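(* For $i=1,2$, let $G_i$ be an essentially principal étale groupoid whose unit space is a Cantor set and suppose that $G_i$ is minimal. The following conditions are equivalent. (1) $G_1$ and $G_2$ are isomorphic as étale groupoids. (2) $[[G_1]]$ and $[[G_2]]$ are isomorphic as discrete groups. (3) $[[G_1]]_0$ and $[[G_2]]_0$ are isomorphic as discrete groups. (4) $D([[G_1]])$ and $D([[G_2]])$ are isomorphic as discrete groups.
   Context: A Cantor set is a (non-empty) compact, metrizable, totally disconnected space with no isolated points. An étale groupoid is a second countable locally compact Hausdorff topological groupoid $G$ whose range map is a local homeomorphism; an isomorphism of étale groupoids is a groupoid isomorphism that is a homeomorphism. $G^{(0)}$ is the unit space, $s,r$ are the source and range maps, and $gh$ is defined when $s(g)=r(h)$. The $G$-orbit of $x\in G^{(0)}$ is $\{r(g)\mid g\in G,\ s(g)=x\}$; $G$ is minimal if every $G$-orbit is dense in $G^{(0)}$. $G$ is essentially principal if the interior of $\{g\in G\mid r(g)=s(g)\}$ is $G^{(0)}$. A $G$-set is a subset $U\subset G$ such that $r|U$ and $s|U$ are injective; for an open $G$-set $U$, $\pi_U=r\circ(s|U)^{-1}:s(U)\to r(U)$ (a homeomorphism). When $G^{(0)}$ is compact, the topological full group $[[G]]$ is the group of all $\alpha\in\mathrm{Homeo}(G^{(0)})$ for which there is a compact open $G$-set $U$ with $\alpha=\pi_U$ (so $s(U)=r(U)=G^{(0)}$); when $G$ is essentially principal this $U$ is unique. $D(\Gamma)$ denotes the commutator subgroup of a group $\Gamma$. Homology: $C_c(Y,\mathbb{Z})$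 is the group of compactly supported continuous functions $Y\to\mathbb{Z}$. For a local homeomorphism $\pi:Y\to Z$, $\pi_*:C_c(Y,\mathbb{Z})\to C_c(Z,\mathbb{Z})$ is $\pi_*(f)(z)=\sum_{\pi(y)=z}f(y)$. Let $G^{(2)}$ be the space of pairs $(g_1,g_2)$ with $s(g_1)=r(g_2)$, and $d_0(g_1,g_2)=g_2$, $d_1(g_1,g_2)=g_1g_2$, $d_2(g_1,g_2)=g_1$. Put $\delta_1=s_*-r_*:C_c(G,\mathbb{Z})\to C_c(G^{(0)},\mathbb{Z})$ and $\delta_2=d_{0*}-d_{1*}+d_{2*}:C_c(G^{(2)},\mathbb{Z})\to C_c(G,\mathbb{Z})$. Then $H_1(G)=\ker\delta_1/\mathrm{Im}\,\delta_2$. The index map is the homomorphism $I:[[G]]\to H_1(G)$, $I(\pi_U)=[1_U]$, where $1_U$ is the characteristic function of the compact open $G$-set $U$, and $[[G]]_0=\ker I$. *)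

theory Defs
  imports "HOL-Algebra.Bij" "HOL-Algebra.Generated_Groups" "HOL-Analysis.Analysis"
begin

no_notation eq_closure_of (\<open>closure'_of\<index>\<close>)
  \<comment> \<open>would make the topological \<open>closure_of\<close> ambiguous\<close>

section \<open>Topological notions\<close>

definition cantor_set :: "'a topology \<Rightarrow> bool" where
  "cantor_set X \<longleftrightarrow>
     topspace X \<noteq> {} \<and> compact_space X \<and> metrizable_space X \<and>
     (\<forall>C. connectedin X C \<longrightarrow> (\<exists>x. C \<subseteq> {x})) \<and>
     (\<forall>x \<in> topspace X. \<not> openin X {x})"

definition local_homeomorphism :: "'a topology \<Rightarrow> 'b topology \<Rightarrow> ('a \<Rightarrow> 'b) \<Rightarrow> bool" where
  "local_homeomorphism Y Z f \<longleftrightarrow>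
     (\<forall>y \<in> topspace Y. \<exists>U. openin Y U \<and> y \<in> U \<and> openin Z (f ` U) \<and>
        homeomorphic_map (subtopology Y U) (subtopology Z (f ` U)) f)"

section \<open>Etale groupoids\<close>

text \<open>The arrows are the points of the topology \<open>arr_top\<close>; the operations are only meaningful on
  arrows, and \<open>gmult g h\<close> only when \<open>src g = rng h\<close>. Units are identified with identity arrows.\<close>

record 'a top_groupoid =
  arr_top :: "'a topology"
  src :: "'a \<Rightarrow> 'a"
  rng :: "'a \<Rightarrow> 'a"
  gmult :: "'a \<Rightarrow> 'a \<Rightarrow> 'a"
  ginv :: "'a \<Rightarrow> 'a"

definition arrows :: "'a top_groupoid \<Rightarrow> 'a set" where
  "arrows G = topspace (arr_top G)"

definition units :: "'a top_groupoid \<Rightarrow> 'a set" where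
  "units G = src G ` arrows G"

definition unit_space :: "'a top_groupoid \<Rightarrow> 'a topology" where
  "unit_space G = subtopology (arr_top G) (units G)"

definition composable :: "'a top_groupoid \<Rightarrow> ('a \<times> 'a) set" where
  "composable G = {(g, h). g \<in> arrows G \<and> h \<in> arrows G \<and> src G g = rng G h}"

definition composable_space :: "'a top_groupoid \<Rightarrow> ('a \<times> 'a) topology" where
  "composable_space G = subtopology (prod_topology (arr_top G) (arr_top G)) (composable G)"

locale groupoid =
  fixes G :: "'a top_groupoid"
  assumes src_closed: "g \<in> arrows G \<Longrightarrow> src G g \<in> arrows G"
    and rng_closed: "g \<in> arrows G \<Longrightarrow> rng G g \<in> arrows G"
    and src_src: "g \<in> arrows G \<Longrightarrow> src G (src G g) = src G g"
    and rng_src: "g \<in> arrows G \<Longrightarrow> rng G (src G g) = src G g"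
    and src_rng: "g \<in> arrows G \<Longrightarrow> src G (rng G g) = rng G g"
    and rng_rng: "g \<in> arrows G \<Longrightarrow> rng G (rng G g) = rng G g"
    and mult_closed: "(g, h) \<in> composable G \<Longrightarrow> gmult G g h \<in> arrows G"
    and src_mult: "(g, h) \<in> composable G \<Longrightarrow> src G (gmult G g h) = src G h"
    and rng_mult: "(g, h) \<in> composable G \<Longrightarrow> rng G (gmult G g h) = rng G g"
    and mult_assoc: "\<lbrakk>(g, h) \<in> composable G; (h, k) \<in> composable G\<rbrakk> \<Longrightarrow>
      gmult G (gmult G g h) k = gmult G g (gmult G h k)"
    and mult_src: "g \<in> arrows G \<Longrightarrow> gmult G g (src G g) = g"
    and rng_mult_id: "g \<in> arrows G \<Longrightarrow> gmult G (rng G g) g = g"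
    and inv_closed: "g \<in> arrows G \<Longrightarrow> ginv G g \<in> arrows G"
    and src_inv: "g \<in> arrows G \<Longrightarrow> src G (ginv G g) = rng G g"
    and rng_inv: "g \<in> arrows G \<Longrightarrow> rng G (ginv G g) = src G g"
    and inv_mult: "g \<in> arrows G \<Longrightarrow> gmult G (ginv G g) g = src G g"
    and mult_inv: "g \<in> arrows G \<Longrightarrow> gmult G g (ginv G g) = rng G g"

locale etale_groupoid = groupoid +
  assumes second_countable: "second_countable (arr_top G)"
    and locally_compact: "locally_compact_space (arr_top G)"
    and Hausdorff: "Hausdorff_space (arr_top G)"
    and continuous_mult:
      "continuous_map (composable_space G) (arr_top G) (\<lambda>(g, h). gmult G g h)"
    and continuous_inv: "continuous_map (arr_top G) (arr_top G) (ginv G)"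
    and etale: "local_homeomorphism (arr_top G) (unit_space G) (rng G)"

definition groupoid_hom :: "'a top_groupoid \<Rightarrow> 'b top_groupoid \<Rightarrow> ('a \<Rightarrow> 'b) \<Rightarrow> bool" where
  "groupoid_hom G H \<phi> \<longleftrightarrow>
     \<phi> ` arrows G \<subseteq> arrows H \<and>
     (\<forall>(g, h) \<in> composable G.
        (\<phi> g, \<phi> h) \<in> composable H \<and> \<phi> (gmult G g h) = gmult H (\<phi> g) (\<phi> h))"

definition etale_isomorphic :: "'a top_groupoid \<Rightarrow> 'b top_groupoid \<Rightarrow> bool" where
  "etale_isomorphic G H \<longleftrightarrow>
     (\<exists>\<phi> \<psi>. homeomorphic_maps (arr_top G) (arr_top H) \<phi> \<psi> \<and>
        groupoid_hom G H \<phi> \<and> groupoid_hom H G \<psi>)"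

definition orbit :: "'a top_groupoid \<Rightarrow> 'a \<Rightarrow> 'a set" where
  "orbit G x = {rng G g | g. g \<in> arrows G \<and> src G g = x}"

definition minimal_groupoid :: "'a top_groupoid \<Rightarrow> bool" where
  "minimal_groupoid G \<longleftrightarrow> (\<forall>x \<in> units G. unit_space G closure_of orbit G x = units G)"

definition essentially_principal :: "'a top_groupoid \<Rightarrow> bool" where
  "essentially_principal G \<longleftrightarrow>
     arr_top G interior_of {g \<in> arrows G. rng G g = src G g} = units G"

section \<open>The topological full group\<close>

definition G_set :: "'a top_groupoid \<Rightarrow> 'a set \<Rightarrow> bool" where
  "G_set G U \<longleftrightarrow> U \<subseteq> arrows G \<and> inj_on (rng G) U \<and> inj_on (src G) U"

definition pi_map :: "'a top_groupoid \<Rightarrow> 'a set \<Rightarrow> 'a \<Rightarrow> 'a" where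
  "pi_map G U = restrict (rng G \<circ> inv_into U (src G)) (src G ` U)"

text \<open>The condition \<open>src G ` U = units G\<close> says that \<open>\<alpha>\<close> and \<open>pi_map G U\<close> have the same domain, which
  for partial maps coded as extensional functions does not follow from their equality.\<close>

definition induces :: "'a top_groupoid \<Rightarrow> 'a set \<Rightarrow> ('a \<Rightarrow> 'a) \<Rightarrow> bool" where
  "induces G U \<alpha> \<longleftrightarrow>
     compactin (arr_top G) U \<and> openin (arr_top G) U \<and> G_set G U \<and>
     src G ` U = units G \<and> \<alpha> = pi_map G U"

definition full_group :: "'a top_groupoid \<Rightarrow> ('a \<Rightarrow> 'a) monoid" where
  "full_group G = (BijGroup (units G))
     \<lparr>carrier := {\<alpha> \<in> Bij (units G).
        homeomorphic_map (unit_space G) (unit_space G) \<alpha> \<and> (\<exists>U. induces G U \<alpha>)}\<rparr>"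

definition commutator_subgroup :: "'g monoid \<Rightarrow> 'g monoid" where
  "commutator_subgroup \<Gamma> = \<Gamma>\<lparr>carrier := derived \<Gamma> (carrier \<Gamma>)\<rparr>"

section \<open>First homology and the index map\<close>

text \<open>Functions on a space \<open>Y\<close> are coded as functions on the whole type that vanish off
  \<open>topspace Y\<close>.\<close>

definition Cc_group :: "'a topology \<Rightarrow> ('a \<Rightarrow> int) monoid" where
  "Cc_group Y =
     \<lparr>carrier = {f. continuous_map Y (discrete_topology UNIV) f \<and>
                    compactin Y (Y closure_of {y \<in> topspace Y. f y \<noteq> 0}) \<and>
                    (\<forall>y. y \<notin> topspace Y \<longrightarrow> f y = 0)},
      monoid.mult = (\<lambda>f g y. f y + g y),
      one = (\<lambda>y. 0)\<rparr>"

text \<open>A fibre of a local homeomorphism may be infinite, but it is discrete, so it meets the support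
  of \<open>f\<close> in a finite set; the sum is restricted to that set because \<open>sum\<close> is zero on infinite
  index sets.\<close>

definition pushforward :: "'a topology \<Rightarrow> ('a \<Rightarrow> 'b) \<Rightarrow> ('a \<Rightarrow> int) \<Rightarrow> 'b \<Rightarrow> int" where
  "pushforward Y p f z = (\<Sum>y \<in> {y \<in> topspace Y. p y = z \<and> f y \<noteq> 0}. f y)"

definition delta1 :: "'a top_groupoid \<Rightarrow> ('a \<Rightarrow> int) \<Rightarrow> 'a \<Rightarrow> int" where
  "delta1 G f x = pushforward (arr_top G) (src G) f x - pushforward (arr_top G) (rng G) f x"

definition delta2 :: "'a top_groupoid \<Rightarrow> ('a \<times> 'a \<Rightarrow> int) \<Rightarrow> 'a \<Rightarrow> int" where
  "delta2 G f x =
     pushforward (composable_space G) snd f x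
     - pushforward (composable_space G) (\<lambda>(g, h). gmult G g h) f x
     + pushforward (composable_space G) fst f x"

definition cycles1 :: "'a top_groupoid \<Rightarrow> ('a \<Rightarrow> int) monoid" where
  "cycles1 G = (Cc_group (arr_top G))
     \<lparr>carrier := kernel (Cc_group (arr_top G)) (Cc_group (unit_space G)) (delta1 G)\<rparr>"

definition boundaries1 :: "'a top_groupoid \<Rightarrow> ('a \<Rightarrow> int) set" where
  "boundaries1 G = delta2 G ` carrier (Cc_group (composable_space G))"

definition H1 :: "'a top_groupoid \<Rightarrow> ('a \<Rightarrow> int) set monoid" where
  "H1 G = cycles1 G Mod boundaries1 G"

text \<open>The definite description is justified only for essentially principal \<open>G\<close>, where \<open>U\<close> is
  determined by \<open>\<alpha>\<close>.\<close>

definition index_map :: "'a top_groupoid \<Rightarrow> ('a \<Rightarrow> 'a) \<Rightarrow> ('a \<Rightarrow> int) set" where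
  "index_map G \<alpha> = boundaries1 G #>\<^bsub>cycles1 G\<^esub> indicator (THE U. induces G U \<alpha>)"

definition full_group0 :: "'a top_groupoid \<Rightarrow> ('a \<Rightarrow> 'a) monoid" where
  "full_group0 G = (full_group G)\<lparr>carrier := kernel (full_group G) (H1 G) (index_map G)\<rparr>"

end

theory Submission
  imports Defs
begin

text \<open>A groupoid isomorphism transports everything, so the point is to recover the groupoid from any
  group \<open>\<Gamma>\<close> between \<open>D([[G]])\<close> and \<open>[[G]]\<close>. By minimality, an arrow \<open>g\<close> with \<open>s(g) \<noteq> r(g)\<close> factors
  through a third point as \<open>g = b a\<close>, and it lies in the commutator of the two involutions that exchange
  the ends of small bisections around \<open>a\<close> and \<open>b\<close>, a 3-cycle supported near the three points; the
  remaining arrows are products of such. Hence the subgroup of \<open>\<Gamma>\<close> supported in an open set \<open>U\<close> has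
  dense orbits in \<open>U\<close>, and Rubin's theorem (with the proof of Belk, Elliott and Matucci) shows that a
  group isomorphism is implemented by a homeomorphism of the unit spaces. The bisections in \<open>\<Gamma>\<close> cover
  \<open>G\<close>, and by essential principality an arrow of a bisection is determined by the germ of the induced
  homeomorphism, so the homeomorphism lifts to the groupoids.\<close>

section \<open>Locally dense group actions\<close>

text \<open>Rubin's theorem must extract points from multiplication alone. Disjoint supports imply
  commutation but not conversely, so commutation is tested under local perturbation: iterated
  commutators trap supports in a few small sets, and a fixed power excludes the short recurrences
  that this test cannot see. The outcome is a relation, definable in the group, that says when
  \<open>support h\<close> lies in the regular open set \<open>core f\<close>. A point is then the
  family of all cores around it, and compactness turns that family into a point of the other space.
  The groups are modelled by full open bisections rather than by homeomorphisms, so that an arrow is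
  a member of a group element: multiplying bisections multiplies arrows, and lifting the
  homeomorphism amounts to reading off the arrow over a point. For the kernel of the index the
  homological input is one identity: the indicator of the composable pairs in
  \<open>U \<times> V\<close> has boundary 1_V - 1_{UV} + 1_U. It makes the kernel a subgroup that
  contains all commutators.\<close>

lemma openin_Diff_finite:
  assumes "Hausdorff_space X" "openin X U" "finite F"
  shows "openin X (U - F)"
proof -
  have "closedin X (F \<inter> topspace X)"
    using assms Hausdorff_imp_t1_space t1_space_closedin_finite by (metis Int_lower2 finite_Int)
  moreover have "U - F = U - (F \<inter> topspace X)" using assms(2) openin_subset by fastforce
  ultimately show ?thesis using assms by auto
qed

text \<open>Deleting all but one point of a finite open set would leave an open singleton.\<close>

lemma open_Diff_finite_nonempty:
  assumes "Hausdorff_space X" "\<And>x. x \<in> topspace X \<Longrightarrow> \<not> openin X {x}"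
    and U: "openin X U" "U \<noteq> {}" and F: "finite F"
  shows "U - F \<noteq> {}"
proof
  assume "U - F = {}"
  obtain x where x: "x \<in> U" using U by blast
  have "U - (F - {x}) = {x}" using \<open>U - F = {}\<close> x by blast
  then show False
    using openin_Diff_finite[OF assms(1) U(1), of "F - {x}"] F x U(1) assms(2) openin_subset
    by fastforce
qed

section \<open>Algebraic counterparts of conditions on supports\<close>

context group
begin

definition commutator :: "'a \<Rightarrow> 'a \<Rightarrow> 'a" where
  "commutator g h = g \<otimes> h \<otimes> inv g \<otimes> inv h"

text \<open>Algebraic shadows of \<open>supp f \<inter> supp g = {}\<close> and of
  \<open>supp h \<subseteq> int (cl (supp f))\<close>. The exponent is \<open>12 = lcm(1,2,3,4)\<close>: a point moved by \<open>g\<^sup>1\<^sup>2\<close> has at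
  least five distinct translates under powers of \<open>g\<close>, whereas the iterated commutator is supported in
  four translates of the support of \<open>h\<close>.\<close>

definition alg_disjoint :: "'a \<Rightarrow> 'a \<Rightarrow> bool" where
  "alg_disjoint f g \<longleftrightarrow> (\<forall>h\<in>carrier G. f \<otimes> h \<noteq> h \<otimes> f \<longrightarrow>
     (\<exists>f1\<in>carrier G. \<exists>f2\<in>carrier G. f1 \<otimes> g = g \<otimes> f1 \<and> f2 \<otimes> g = g \<otimes> f2 \<and>
        commutator f1 (commutator f2 h) \<noteq> \<one> \<and>
        commutator f1 (commutator f2 h) \<otimes> g = g \<otimes> commutator f1 (commutator f2 h)))"

definition below :: "'a \<Rightarrow> 'a \<Rightarrow> bool" where
  "below h f \<longleftrightarrow>
     (\<forall>g\<in>carrier G. alg_disjoint f g \<longrightarrow> h \<otimes> g [^] (12::nat) = g [^] (12::nat) \<otimes> h)"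

lemma commutator_closed [simp]:
  "\<lbrakk>g \<in> carrier G; h \<in> carrier G\<rbrakk> \<Longrightarrow> commutator g h \<in> carrier G"
  by (simp add: commutator_def)

lemma inv_commute:
  assumes "a \<in> carrier G" "g \<in> carrier G" "a \<otimes> g = g \<otimes> a"
  shows "inv a \<otimes> g = g \<otimes> inv a"
  using assms by (metis inv_closed inv_solve_left inv_solve_right m_assoc m_closed)

lemma mult_commute:
  assumes "a \<in> carrier G" "b \<in> carrier G" "g \<in> carrier G" "a \<otimes> g = g \<otimes> a" "b \<otimes> g = g \<otimes> b"
  shows "a \<otimes> b \<otimes> g = g \<otimes> (a \<otimes> b)"
  using assms by (metis m_assoc)

lemma pow_commute:
  assumes "a \<in> carrier G" "g \<in> carrier G" "a \<otimes> g = g \<otimes> a"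
  shows "a \<otimes> g [^] (n::nat) = g [^] n \<otimes> a"
proof (induction n)
  case (Suc n)
  have "a \<otimes> g [^] Suc n = g [^] n \<otimes> a \<otimes> g"
    using assms Suc by (simp flip: m_assoc)
  then show ?case using assms by (simp add: m_assoc)
qed (use assms in simp)

lemma commutator_eq_one_iff:
  assumes "a \<in> carrier G" "b \<in> carrier G"
  shows "commutator a b = \<one> \<longleftrightarrow> a \<otimes> b = b \<otimes> a"
proof -
  have "commutator a b = a \<otimes> b \<otimes> inv (b \<otimes> a)"
    using assms by (simp add: commutator_def inv_mult_group m_assoc)
  then show ?thesis
    using assms inv_solve_right[of \<one> "a \<otimes> b" "b \<otimes> a"] by (simp add: eq_commute)
qed

text \<open>Collapses an iterated commutator: \<open>commutator f2 h\<close> is \<open>f2\<close>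
  times a conjugate of its inverse, and \<open>f1\<close> does not see that conjugate when they
  commute.\<close>

lemma commutator_mult_commuting:
  assumes "a \<in> carrier G" "b \<in> carrier G" "q \<in> carrier G" "a \<otimes> q = q \<otimes> a"
  shows "commutator a (b \<otimes> q) = commutator a b"
proof -
  have "commutator a (b \<otimes> q) = a \<otimes> b \<otimes> (q \<otimes> inv a) \<otimes> inv q \<otimes> inv b"
    using assms by (simp add: commutator_def inv_mult_group m_assoc)
  also have "q \<otimes> inv a = inv a \<otimes> q"
    using inv_commute assms by simp
  also have "a \<otimes> b \<otimes> (inv a \<otimes> q) \<otimes> inv q \<otimes> inv b = commutator a b"
    using assms by (simp add: commutator_def m_assoc inv_solve_left flip: m_assoc[of q])
  finally show ?thesis .
qed

end

section \<open>Supports and displacement in a locally dense action\<close>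

text \<open>In \<open>locally_dense\<close> the elements supported in \<open>U\<close> move each
  point of \<open>U\<close> densely through all of \<open>U\<close>, which is what minimality of the
  groupoid supplies; Rubin's condition only asks that the closure of such an orbit have
  interior.\<close>

locale locally_dense_action = group +
  fixes X :: "'x topology" and act :: "'a \<Rightarrow> 'x \<Rightarrow> 'x"
  assumes act_closed: "\<lbrakk>g \<in> carrier G; x \<in> topspace X\<rbrakk> \<Longrightarrow> act g x \<in> topspace X"
    and act_one: "x \<in> topspace X \<Longrightarrow> act \<one> x = x"
    and act_mult: "\<lbrakk>g \<in> carrier G; h \<in> carrier G; x \<in> topspace X\<rbrakk> \<Longrightarrow> act (g \<otimes> h) x = act g (act h x)"
    and faithful: "\<lbrakk>g \<in> carrier G; \<And>x. x \<in> topspace X \<Longrightarrow> act g x = x\<rbrakk> \<Longrightarrow> g = \<one>"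
    and act_continuous: "g \<in> carrier G \<Longrightarrow> continuous_map X X (act g)"
    and Hausdorff: "Hausdorff_space X"
    and compact: "compact_space X"
    and no_isolated_points: "x \<in> topspace X \<Longrightarrow> \<not> openin X {x}"
    and locally_dense: "\<lbrakk>openin X U; x \<in> U; openin X W; W \<subseteq> U; W \<noteq> {}\<rbrakk> \<Longrightarrow>
      \<exists>k\<in>carrier G. (\<forall>y\<in>topspace X - U. act k y = y) \<and> act k x \<in> W"
begin

definition support :: "'a \<Rightarrow> 'x set" where
  "support g = {x \<in> topspace X. act g x \<noteq> x}"

text \<open>The regular open hull of the support. Commutation with elements living off
  \<open>support f\<close> sees only the closure, so this hull, and not the support, is what the
  group determines.\<close>

definition core :: "'a \<Rightarrow> 'x set" where
  "core g = X interior_of (X closure_of support g)"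

lemma act_inv_act [simp]:
  "\<lbrakk>g \<in> carrier G; x \<in> topspace X\<rbrakk> \<Longrightarrow> act (inv g) (act g x) = x"
  by (metis act_mult act_one inv_closed l_inv)

lemma act_act_inv [simp]:
  "\<lbrakk>g \<in> carrier G; x \<in> topspace X\<rbrakk> \<Longrightarrow> act g (act (inv g) x) = x"
  by (metis act_mult act_one inv_closed r_inv)

lemma act_inject:
  "\<lbrakk>g \<in> carrier G; x \<in> topspace X; y \<in> topspace X\<rbrakk> \<Longrightarrow> act g x = act g y \<longleftrightarrow> x = y"
  by (metis act_inv_act)

lemma act_ext:
  assumes "g \<in> carrier G" "h \<in> carrier G" "\<And>x. x \<in> topspace X \<Longrightarrow> act g x = act h x"
  shows "g = h"
proof -
  have "inv h \<otimes> g = \<one>"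
    using assms by (intro faithful) (simp_all add: act_mult)
  then show ?thesis
    using assms by (metis inv_closed inv_equality inv_inv)
qed

lemma homeomorphic_act: "g \<in> carrier G \<Longrightarrow> homeomorphic_map X X (act g)"
  unfolding homeomorphic_map_maps homeomorphic_maps_def
  by (rule exI[of _ "act (inv g)"]) (simp add: act_continuous)

lemma support_subset: "support g \<subseteq> topspace X"
  by (auto simp: support_def)

lemma openin_support:
  assumes "g \<in> carrier G" shows "openin X (support g)"
proof -
  have "closedin X {x \<in> topspace X. act g x = x}"
    using closedin_continuous_maps_eq[OF Hausdorff act_continuous[OF assms], of "\<lambda>x. x"] by simp
  moreover have "support g = topspace X - {x \<in> topspace X. act g x = x}"
    by (auto simp: support_def)
  ultimately show ?thesis by auto
qed

lemma support_empty_iff: "g \<in> carrier G \<Longrightarrow> support g = {} \<longleftrightarrow> g = \<one>"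
  using faithful act_one by (auto simp: support_def)

lemma support_act: "\<lbrakk>g \<in> carrier G; x \<in> support g\<rbrakk> \<Longrightarrow> act g x \<in> support g"
  by (auto simp: support_def act_closed act_inject)

lemma act_preserves:
  assumes "g \<in> carrier G" "support g \<subseteq> U" "x \<in> U" "U \<subseteq> topspace X"
  shows "act g x \<in> U"
proof (cases "x \<in> support g")
  case True
  then show ?thesis using assms support_act by blast
next
  case False
  then have "act g x = x" using assms by (auto simp: support_def)
  then show ?thesis using assms by simp
qed

lemma support_mult:
  "\<lbrakk>g \<in> carrier G; h \<in> carrier G\<rbrakk> \<Longrightarrow> support (g \<otimes> h) \<subseteq> support g \<union> support h"
  by (auto simp: support_def act_mult)

lemma support_inv: "g \<in> carrier G \<Longrightarrow> support (inv g) = support g"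
  unfolding support_def by (metis act_act_inv act_inv_act)

lemma support_conj:
  assumes "g \<in> carrier G" "h \<in> carrier G"
  shows "support (g \<otimes> h \<otimes> inv g) = act g ` support h"
proof (intro equalityI subsetI)
  fix x assume x: "x \<in> support (g \<otimes> h \<otimes> inv g)"
  let ?y = "act (inv g) x"
  have "act g (act h ?y) \<noteq> x" and xX: "x \<in> topspace X"
    using x assms by (auto simp: support_def act_mult act_closed)
  then have "act h ?y \<noteq> ?y"
    using assms by auto
  then have "?y \<in> support h"
    using assms xX by (auto simp: support_def act_closed)
  moreover have "x = act g ?y" using assms xX by simp
  ultimately show "x \<in> act g ` support h" by blast
next
  fix x assume "x \<in> act g ` support h"
  then show "x \<in> support (g \<otimes> h \<otimes> inv g)"
    using assms by (auto simp: support_def act_mult act_closed act_inject)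
qed

lemma disjoint_support_commute:
  assumes "g \<in> carrier G" "h \<in> carrier G" "support g \<inter> support h = {}"
  shows "g \<otimes> h = h \<otimes> g"
proof (rule act_ext)
  fix x assume x: "x \<in> topspace X"
  consider "x \<in> support g" "x \<notin> support h" | "x \<notin> support g" "x \<in> support h"
    | "x \<notin> support g" "x \<notin> support h"
    using assms by blast
  then have "act g (act h x) = act h (act g x)"
  proof cases
    case 1
    then have "act g x \<notin> support h" using support_act assms by blast
    then show ?thesis using 1 x assms by (auto simp: support_def act_closed)
  next
    case 2
    then have "act h x \<notin> support g" using support_act assms by blast
    then show ?thesis using 2 x assms by (auto simp: support_def act_closed)
  next
    case 3
    then show ?thesis using x by (auto simp: support_def)
  qed
  then show "act (g \<otimes> h) x = act (h \<otimes> g) x"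
    using assms x by (simp add: act_mult)
qed (use assms in auto)

lemma Diff_finite_nonempty: "\<lbrakk>openin X U; U \<noteq> {}; finite F\<rbrakk> \<Longrightarrow> U - F \<noteq> {}"
  by (rule open_Diff_finite_nonempty[OF Hausdorff no_isolated_points])

lemma move_into:
  assumes "openin X U" "x \<in> U" "openin X W" "W \<subseteq> U" "W \<noteq> {}"
  obtains k where "k \<in> carrier G" "support k \<subseteq> U" "act k x \<in> W"
  using locally_dense[OF assms] by (auto simp: support_def)

text \<open>Local density is applied with target \<open>U - {x}\<close>, nonempty because no point
  is isolated, so the element found really moves \<open>x\<close>.\<close>

lemma move_within:
  assumes "openin X U" "x \<in> U"
  obtains k where "k \<in> carrier G" "support k \<subseteq> U" "x \<in> support k"
proof -
  have "U - {x} \<noteq> {}" "openin X (U - {x})"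
    using assms Diff_finite_nonempty[of U "{x}"] openin_Diff_finite[OF Hausdorff] by auto
  then obtain k where k: "k \<in> carrier G" "support k \<subseteq> U" "act k x \<in> U - {x}"
    using move_into[OF assms] by blast
  then have "x \<in> support k"
    using openin_subset[OF assms(1)] assms(2) by (auto simp: support_def)
  with k that show thesis by blast
qed

lemma displace:
  assumes "g \<in> carrier G" "x \<in> support g" "openin X V" "x \<in> V"
  obtains U where "openin X U" "x \<in> U" "U \<subseteq> V" "act g ` U \<inter> U = {}"
proof -
  have "x \<in> topspace X" "act g x \<in> topspace X" "x \<noteq> act g x"
    using assms by (auto simp: support_def act_closed)
  then obtain A B where AB: "openin X A" "openin X B" "x \<in> A" "act g x \<in> B" "A \<inter> B = {}"
    using Hausdorff unfolding Hausdorff_space_def disjnt_def by metis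
  let ?U = "V \<inter> A \<inter> {y \<in> topspace X. act g y \<in> B}"
  have "openin X ?U"
    using AB assms openin_continuous_map_preimage[OF act_continuous] by auto
  then show thesis
    by (rule that) (use AB assms \<open>x \<in> topspace X\<close> in auto)
qed

lemma displace_finite:
  assumes "finite T" "T \<subseteq> carrier G" "\<And>t. t \<in> T \<Longrightarrow> x \<in> support t" "openin X V" "x \<in> V"
  shows "\<exists>U. openin X U \<and> x \<in> U \<and> U \<subseteq> V \<and> (\<forall>t\<in>T. act t ` U \<inter> U = {})"
  using assms
proof (induction T rule: finite_induct)
  case empty
  then show ?case by blast
next
  case (insert t T)
  have "\<exists>U. openin X U \<and> x \<in> U \<and> U \<subseteq> V \<and> (\<forall>t\<in>T. act t ` U \<inter> U = {})"
    by (rule insert.IH) (use insert.prems in auto)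
  then obtain U where U: "openin X U" "x \<in> U" "U \<subseteq> V" "\<forall>t\<in>T. act t ` U \<inter> U = {}"
    by blast
  have t: "t \<in> carrier G" "x \<in> support t" using insert.prems by auto
  obtain U' where U': "openin X U'" "x \<in> U'" "U' \<subseteq> U" "act t ` U' \<inter> U' = {}"
    using displace[OF t U(1,2)] by blast
  have "act s ` U' \<inter> U' = {}" if "s \<in> insert t T" for s
  proof (cases "s = t")
    case False
    then have "act s ` U \<inter> U = {}" using that U(4) by simp
    then show ?thesis using U'(3) by blast
  qed (use U' in simp)
  then show ?case using U(3) U'(1,2,3) by (intro exI[of _ U']) auto
qed

text \<open>Let \<open>f1\<close> displace a neighbourhood \<open>V\<close> of \<open>x\<close>. An
  \<open>f2\<close> supported in \<open>V\<close> and moving \<open>x\<close> fixes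
  \<open>act f1 x\<close>, whereas its conjugate by \<open>f1\<close> moves that point.\<close>

lemma noncommuting_pair:
  assumes "openin X U" "x \<in> U"
  obtains f1 f2 where "f1 \<in> carrier G" "f2 \<in> carrier G" "support f1 \<subseteq> U" "support f2 \<subseteq> U"
    "f1 \<otimes> f2 \<noteq> f2 \<otimes> f1"
proof -
  obtain f1 where f1: "f1 \<in> carrier G" "support f1 \<subseteq> U" "x \<in> support f1"
    using move_within assms by blast
  obtain V where V: "openin X V" "x \<in> V" "V \<subseteq> U" "act f1 ` V \<inter> V = {}"
    using displace[OF f1(1,3) assms] by blast
  obtain f2 where f2: "f2 \<in> carrier G" "support f2 \<subseteq> V" "x \<in> support f2"
    using move_within V by blast
  have x: "x \<in> topspace X" "act f2 x \<noteq> x" using f2 by (auto simp: support_def)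
  have "act f1 x \<notin> support f2" using V f2 by blast
  then have "act (f2 \<otimes> f1) x = act f1 x"
    using f1 f2 x by (auto simp: support_def act_mult act_closed)
  moreover have "act (f1 \<otimes> f2) x \<noteq> act f1 x"
    using f1 f2 x by (simp add: act_mult act_inject act_closed)
  ultimately have "f1 \<otimes> f2 \<noteq> f2 \<otimes> f1" by metis
  then show thesis using that f1 f2 V by blast
qed

section \<open>Disjoint supports recognised in the group\<close>

text \<open>The witnesses for \<open>h\<close> are two noncommuting elements on a set
  \<open>U\<close> inside \<open>support f\<close> that \<open>h\<close> displaces. In
  \<open>commutator f2 h\<close> the factor after \<open>f2\<close> lives on the displaced copy of
  \<open>U\<close> and commutes with \<open>f1\<close>, so the double commutator reduces to
  \<open>commutator f1 f2\<close>, and all of this happens away from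
  \<open>support g\<close>.\<close>

lemma alg_disjoint_if_disjoint_support:
  assumes f: "f \<in> carrier G" and g: "g \<in> carrier G" and dis: "support f \<inter> support g = {}"
  shows "alg_disjoint f g"
  unfolding alg_disjoint_def
proof (intro ballI impI)
  fix h assume h: "h \<in> carrier G" and nc: "f \<otimes> h \<noteq> h \<otimes> f"
  then obtain x where x: "x \<in> support f" "x \<in> support h"
    using disjoint_support_commute f by blast
  obtain U where U: "openin X U" "x \<in> U" "U \<subseteq> support f" "act h ` U \<inter> U = {}"
    using displace[OF h x(2) openin_support[OF f] x(1)] by blast
  obtain f1 f2 where f12: "f1 \<in> carrier G" "f2 \<in> carrier G" "support f1 \<subseteq> U" "support f2 \<subseteq> U"
    "f1 \<otimes> f2 \<noteq> f2 \<otimes> f1"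
    using noncommuting_pair U by blast
  let ?q = "h \<otimes> inv f2 \<otimes> inv h"
  have q: "?q \<in> carrier G" using h f12 by simp
  have "support ?q = act h ` support f2"
    using support_conj h f12 support_inv by simp
  then have "f1 \<otimes> ?q = ?q \<otimes> f1"
    using U f12 h by (intro disjoint_support_commute) (auto, blast)
  then have eq: "commutator f1 (commutator f2 h) = commutator f1 f2"
    using commutator_mult_commuting[OF f12(1,2) q] f12 h by (simp add: commutator_def m_assoc)
  have c1: "f1 \<otimes> g = g \<otimes> f1" and c2: "f2 \<otimes> g = g \<otimes> f2"
    using U f12 dis g by (auto intro!: disjoint_support_commute)
  have c3: "commutator f1 f2 \<otimes> g = g \<otimes> commutator f1 f2"
    unfolding commutator_def using c1 c2 f12 g
    by (intro mult_commute inv_commute) auto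
  show "\<exists>f1\<in>carrier G. \<exists>f2\<in>carrier G. f1 \<otimes> g = g \<otimes> f1 \<and> f2 \<otimes> g = g \<otimes> f2 \<and>
        commutator f1 (commutator f2 h) \<noteq> \<one> \<and>
        commutator f1 (commutator f2 h) \<otimes> g = g \<otimes> commutator f1 (commutator f2 h)"
    using f12 c1 c2 c3 eq commutator_eq_one_iff by metis
qed

lemma act_pow_closed: "\<lbrakk>g \<in> carrier G; x \<in> topspace X\<rbrakk> \<Longrightarrow> act (g [^] (n::nat)) x \<in> topspace X"
  by (simp add: act_closed)

lemma act_pow_fixed:
  assumes "g \<in> carrier G" "x \<in> topspace X" "act g x = x"
  shows "act (g [^] (n::nat)) x = x"
  by (induction n) (use assms in \<open>simp_all add: act_one act_mult\<close>)

lemma support_pow_dvd: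
  assumes "g \<in> carrier G" "d dvd (n::nat)"
  shows "support (g [^] n) \<subseteq> support (g [^] d)"
proof
  fix x assume x: "x \<in> support (g [^] n)"
  obtain k where "n = d * k" using assms by blast
  then have "g [^] n = (g [^] d) [^] k" using assms nat_pow_pow by simp
  then show "x \<in> support (g [^] d)"
    using x act_pow_fixed[of "g [^] d" x k] assms by (auto simp: support_def)
qed

lemma support_commutator:
  assumes "a \<in> carrier G" "b \<in> carrier G"
  shows "support (commutator a b) \<subseteq> act a ` support b \<union> support b"
proof -
  have "commutator a b = (a \<otimes> b \<otimes> inv a) \<otimes> inv b" by (simp add: commutator_def)
  then show ?thesis
    using support_mult[of "a \<otimes> b \<otimes> inv a" "inv b"] assms by (simp add: support_conj support_inv)
qed

lemma support_commuting_invariant: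
  assumes "k \<in> carrier G" "g \<in> carrier G" "k \<otimes> g = g \<otimes> k" "p \<in> support k"
  shows "act g p \<in> support k"
proof -
  have p: "p \<in> topspace X" "act k p \<noteq> p" using assms by (auto simp: support_def)
  have "act k (act g p) = act g (act k p)"
    using assms p by (metis act_mult)
  then show ?thesis using assms p by (auto simp: support_def act_inject act_closed)
qed

text \<open>Pigeonhole. For \<open>h\<close> supported in a small \<open>U\<close> around a common
  point, the double commutator \<open>k\<close> commutes with \<open>g\<close>, so \<open>g\<close>
  preserves its support; but that support lies in four translates of \<open>U\<close>. Among five
  consecutive points of a \<open>g\<close>-orbit two share a translate, which brings
  \<open>U\<close> back to itself under one of the first four powers of \<open>g\<close>.\<close>

lemma disjoint_support_if_alg_disjoint:
  assumes f: "f \<in> carrier G" and g: "g \<in> carrier G" and dis: "alg_disjoint f g"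
  shows "support f \<inter> support (g [^] (12::nat)) = {}"
proof (rule ccontr)
  assume "\<not> ?thesis"
  then obtain x where xf: "x \<in> support f" and xg: "x \<in> support (g [^] (12::nat))" by blast
  have gd: "x \<in> support (g [^] d)" if "d \<in> {1..4::nat}" for d
  proof -
    have "d = 1 \<or> d = 2 \<or> d = 3 \<or> d = 4" using that by auto
    then have "d dvd 12" by auto
    then show ?thesis using support_pow_dvd g xg by blast
  qed
  \<comment> \<open>Displacement by \<open>f\<close> prevents an \<open>h\<close> that is supported
    in \<open>U\<close> and moves \<open>x\<close> from commuting with \<open>f\<close>.
    Displacement by four powers of \<open>g\<close> is what the pigeonhole argument contradicts,
    since indices from \<open>0\<close> to \<open>4\<close> differ by at most
    \<open>4\<close>.\<close>
  let ?T = "insert f ((\<lambda>d. g [^] d) ` {1..4::nat})"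
  have xX: "x \<in> topspace X" using xf by (simp add: support_def)
  have "\<exists>U. openin X U \<and> x \<in> U \<and> U \<subseteq> topspace X \<and> (\<forall>t\<in>?T. act t ` U \<inter> U = {})"
  proof (rule displace_finite)
    show "x \<in> support t" if "t \<in> ?T" for t using that xf gd by blast
  qed (use f g xX in auto)
  then obtain U where U: "openin X U" "x \<in> U" "U \<subseteq> topspace X"
    and dT: "\<forall>t\<in>?T. act t ` U \<inter> U = {}" by (elim exE conjE)
  have dU: "act t ` U \<inter> U = {}" if "t \<in> ?T" for t using dT that by (rule bspec)
  obtain h where h: "h \<in> carrier G" "support h \<subseteq> U" "x \<in> support h"
    using move_within U by blast
  have "act f x \<notin> U" using dU[of f] U by blast
  then have "act f x \<notin> support h" using h by blast
  then have "act (h \<otimes> f) x = act f x"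
    using h(1) f xX by (simp add: act_mult support_def act_closed)
  moreover have "act (f \<otimes> h) x \<noteq> act f x"
    using h f xX by (auto simp: act_mult support_def act_inject act_closed)
  ultimately have "f \<otimes> h \<noteq> h \<otimes> f" by metis
  then obtain f1 f2 where f12: "f1 \<in> carrier G" "f2 \<in> carrier G"
    "f1 \<otimes> g = g \<otimes> f1" "f2 \<otimes> g = g \<otimes> f2"
    and k1: "commutator f1 (commutator f2 h) \<noteq> \<one>"
    and kg: "commutator f1 (commutator f2 h) \<otimes> g = g \<otimes> commutator f1 (commutator f2 h)"
    using dis h unfolding alg_disjoint_def by blast
  define k where "k = commutator f1 (commutator f2 h)"
  have k: "k \<in> carrier G" "k \<otimes> g = g \<otimes> k" "k \<noteq> \<one>"
    using k1 kg f12 h by (auto simp: k_def)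
  define W where "W = {\<one>, f1, f2, f1 \<otimes> f2}"
  have W: "W \<subseteq> carrier G" "\<And>w. w \<in> W \<Longrightarrow> w \<otimes> g = g \<otimes> w"
    using f12 g mult_commute by (auto simp: W_def)
  have cardW: "finite W" "card W \<le> 4"
    by (auto simp: W_def card_insert_if)
  have supp_k: "support k \<subseteq> (\<Union>w\<in>W. act w ` U)"
  proof -
    have "support (commutator f2 h) \<subseteq> act f2 ` U \<union> U"
      using support_commutator[OF f12(2) h(1)] h(2) by blast
    then have "act f1 ` support (commutator f2 h) \<union> support (commutator f2 h)
        \<subseteq> act f1 ` (act f2 ` U \<union> U) \<union> (act f2 ` U \<union> U)"
      by (intro Un_mono image_mono)
    moreover have "support k \<subseteq> act f1 ` support (commutator f2 h) \<union> support (commutator f2 h)"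
      unfolding k_def using f12 h by (intro support_commutator) auto
    ultimately have "support k \<subseteq> act f1 ` (act f2 ` U \<union> U) \<union> (act f2 ` U \<union> U)"
      by (rule order_trans[rotated])
    moreover have "act f1 ` (act f2 ` U) = act (f1 \<otimes> f2) ` U"
      unfolding image_image using f12 U(3) by (intro image_cong) (auto simp: act_mult)
    moreover have "act \<one> ` U = U"
      using U(3) act_one by (metis image_cong image_ident subsetD)
    ultimately show ?thesis
      unfolding W_def by (simp add: image_Un Un_ac)
  qed
  obtain p where p: "p \<in> support k" using support_empty_iff k by blast
  then have pX: "p \<in> topspace X" by (simp add: support_def)
  have "act (g [^] i) p \<in> support k" for i :: nat
    by (rule support_commuting_invariant) (use p k g in \<open>auto intro: pow_commute\<close>)
  then have "\<forall>i::nat. \<exists>w\<in>W. act (g [^] i) p \<in> act w ` U" using supp_k by blast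
  then obtain c where c: "\<And>i::nat. c i \<in> W" "\<And>i::nat. act (g [^] i) p \<in> act (c i) ` U" by metis
  have "\<not> inj_on c {0..4}"
  proof
    assume "inj_on c {0..4}"
    then have "card (c ` {0..4::nat}) = 5" by (simp add: card_image)
    moreover have "card (c ` {0..4::nat}) \<le> card W"
      using c cardW by (intro card_mono) auto
    ultimately show False using cardW by simp
  qed
  then obtain i j where ij: "i < j" "j \<le> 4" "c i = c j"
    unfolding inj_on_def by (metis atLeastAtMost_iff linorder_neqE_nat)
  define w d where "w = c i" and "d = j - i"
  have w: "w \<in> carrier G" "w \<otimes> g = g \<otimes> w" using c W unfolding w_def by auto
  have d: "d \<in> {1..4}" "j = d + i" using ij by (auto simp: d_def)
  obtain u u' where u: "u \<in> U" "act (g [^] i) p = act w u" and u': "u' \<in> U" "act (g [^] j) p = act w u'"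
    using c[of i] c[of j] ij unfolding w_def by auto
  \<comment> \<open>Every \<open>w\<close> in \<open>W\<close> commutes with \<open>g\<close>, so a
    return of the orbit to the \<open>w\<close>-translate of \<open>U\<close> cancels down to a
    return to \<open>U\<close> itself.\<close>
  have "act (g [^] j) p = act (g [^] d) (act (g [^] i) p)"
    unfolding d(2) using g pX by (simp add: act_mult flip: nat_pow_mult)
  then have "act w u' = act (g [^] d) (act w u)" using u u' by simp
  also have "\<dots> = act (g [^] d \<otimes> w) u"
    using g w u U by (auto simp: act_mult)
  also have "g [^] d \<otimes> w = w \<otimes> g [^] d"
    using pow_commute[OF w(1) g w(2)] by simp
  also have "act (w \<otimes> g [^] d) u = act w (act (g [^] d) u)"
    using g w u U by (auto simp: act_mult)
  finally have "u' = act (g [^] d) u"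
    using w u u' U g by (metis act_inject act_pow_closed subsetD)
  then show False using dU[of "g [^] d"] d u u' by blast
qed

section \<open>Long orbits and inclusion of supports\<close>

text \<open>Elements of small order, involutions for instance, are killed by the twelfth power, so
  testing \<open>below\<close> calls for longer orbits. The induction follows \<open>g\<close> by
  some \<open>k\<close> that fixes the earlier orbit points and bends the last one to a place from
  which one more step leads to a new point.\<close>

lemma long_orbit:
  assumes "openin X U" "U \<noteq> {}"
  shows "\<exists>g x. g \<in> carrier G \<and> support g \<subseteq> U \<and> x \<in> U \<and>
    inj_on (\<lambda>i. act (g [^] i) x) {..Suc n}"
proof (induction n)
  case 0
  obtain x where x: "x \<in> U" using assms by blast
  obtain g where g: "g \<in> carrier G" "support g \<subseteq> U" "x \<in> support g"
    using move_within assms x by blast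
  then have "inj_on (\<lambda>i. act (g [^] i) x) {..Suc 0}"
    by (auto simp: inj_on_def support_def le_Suc_eq act_one)
  then show ?case using g x by blast
next
  case (Suc n)
  have UX: "U \<subseteq> topspace X" using assms openin_subset by blast
  obtain g x where g: "g \<in> carrier G" "support g \<subseteq> U" and x: "x \<in> U"
    and inj: "inj_on (\<lambda>i. act (g [^] i) x) {..Suc n}"
    using Suc.IH by blast
  have xX: "x \<in> topspace X" using x UX by blast
  define p where "p i = act (g [^] i) x" for i :: nat
  have p0: "p 0 = x" using xX by (simp add: p_def act_one)
  have pSuc: "p (Suc i) = act g (p i)" for i
  proof -
    have "g [^] Suc i = g \<otimes> g [^] i" using g nat_pow_Suc2 by simp
    then show ?thesis using g xX by (simp add: p_def act_mult)
  qed
  have pU: "p i \<in> U" for i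
    by (induction i) (use p0 pSuc x act_preserves[OF g _ UX] in auto)
  have pX: "p i \<in> topspace X" for i using pU UX by blast
  have p_inj: "i = j" if "p i = p j" "i \<le> Suc n" "j \<le> Suc n" for i j
    using inj that unfolding inj_on_def p_def by auto
  define S where "S = p ` {..n}"
  define y where "y = p (Suc n)"
  have yS: "y \<notin> S" using p_inj unfolding y_def S_def by fastforce
  \<comment> \<open>As \<open>k\<close> will be supported in \<open>V\<close>, it fixes
    \<open>p 0\<close> to \<open>p n\<close>; hence the orbit of \<open>x\<close> under the product
    of \<open>k\<close> and \<open>g\<close> is the old one up to index \<open>n\<close> and departs
    only at \<open>y\<close>.\<close>
  define V where "V = U - S"
  have V: "openin X V" "y \<in> V" "V \<subseteq> U"
    using openin_Diff_finite[OF Hausdorff] assms yS pU by (auto simp: V_def S_def y_def)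
  \<comment> \<open>Excluding the preimage of \<open>x\<close> keeps \<open>act g z\<close> from
    closing the orbit at \<open>p 0\<close>. It also avoids the later points of \<open>S\<close>,
    because their preimages under \<open>g\<close> lie in \<open>S\<close> and \<open>z\<close> does
    not.\<close>
  define W where "W = V - {act (inv g) x}"
  have W: "openin X W" "W \<subseteq> V" "W \<noteq> {}"
    using openin_Diff_finite[OF Hausdorff V(1)] Diff_finite_nonempty[OF V(1), of "{act (inv g) x}"] V(2)
    by (auto simp: W_def)
  obtain k where k: "k \<in> carrier G" "support k \<subseteq> V" "act k y \<in> W"
    using move_into[OF V(1,2) W] by blast
  define z where "z = act k y"
  have z: "z \<in> V" "z \<noteq> act (inv g) x" "z \<in> topspace X"
    using k V W UX by (auto simp: z_def W_def)
  define g' where "g' = k \<otimes> g"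
  have g': "g' \<in> carrier G" "support g' \<subseteq> U"
    using k g V support_mult[of k g] by (auto simp: g'_def)
  have act_g': "act g' u = act k (act g u)" if "u \<in> topspace X" for u
    using that k g by (simp add: g'_def act_mult)
  have k_fix: "act k u = u" if "u \<in> topspace X" "u \<notin> V" for u
    using that k by (auto simp: support_def)
  define q where "q i = act (g' [^] i) x" for i :: nat
  have q0: "q 0 = x" using xX by (simp add: q_def act_one)
  have qSuc: "q (Suc i) = act g' (q i)" for i
  proof -
    have "g' [^] Suc i = g' \<otimes> g' [^] i" using g' nat_pow_Suc2 by simp
    then show ?thesis using g' xX by (simp add: q_def act_mult)
  qed
  have q_eq: "q i = p i" if "i \<le> n" for i
    using that
  proof (induction i)
    case (Suc i)
    have "p (Suc i) \<notin> V" using Suc.prems by (auto simp: V_def S_def)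
    then show ?case using Suc k_fix pX by (simp add: qSuc act_g' flip: pSuc)
  qed (simp add: q0 p0)
  have q_z: "q (Suc n) = z"
    using q_eq[of n] pX by (simp add: qSuc act_g' z_def y_def pSuc)
  have q_last: "q (Suc (Suc n)) = act k (act g z)"
    using q_z z by (simp add: qSuc[of "Suc n"] act_g')
  have zS: "z \<notin> S" using z by (simp add: V_def)
  have gzX: "act g z \<in> topspace X" using g z act_closed by blast
  have gzS: "act g z \<notin> S"
  proof
    assume "act g z \<in> S"
    then obtain i where i: "i \<le> n" "act g z = p i" by (auto simp: S_def)
    show False
    proof (cases i)
      case 0
      then have "z = act (inv g) x" using i p0 z g by (metis act_inv_act)
      then show False using z by blast
    next
      case (Suc j)
      then have "z = p j" using i pSuc z g pX by (metis act_inject)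
      then show False using zS Suc i by (auto simp: S_def)
    qed
  qed
  have last: "act k (act g z) \<notin> S \<and> act k (act g z) \<noteq> z"
  proof (cases "act g z \<in> V")
    case True
    have VX: "V \<subseteq> topspace X" using V UX by blast
    have "act k (act g z) \<in> V" using act_preserves[OF k(1,2) True VX] .
    moreover have "act k (act g z) \<noteq> z"
    proof
      assume "act k (act g z) = z"
      then have "act g z = act g (p n)"
        using k gzX pX unfolding z_def y_def pSuc[symmetric] by (metis act_inject)
      then have "z = p n" using g z pX by (metis act_inject)
      then show False using zS by (auto simp: S_def)
    qed
    ultimately show ?thesis by (auto simp: V_def)
  next
    case False
    then show ?thesis using k_fix gzX gzS z by metis
  qed
  have S: "S = q ` {..n}" using q_eq by (auto simp: S_def)
  have "inj_on q {..n}"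
    using p_inj q_eq by (auto simp: inj_on_def)
  moreover have "{..Suc (Suc n)} = insert (Suc (Suc n)) (insert (Suc n) {..n})" by auto
  ultimately have "inj_on q {..Suc (Suc n)}"
    using zS last q_z q_last S by (auto simp: inj_on_insert)
  then show ?case using g' x unfolding q_def by blast
qed

text \<open>A support disjoint from \<open>support f\<close> is open, so it also misses the closure
  and thereby \<open>core f\<close>; this gives one direction. For the other, if \<open>h\<close>
  moves a point off that closure, take \<open>g\<close> on a small set there that \<open>h\<close>
  displaces: then \<open>f\<close> and \<open>g\<close> are disjoint, yet the twelfth power of
  \<open>g\<close> moves \<open>y\<close> and fixes \<open>act h y\<close>, so it cannot commute
  with \<open>h\<close>.\<close>

lemma below_iff:
  assumes h: "h \<in> carrier G" and f: "f \<in> carrier G"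
  shows "below h f \<longleftrightarrow> support h \<subseteq> core f"
proof
  assume hf: "support h \<subseteq> core f"
  show "below h f"
    unfolding below_def
  proof (intro ballI impI)
    fix g assume g: "g \<in> carrier G" and "alg_disjoint f g"
    then have "support f \<inter> support (g [^] (12::nat)) = {}"
      using disjoint_support_if_alg_disjoint f by blast
    then have "support (g [^] (12::nat)) \<inter> X closure_of support f = {}"
      using openin_Int_closure_of_eq_empty[OF openin_support] g by (simp add: Int_commute)
    then have "support h \<inter> support (g [^] (12::nat)) = {}"
      using hf interior_of_subset unfolding core_def by fastforce
    then show "h \<otimes> g [^] (12::nat) = g [^] (12::nat) \<otimes> h"
      using g h by (intro disjoint_support_commute) auto
  qed
next
  assume b: "below h f"
  have "support h \<subseteq> X closure_of support f"
  proof (rule ccontr)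
    assume "\<not> ?thesis"
    then obtain x where x: "x \<in> support h" "x \<in> support h - X closure_of support f" by blast
    have "openin X (support h - X closure_of support f)"
      using openin_support h by (simp add: openin_diff)
    then obtain U where U: "openin X U" "x \<in> U" "U \<subseteq> support h - X closure_of support f"
      "act h ` U \<inter> U = {}"
      using displace[OF h x(1) _ x(2)] by blast
    \<comment> \<open>The bound \<open>Suc 11\<close> covers the indices from \<open>0\<close> to
      \<open>12\<close>, so the twelfth power moves \<open>y\<close>.\<close>
    obtain g y where g: "g \<in> carrier G" "support g \<subseteq> U" "y \<in> U"
      and inj: "inj_on (\<lambda>i. act (g [^] i) y) {..Suc 11}"
      using long_orbit[OF U(1), of 11] U(2) by blast
    have yX: "y \<in> topspace X" using g U openin_subset by blast
    let ?t = "g [^] (12::nat)"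
    have "act ?t y \<noteq> act (g [^] (0::nat)) y"
      using inj_onD[OF inj, of 12 0] by auto
    then have ty: "act ?t y \<noteq> y" using yX by (simp add: act_one)
    have "support g \<inter> support f = {}"
      using g U closure_of_subset[OF support_subset] by blast
    then have "alg_disjoint f g" using alg_disjoint_if_disjoint_support f g by blast
    then have comm: "h \<otimes> ?t = ?t \<otimes> h" using b g unfolding below_def by blast
    have hy: "act h y \<notin> support ?t" "act h y \<in> topspace X"
      using U g support_pow_dvd[OF g(1), of 1 12] h yX by (auto simp: act_closed)
    have "act h (act ?t y) = act ?t (act h y)"
      using comm h g yX by (metis act_mult nat_pow_closed)
    also have "\<dots> = act h y" using hy by (simp add: support_def)
    finally show False using ty h g yX by (simp add: act_inject act_closed)
  qed
  then show "support h \<subseteq> core f"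
    unfolding core_def using openin_support[OF h] by (simp add: interior_of_maximal)
qed

section \<open>Regular open cores as a base of the topology\<close>

lemma support_subset_core: "f \<in> carrier G \<Longrightarrow> support f \<subseteq> core f"
  unfolding core_def
  by (simp add: openin_support interior_of_maximal closure_of_subset support_subset)

lemma openin_core [simp]: "openin X (core f)"
  by (simp add: core_def)

lemma core_subset_closure: "core f \<subseteq> X closure_of support f"
  by (simp add: core_def interior_of_subset)

lemma core_conj:
  assumes "g \<in> carrier G" "f \<in> carrier G"
  shows "core (g \<otimes> f \<otimes> inv g) = act g ` core f"
  using homeomorphic_map_closure_of[OF homeomorphic_act[OF assms(1)] support_subset]
    homeomorphic_map_interior_of[OF homeomorphic_act[OF assms(1)] closure_of_subset_topspace]
  by (simp add: core_def support_conj assms)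

lemma closure_conj:
  assumes "g \<in> carrier G" "f \<in> carrier G"
  shows "X closure_of support (g \<otimes> f \<otimes> inv g) = act g ` (X closure_of support f)"
  using homeomorphic_map_closure_of[OF homeomorphic_act[OF assms(1)] support_subset]
  by (simp add: support_conj assms)

text \<open>The closure has to stay inside \<open>U\<close> as well, because points of the two
  spaces are first compared through closures of supports. Regularity of a compact Hausdorff space
  leaves room for it.\<close>

lemma core_base:
  assumes "openin X U" "x \<in> U"
  obtains f where "f \<in> carrier G" "x \<in> core f" "X closure_of support f \<subseteq> U"
proof -
  have "neighbourhood_base_of (closedin X) X"
    using compact Hausdorff by (simp add: neighbourhood_base_of_closedin compact_Hausdorff_imp_regular_space)
  then obtain V C where VC: "openin X V" "closedin X C" "x \<in> V" "V \<subseteq> C" "C \<subseteq> U"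
    using assms unfolding neighbourhood_base_of by meson
  obtain f where f: "f \<in> carrier G" "support f \<subseteq> V" "x \<in> support f"
    using move_within VC by blast
  have "X closure_of support f \<subseteq> C" using f VC by (intro closure_of_minimal) auto
  then show thesis using that f VC support_subset_core by blast
qed

end

section \<open>Rubin's reconstruction of the space\<close>

text \<open>An isomorphism between two groups of homeomorphisms is treated as one group acting on both
  spaces, so that everything defined from the group alone agrees for the two actions.\<close>

locale two_locally_dense_actions =
  A: locally_dense_action G X a + B: locally_dense_action G Y b
  for G (structure) and X :: "'x topology" and a and Y :: "'y topology" and b
begin

lemma support_transfer:
  "\<lbrakk>h \<in> carrier G; f \<in> carrier G\<rbrakk> \<Longrightarrow> A.support h \<subseteq> A.core f \<longleftrightarrow> B.support h \<subseteq> B.core f"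
  using A.below_iff B.below_iff by blast

text \<open>Any finitely many cores around \<open>x\<close> contain the support of some nontrivial
  \<open>h\<close>. These inclusions transfer to \<open>Y\<close>, where \<open>h\<close> is again
  nontrivial, so the closures have the finite intersection property.\<close>

lemma closure_point_exists:
  assumes x: "x \<in> topspace X"
  obtains y where "y \<in> topspace Y"
    "\<And>f. \<lbrakk>f \<in> carrier G; x \<in> A.core f\<rbrakk> \<Longrightarrow> y \<in> Y closure_of B.support f"
proof -
  define F where "F = {f \<in> carrier G. x \<in> A.core f}"
  \<comment> \<open>Including \<open>topspace Y\<close> keeps the intersection inside the space even
    if the family is empty.\<close>
  let ?C = "insert (topspace Y) ((\<lambda>f. Y closure_of B.support f) ` F)"
  have "\<Inter>?C \<noteq> {}"
  proof (rule B.compact[unfolded compact_space_fip, rule_format], intro conjI ballI allI impI)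
    fix C assume "C \<in> ?C"
    then show "closedin Y C" by auto
  next
    fix D assume D: "finite D \<and> D \<subseteq> ?C"
    obtain E where E: "finite E" "E \<subseteq> F" "D \<subseteq> insert (topspace Y) ((\<lambda>f. Y closure_of B.support f) ` E)"
    proof -
      have "finite (D - {topspace Y})" "D - {topspace Y} \<subseteq> (\<lambda>f. Y closure_of B.support f) ` F"
        using D by auto
      then obtain E where "E \<subseteq> F" "finite E" "D - {topspace Y} = (\<lambda>f. Y closure_of B.support f) ` E"
        by (meson finite_subset_image)
      then show thesis by (intro that[of E]) auto
    qed
    define U where "U = (\<Inter>f\<in>E. A.core f) \<inter> topspace X"
    have U: "openin X U" "x \<in> U"
      using E x unfolding U_def F_def by (auto intro: openin_INT)
    obtain h where h: "h \<in> carrier G" "A.support h \<subseteq> U" "x \<in> A.support h"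
      using A.move_within[OF U] by blast
    have "A.support h \<noteq> {}" using h(3) by blast
    then have "h \<noteq> \<one>" using h(1) by (simp add: A.support_empty_iff)
    then have "B.support h \<noteq> {}" using h(1) by (simp add: B.support_empty_iff)
    then obtain y where y: "y \<in> B.support h" by blast
    have "y \<in> Y closure_of B.support f" if "f \<in> E" for f
    proof -
      have "A.support h \<subseteq> A.core f" "f \<in> carrier G" using that h E by (auto simp: U_def F_def)
      then have "B.support h \<subseteq> B.core f" using support_transfer h(1) by simp
      then show ?thesis using y B.core_subset_closure[of f] by (meson subsetD)
    qed
    moreover have "y \<in> topspace Y" using y B.support_subset by blast
    ultimately have "y \<in> \<Inter>D" using E by blast
    then show "\<Inter>D \<noteq> {}" by blast
  qed
  then obtain y where "y \<in> \<Inter>?C" by blast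
  then show thesis using that by (auto simp: F_def)
qed

text \<open>If \<open>x\<close> were outside \<open>A.core f\<close>, everything supported in \<open>core f\<close> would fix \<open>x\<close> and so preserve the
  family of neighbourhoods defining \<open>y\<close>; by local density every neighbourhood of \<open>x\<close> would then
  contain \<open>A.core f\<close>.\<close>

lemma core_of_closure_point:
  assumes x: "x \<in> topspace X" and y: "y \<in> topspace Y"
    and xy: "\<And>f. \<lbrakk>f \<in> carrier G; x \<in> A.core f\<rbrakk> \<Longrightarrow> y \<in> Y closure_of B.support f"
    and f: "f \<in> carrier G" "y \<in> B.core f"
  shows "x \<in> A.core f"
proof (rule ccontr)
  assume nx: "x \<notin> A.core f"
  have sub: "A.support f \<subseteq> A.core g" if g: "g \<in> carrier G" "x \<in> A.core g" for g
  proof -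
    have "B.core f \<subseteq> Y closure_of B.support g"
    proof (rule ccontr)
      assume "\<not> ?thesis"
      then have ne: "B.core f - Y closure_of B.support g \<noteq> {}" by blast
      have "openin Y (B.core f - Y closure_of B.support g)" by (simp add: openin_diff)
      then obtain k where k: "k \<in> carrier G" "B.support k \<subseteq> B.core f"
        "b k y \<in> B.core f - Y closure_of B.support g"
        using B.move_into[OF _ f(2) _ _ ne] by auto
      have "A.support k \<subseteq> A.core f" using k f support_transfer by blast
      then have fix_x: "a k x = x" using nx x by (auto simp: A.support_def)
      \<comment> \<open>Since \<open>k\<close> fixes \<open>x\<close>, the conjugate
        \<open>?g\<close> again has \<open>x\<close> in its core. Hence \<open>y\<close> lies in the
        closure belonging to \<open>?g\<close>, and \<open>b k y\<close> in the one belonging to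
        \<open>g\<close>, from which it was chosen to be absent.\<close>
      let ?g = "inv k \<otimes> g \<otimes> k"
      have "k \<otimes> ?g \<otimes> inv k = g"
        using k g by (simp add: A.m_assoc A.inv_solve_left' flip: A.m_assoc[of k])
      then have "A.core g = a k ` A.core ?g" "Y closure_of B.support g = b k ` (Y closure_of B.support ?g)"
        using A.core_conj[of k ?g] B.closure_conj[of k ?g] k g by auto
      moreover have "x \<in> A.core ?g"
      proof -
        obtain x' where x': "x' \<in> A.core ?g" "x = a k x'"
          using calculation g by blast
        then have "x' \<in> topspace X" using openin_subset[OF A.openin_core] by blast
        then show ?thesis using x' fix_x x k by (metis A.act_inject)
      qed
      ultimately have "b k y \<in> Y closure_of B.support g"
        using xy[of ?g] k g by auto
      then show False using k by blast
    qed
    then have "B.support f \<subseteq> B.core g"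
      using B.support_subset_core[OF f(1)] B.openin_support[OF f(1)] unfolding B.core_def[of g]
      by (intro interior_of_maximal) auto
    then show ?thesis using support_transfer f g by blast
  qed
  have "B.support f \<noteq> {}" using f(2) by (auto simp: B.core_def)
  then have "f \<noteq> \<one>" using f(1) by (simp add: B.support_empty_iff)
  then have "A.support f \<noteq> {}" using f(1) by (simp add: A.support_empty_iff)
  then obtain p where p: "p \<in> A.support f" by blast
  have "p \<noteq> x" using p nx A.support_subset_core f by blast
  moreover have "p \<in> topspace X" using p A.support_subset by blast
  ultimately have "openin X (topspace X - {p})" "x \<in> topspace X - {p}"
    using x openin_Diff_finite[OF A.Hausdorff, of "topspace X" "{p}"] by auto
  then obtain g where g: "g \<in> carrier G" "x \<in> A.core g" "X closure_of A.support g \<subseteq> topspace X - {p}"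
    using A.core_base by metis
  then show False using sub[OF g(1,2)] A.core_subset_closure p by blast
qed

lemma core_separates:
  assumes "x \<in> topspace X" "x' \<in> topspace X"
    "\<And>f. f \<in> carrier G \<Longrightarrow> x \<in> A.core f \<Longrightarrow> x' \<in> A.core f"
  shows "x = x'"
proof (rule ccontr)
  assume "x \<noteq> x'"
  then have "openin X (topspace X - {x'})" "x \<in> topspace X - {x'}"
    using assms openin_Diff_finite[OF A.Hausdorff, of "topspace X" "{x'}"] by auto
  then obtain g where g: "g \<in> carrier G" "x \<in> A.core g" "X closure_of A.support g \<subseteq> topspace X - {x'}"
    using A.core_base by metis
  then show False using assms(3)[OF g(1,2)] A.core_subset_closure by blast
qed

lemma swap: "two_locally_dense_actions G Y b X a"
  by unfold_locales

text \<open>Pass from \<open>x\<close> to \<open>y\<close> and back to \<open>x'\<close>. Every core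
  around \<open>x'\<close> corresponds to one around \<open>y\<close>, and that to one around
  \<open>x\<close>; as cores separate points, \<open>x' = x\<close>, and the two one-sided
  implications close up to an equivalence.\<close>

lemma corresponding_point:
  assumes x: "x \<in> topspace X"
  shows "\<exists>y\<in>topspace Y. \<forall>f\<in>carrier G. x \<in> A.core f \<longleftrightarrow> y \<in> B.core f"
proof -
  interpret S: two_locally_dense_actions G Y b X a by (rule swap)
  obtain y where y: "y \<in> topspace Y"
    and xy: "\<And>f. \<lbrakk>f \<in> carrier G; x \<in> A.core f\<rbrakk> \<Longrightarrow> y \<in> Y closure_of B.support f"
    using closure_point_exists[OF x] by blast
  obtain x' where x': "x' \<in> topspace X"
    and yx': "\<And>f. \<lbrakk>f \<in> carrier G; y \<in> B.core f\<rbrakk> \<Longrightarrow> x' \<in> X closure_of A.support f"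
    using S.closure_point_exists[OF y] by blast
  have 1: "x \<in> A.core f" if "f \<in> carrier G" "y \<in> B.core f" for f
    by (rule core_of_closure_point[OF x y xy that])
  have 2: "y \<in> B.core f" if "f \<in> carrier G" "x' \<in> A.core f" for f
    by (rule S.core_of_closure_point[OF y x' yx' that])
  have "x' = x" using core_separates[OF x' x] 1 2 by blast
  then show ?thesis using 1 2 y by blast
qed

text \<open>Everything follows from the characterisation of \<phi> and \<psi> by membership in
  cores: continuity because cores form a base, mutual inverseness because they separate points, and
  equivariance because conjugation by \<open>g\<close> carries the core of an element to its image
  under \<open>g\<close>.\<close>

theorem equivariant_homeomorphism:
  obtains \<phi> \<psi> where "homeomorphic_maps X Y \<phi> \<psi>"
    "\<And>g x. \<lbrakk>g \<in> carrier G; x \<in> topspace X\<rbrakk> \<Longrightarrow> \<phi> (a g x) = b g (\<phi> x)"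
proof -
  interpret S: two_locally_dense_actions G Y b X a by (rule swap)
  obtain \<phi> where \<phi>: "\<And>x. x \<in> topspace X \<Longrightarrow> \<phi> x \<in> topspace Y"
    "\<And>x f. \<lbrakk>x \<in> topspace X; f \<in> carrier G\<rbrakk> \<Longrightarrow> \<phi> x \<in> B.core f \<longleftrightarrow> x \<in> A.core f"
    using corresponding_point by metis
  obtain \<psi> where \<psi>: "\<And>y. y \<in> topspace Y \<Longrightarrow> \<psi> y \<in> topspace X"
    "\<And>y f. \<lbrakk>y \<in> topspace Y; f \<in> carrier G\<rbrakk> \<Longrightarrow> \<psi> y \<in> A.core f \<longleftrightarrow> y \<in> B.core f"
    using S.corresponding_point by metis
  have cont: "continuous_map X Y \<phi>"
    unfolding continuous_map_def
  proof (intro conjI allI impI)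
    fix V assume V: "openin Y V"
    show "openin X {x \<in> topspace X. \<phi> x \<in> V}"
    proof (subst openin_subopen, intro ballI)
      fix x assume "x \<in> {x \<in> topspace X. \<phi> x \<in> V}"
      then have x: "x \<in> topspace X" "\<phi> x \<in> V" by auto
      then obtain f where f: "f \<in> carrier G" "\<phi> x \<in> B.core f" "Y closure_of B.support f \<subseteq> V"
        using B.core_base V by metis
      have "A.core f \<subseteq> {x \<in> topspace X. \<phi> x \<in> V}"
        using \<phi>(2) f B.core_subset_closure openin_subset[OF A.openin_core] by blast
      then show "\<exists>T. openin X T \<and> x \<in> T \<and> T \<subseteq> {x \<in> topspace X. \<phi> x \<in> V}"
        using f x \<phi>(2) by (intro exI[of _ "A.core f"]) auto
    qed
  qed (use \<phi> in auto)
  have cont': "continuous_map Y X \<psi>"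
    unfolding continuous_map_def
  proof (intro conjI allI impI)
    fix V assume V: "openin X V"
    show "openin Y {x \<in> topspace Y. \<psi> x \<in> V}"
    proof (subst openin_subopen, intro ballI)
      fix x assume "x \<in> {x \<in> topspace Y. \<psi> x \<in> V}"
      then have x: "x \<in> topspace Y" "\<psi> x \<in> V" by auto
      then obtain f where f: "f \<in> carrier G" "\<psi> x \<in> A.core f" "X closure_of A.support f \<subseteq> V"
        using A.core_base V by metis
      have "B.core f \<subseteq> {x \<in> topspace Y. \<psi> x \<in> V}"
        using \<psi>(2) f A.core_subset_closure openin_subset[OF B.openin_core] by blast
      then show "\<exists>T. openin Y T \<and> x \<in> T \<and> T \<subseteq> {x \<in> topspace Y. \<psi> x \<in> V}"
        using f x \<psi>(2) by (intro exI[of _ "B.core f"]) auto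
    qed
  qed (use \<psi> in auto)
  have "\<psi> (\<phi> x) = x" if "x \<in> topspace X" for x
    using core_separates[of "\<psi> (\<phi> x)" x] \<phi> \<psi> that by auto
  moreover have "\<phi> (\<psi> y) = y" if "y \<in> topspace Y" for y
    using S.core_separates[of "\<phi> (\<psi> y)" y] \<phi> \<psi> that by auto
  ultimately have "homeomorphic_maps X Y \<phi> \<psi>"
    using cont cont' by (simp add: homeomorphic_maps_def)
  moreover have "\<phi> (a g x) = b g (\<phi> x)" if g: "g \<in> carrier G" and x: "x \<in> topspace X" for g x
  proof (rule S.core_separates)
    show "\<phi> (a g x) \<in> topspace Y" "b g (\<phi> x) \<in> topspace Y"
      using \<phi> g x by (auto simp: A.act_closed B.act_closed)
    fix f assume f: "f \<in> carrier G" and "\<phi> (a g x) \<in> B.core f"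
    then have gx: "a g x \<in> A.core f" using \<phi> g x by (simp add: A.act_closed)
    let ?f = "inv g \<otimes> f \<otimes> g"
    have "g \<otimes> ?f \<otimes> inv g = f"
      using f g by (simp add: A.m_assoc A.inv_solve_left' flip: A.m_assoc[of g])
    then have "A.core f = a g ` A.core ?f" "B.core f = b g ` B.core ?f"
      using A.core_conj[of g ?f] B.core_conj[of g ?f] f g by auto
    moreover have "x \<in> A.core ?f"
    proof -
      obtain x' where "x' \<in> A.core ?f" "a g x = a g x'" using calculation gx by blast
      moreover from this have "x' \<in> topspace X" using openin_subset[OF A.openin_core] by blast
      ultimately show ?thesis using x g by (simp add: A.act_inject)
    qed
    ultimately show "b g (\<phi> x) \<in> B.core f" using \<phi> x f g by auto
  qed
  ultimately show thesis using that by blast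
qed

end

section \<open>Clopen neighbourhoods and continuous sections\<close>

text \<open>In a compact Hausdorff space quasi-components are components, here single points. So
  \<open>x\<close> is separated by a clopen set from each point off \<open>U\<close>, and
  compactness of the complement yields one clopen set for all of them.\<close>

lemma clopen_neighbourhood:
  assumes X: "compact_space X" "Hausdorff_space X"
    and td: "\<And>C. connectedin X C \<Longrightarrow> \<exists>x. C \<subseteq> {x}"
    and U: "openin X U" "x \<in> U"
  obtains K where "openin X K" "closedin X K" "x \<in> K" "K \<subseteq> U"
proof -
  have xX: "x \<in> topspace X" using U openin_subset by blast
  have "quasi_components_of X = connected_components_of X"
    by (rule quasi_eq_connected_components_of) (simp add: X)
  then have eq: "quasi_component_of X x = connected_component_of X x"
    unfolding quasi_eq_connected_components_of_pointwise using xX by (rule bspec)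
  have "separated_between X {x} {y}" if y: "y \<in> topspace X - U" for y
  proof -
    have "\<not> quasi_component_of X x y"
    proof
      assume "quasi_component_of X x y"
      then obtain C where "connectedin X C" "x \<in> C" "y \<in> C"
        unfolding eq connected_component_of_def by blast
      then show False using td[of C] y U(2) by blast
    qed
    then obtain T where "x \<in> T" "closedin X T" "openin X T" "y \<notin> T"
      using xX y unfolding quasi_component_of by blast
    then show ?thesis
      unfolding separated_between using y by (intro exI[of _ T]) auto
  qed
  moreover have co: "compactin X (topspace X - U)"
    using X(1) U(1) by (intro closedin_compact_space) auto
  ultimately have "separated_between X {x} (topspace X - U)"
    unfolding separated_between_pointwise_right[OF co] using xX by simp
  then obtain K where K: "closedin X K" "openin X K" "{x} \<subseteq> K" "topspace X - U \<subseteq> topspace X - K"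
    unfolding separated_between by blast
  moreover have "K \<subseteq> U" using K openin_subset[OF K(2)] by blast
  ultimately show thesis using that by blast
qed

lemma continuous_map_section:
  assumes U: "openin X U" and inj: "inj_on f U" and op: "\<And>N. openin X N \<Longrightarrow> openin Y (f ` N)"
  shows "continuous_map (subtopology Y (f ` U)) X (inv_into U f)"
proof -
  have top: "topspace (subtopology Y (f ` U)) = f ` U"
    using openin_subset[OF op[OF U]] by (simp add: Int_absorb1)
  show ?thesis
    unfolding continuous_map_def top
  proof (intro conjI allI impI)
    show "inv_into U f \<in> f ` U \<rightarrow> topspace X"
      using inv_into_into[of _ f U] openin_subset[OF U] by blast
    fix N assume N: "openin X N"
    have "{x \<in> f ` U. inv_into U f x \<in> N} = f ` (U \<inter> N)"
      using inj by (auto simp: inv_into_f_f)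
    then show "openin (subtopology Y (f ` U)) {x \<in> f ` U. inv_into U f x \<in> N}"
      using openin_open_subtopology[OF op[OF U]] op[of "U \<inter> N"] U N by auto
  qed
qed

section \<open>Etale groupoids and their full bisections\<close>

context groupoid
begin

lemma composable_iff:
  "(g, h) \<in> composable G \<longleftrightarrow> g \<in> arrows G \<and> h \<in> arrows G \<and> src G g = rng G h"
  by (simp add: composable_def)

lemma units_arrows: "x \<in> units G \<Longrightarrow> x \<in> arrows G"
  using src_closed by (auto simp: units_def)

lemma src_unit [simp]: "x \<in> units G \<Longrightarrow> src G x = x"
  unfolding units_def by (elim imageE) (simp only: src_src)

lemma rng_unit [simp]: "x \<in> units G \<Longrightarrow> rng G x = x"
  unfolding units_def by (elim imageE) (simp only: rng_src)

lemma src_units [simp]: "g \<in> arrows G \<Longrightarrow> src G g \<in> units G"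
  unfolding units_def by (rule imageI)

lemma rng_units [simp]: "g \<in> arrows G \<Longrightarrow> rng G g \<in> units G"
  using src_units[of "rng G g"] by (simp add: src_rng rng_closed)

lemma gmult_closed [simp]:
  "\<lbrakk>g \<in> arrows G; h \<in> arrows G; src G g = rng G h\<rbrakk> \<Longrightarrow> gmult G g h \<in> arrows G"
  by (simp add: mult_closed composable_iff)

lemma src_gmult [simp]:
  "\<lbrakk>g \<in> arrows G; h \<in> arrows G; src G g = rng G h\<rbrakk> \<Longrightarrow> src G (gmult G g h) = src G h"
  by (simp add: src_mult composable_iff)

lemma rng_gmult [simp]:
  "\<lbrakk>g \<in> arrows G; h \<in> arrows G; src G g = rng G h\<rbrakk> \<Longrightarrow> rng G (gmult G g h) = rng G g"
  by (simp add: rng_mult composable_iff)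

lemma gmult_assoc:
  "\<lbrakk>g \<in> arrows G; h \<in> arrows G; k \<in> arrows G; src G g = rng G h; src G h = rng G k\<rbrakk> \<Longrightarrow>
    gmult G (gmult G g h) k = gmult G g (gmult G h k)"
  by (simp add: mult_assoc composable_iff)

lemma unit_gmult [simp]: "\<lbrakk>x \<in> units G; g \<in> arrows G; x = rng G g\<rbrakk> \<Longrightarrow> gmult G x g = g"
  using rng_mult_id by simp

lemma gmult_unit [simp]: "\<lbrakk>x \<in> units G; g \<in> arrows G; src G g = x\<rbrakk> \<Longrightarrow> gmult G g x = g"
  using mult_src by metis

lemma inv_gmult_cancel [simp]:
  "\<lbrakk>g \<in> arrows G; h \<in> arrows G; src G g = rng G h\<rbrakk> \<Longrightarrow> gmult G (ginv G g) (gmult G g h) = h"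
  using gmult_assoc[of "ginv G g" g h] by (simp add: inv_closed inv_mult src_inv rng_inv)

lemma gmult_inv_cancel [simp]:
  "\<lbrakk>g \<in> arrows G; h \<in> arrows G; rng G g = rng G h\<rbrakk> \<Longrightarrow> gmult G g (gmult G (ginv G g) h) = h"
  using gmult_assoc[of g "ginv G g" h] by (simp add: inv_closed mult_inv src_inv rng_inv)

lemma ginv_ginv [simp]: "g \<in> arrows G \<Longrightarrow> ginv G (ginv G g) = g"
  using inv_gmult_cancel[of "ginv G g" g]
  by (simp add: inv_closed inv_mult src_inv rng_inv mult_src)

lemma ginv_unit [simp]: "x \<in> units G \<Longrightarrow> ginv G x = x"
  using inv_mult[of x] gmult_unit[of x "ginv G x"]
  by (simp add: units_arrows inv_closed src_inv)

end

section \<open>Full bisections as group elements\<close>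

definition bis_mult :: "'a top_groupoid \<Rightarrow> 'a set \<Rightarrow> 'a set \<Rightarrow> 'a set" where
  "bis_mult G U V = {gmult G g h | g h. g \<in> U \<and> h \<in> V \<and> src G g = rng G h}"

lemma bis_multI: "\<lbrakk>g \<in> U; h \<in> V; src G g = rng G h\<rbrakk> \<Longrightarrow> gmult G g h \<in> bis_mult G U V"
  by (auto simp: bis_mult_def)

text \<open>The full group with the bisection in place of the homeomorphism that it induces. Such a
  bisection is compact, since the source map identifies it homeomorphically with the compact unit
  space.\<close>

definition bis_group :: "'a top_groupoid \<Rightarrow> 'a set monoid" where
  "bis_group G = \<lparr>carrier = {U. openin (arr_top G) U \<and> G_set G U \<and>
      src G ` U = units G \<and> rng G ` U = units G},
    monoid.mult = bis_mult G, one = units G\<rparr>"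

definition arrow_at :: "'a top_groupoid \<Rightarrow> 'a set \<Rightarrow> 'a \<Rightarrow> 'a" where
  "arrow_at G U x = inv_into U (src G) x"

text \<open>This is \<open>pi_map G U\<close> before its restriction to the units, factored through
  the arrow that realises the motion.\<close>

definition bis_act :: "'a top_groupoid \<Rightarrow> 'a set \<Rightarrow> 'a \<Rightarrow> 'a" where
  "bis_act G U x = rng G (arrow_at G U x)"

locale cantor_groupoid = etale_groupoid +
  assumes ep: "essentially_principal G"
    and cantor: "cantor_set (unit_space G)"
    and min: "minimal_groupoid G"
begin

lemma topspace_arr [simp]: "topspace (arr_top G) = arrows G"
  by (simp add: arrows_def)

lemma units_subset: "units G \<subseteq> arrows G"
  using units_arrows by blast

lemma topspace_unit_space [simp]: "topspace (unit_space G) = units G"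
  using units_subset by (auto simp: unit_space_def)

lemma topspace_composable_space [simp]: "topspace (composable_space G) = composable G"
  by (auto simp: composable_space_def composable_def)

lemma openin_units: "openin (arr_top G) (units G)"
  using ep openin_interior_of unfolding essentially_principal_def by metis

lemma openin_unit_space_iff: "openin (unit_space G) U \<longleftrightarrow> openin (arr_top G) U \<and> U \<subseteq> units G"
  unfolding unit_space_def using openin_units by (simp add: openin_open_subtopology)

lemma Hausdorff_unit_space: "Hausdorff_space (unit_space G)"
  unfolding unit_space_def using Hausdorff Hausdorff_space_subtopology by blast

lemma compact_unit_space: "compact_space (unit_space G)"
  using cantor by (simp add: cantor_set_def)

lemma compactin_units: "compactin (arr_top G) (units G)"
  using compact_unit_space units_subset by (simp add: unit_space_def compact_space_subtopology compactin_subspace)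

lemma no_isolated_unit: "x \<in> units G \<Longrightarrow> \<not> openin (unit_space G) {x}"
  using cantor by (simp add: cantor_set_def)

lemma clopen_units:
  assumes "openin (unit_space G) U" "x \<in> U"
  obtains K where "openin (unit_space G) K" "closedin (unit_space G) K" "x \<in> K" "K \<subseteq> U"
  using clopen_neighbourhood[OF compact_unit_space Hausdorff_unit_space _ assms] cantor
  unfolding cantor_set_def by blast

lemma continuous_rng: "continuous_map (arr_top G) (arr_top G) (rng G)"
proof -
  have "continuous_map (arr_top G) (unit_space G) (rng G)"
    unfolding continuous_map_def
  proof (intro conjI allI impI)
    fix V assume V: "openin (unit_space G) V"
    show "openin (arr_top G) {g \<in> topspace (arr_top G). rng G g \<in> V}"
    proof (subst openin_subopen, intro ballI)
      fix g assume g: "g \<in> {g \<in> topspace (arr_top G). rng G g \<in> V}"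
      then obtain U where U: "openin (arr_top G) U" "g \<in> U"
        "homeomorphic_map (subtopology (arr_top G) U) (subtopology (unit_space G) (rng G ` U)) (rng G)"
        using etale unfolding local_homeomorphism_def by blast
      have "continuous_map (subtopology (arr_top G) U) (unit_space G) (rng G)"
        using U(3) homeomorphic_imp_continuous_map continuous_map_in_subtopology by blast
      then have "openin (subtopology (arr_top G) U) {h \<in> topspace (subtopology (arr_top G) U). rng G h \<in> V}"
        using V openin_continuous_map_preimage by blast
      then have "openin (arr_top G) {h \<in> topspace (subtopology (arr_top G) U). rng G h \<in> V}"
        using U(1) openin_open_subtopology by blast
      then show "\<exists>T. openin (arr_top G) T \<and> g \<in> T \<and> T \<subseteq> {g \<in> topspace (arr_top G). rng G g \<in> V}"
        using g U by (intro exI[of _ "{h \<in> topspace (subtopology (arr_top G) U). rng G h \<in> V}"]) auto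
    qed
  qed auto
  then show ?thesis unfolding unit_space_def using continuous_map_in_subtopology by blast
qed

lemma continuous_src: "continuous_map (arr_top G) (arr_top G) (src G)"
proof (rule continuous_map_eq)
  show "continuous_map (arr_top G) (arr_top G) (rng G \<circ> ginv G)"
    using continuous_inv continuous_rng continuous_map_compose by blast
qed (simp add: rng_inv)

lemma openin_rng_image:
  assumes N: "openin (arr_top G) N" shows "openin (arr_top G) (rng G ` N)"
proof (subst openin_subopen, intro ballI)
  fix x assume "x \<in> rng G ` N"
  then obtain g where g: "g \<in> N" "x = rng G g" by blast
  then have "g \<in> topspace (arr_top G)" using N openin_subset by blast
  then obtain U where U: "openin (arr_top G) U" "g \<in> U" "openin (unit_space G) (rng G ` U)"
    "homeomorphic_map (subtopology (arr_top G) U) (subtopology (unit_space G) (rng G ` U)) (rng G)"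
    using etale unfolding local_homeomorphism_def by blast
  have "openin (subtopology (arr_top G) U) (N \<inter> U)"
    using N by (metis openin_subtopology_Int)
  then have "openin (subtopology (unit_space G) (rng G ` U)) (rng G ` (N \<inter> U))"
    using U(4) homeomorphic_imp_open_map open_map_def by blast
  then have "openin (arr_top G) (rng G ` (N \<inter> U))"
    using U(3) by (simp add: openin_open_subtopology openin_unit_space_iff)
  then show "\<exists>T. openin (arr_top G) T \<and> x \<in> T \<and> T \<subseteq> rng G ` N"
    using g U by (intro exI[of _ "rng G ` (N \<inter> U)"]) auto
qed

lemma ginv_image: "U \<subseteq> arrows G \<Longrightarrow> ginv G ` U = {g \<in> arrows G. ginv G g \<in> U}"
  using inv_closed by (force simp: image_iff)

lemma openin_ginv_image:
  assumes "openin (arr_top G) U" shows "openin (arr_top G) (ginv G ` U)"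
  using openin_continuous_map_preimage[OF continuous_inv assms] ginv_image[of U] openin_subset[OF assms] by simp

lemma openin_src_image:
  assumes N: "openin (arr_top G) N" shows "openin (arr_top G) (src G ` N)"
proof -
  have "src G ` N = rng G ` (ginv G ` N)"
    unfolding image_image using openin_subset[OF N] by (intro image_cong) (auto simp: rng_inv)
  then show ?thesis using N openin_ginv_image openin_rng_image by simp
qed

lemma openin_src_preimage:
  "openin (arr_top G) U \<Longrightarrow> openin (arr_top G) {g \<in> arrows G. src G g \<in> U}"
  using openin_continuous_map_preimage[OF continuous_src] by simp

lemma openin_rng_preimage:
  "openin (arr_top G) U \<Longrightarrow> openin (arr_top G) {g \<in> arrows G. rng G g \<in> U}"
  using openin_continuous_map_preimage[OF continuous_rng] by simp

lemma continuous_src_section: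
  assumes U: "openin (arr_top G) U" and inj: "inj_on (src G) U"
  shows "continuous_map (subtopology (arr_top G) (src G ` U)) (arr_top G) (inv_into U (src G))"
  using U inj openin_src_image by (rule continuous_map_section)

lemma continuous_rng_section:
  assumes U: "openin (arr_top G) U" and inj: "inj_on (rng G) U"
  shows "continuous_map (subtopology (arr_top G) (rng G ` U)) (arr_top G) (inv_into U (rng G))"
  using U inj openin_rng_image by (rule continuous_map_section)

text \<open>The part of \<open>U\<close> over \<open>K\<close> is the image of \<open>K\<close>
  under the continuous section of the source map.\<close>

lemma compactin_bisection:
  assumes U: "openin (arr_top G) U" "inj_on (src G) U" and K: "compactin (arr_top G) K" "K \<subseteq> src G ` U"
  shows "compactin (arr_top G) {g \<in> U. src G g \<in> K}"
proof -
  have "compactin (subtopology (arr_top G) (src G ` U)) K"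
    using K by (simp add: compactin_subtopology)
  then have "compactin (arr_top G) (inv_into U (src G) ` K)"
    using continuous_src_section[OF U] image_compactin by blast
  moreover have "inv_into U (src G) ` K = {g \<in> U. src G g \<in> K}"
  proof
    show "inv_into U (src G) ` K \<subseteq> {g \<in> U. src G g \<in> K}"
      using K(2) by (auto simp: inv_into_into f_inv_into_f subset_iff)
    show "{g \<in> U. src G g \<in> K} \<subseteq> inv_into U (src G) ` K"
      using U(2) by (auto intro!: image_eqI simp: inv_into_f_f)
  qed
  ultimately show ?thesis by simp
qed

text \<open>The product is a preimage: the first factor of \<open>k\<close> must be the unique
  \<open>u k\<close> in \<open>U\<close> with the range of \<open>k\<close>, and \<open>k\<close>
  lies in the product iff the inverse of \<open>u k\<close> times \<open>k\<close> lies in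
  \<open>V\<close>. Both expressions depend continuously on \<open>k\<close>.\<close>

lemma openin_bis_mult:
  assumes U: "openin (arr_top G) U" "inj_on (rng G) U" and V: "openin (arr_top G) V"
  shows "openin (arr_top G) (bis_mult G U V)"
proof -
  have UA: "U \<subseteq> arrows G" and VA: "V \<subseteq> arrows G"
    using openin_subset[OF U(1)] openin_subset[OF V] by simp_all
  define W where "W = {k \<in> arrows G. rng G k \<in> rng G ` U}"
  define T where "T = subtopology (arr_top G) W"
  define u where "u k = inv_into U (rng G) (rng G k)" for k
  have W: "openin (arr_top G) W" unfolding W_def
    by (rule openin_rng_preimage[OF openin_rng_image[OF U(1)]])
  have topT: "topspace T = W" by (auto simp: T_def W_def)
  have u: "u k \<in> U" "rng G (u k) = rng G k" if "k \<in> W" for k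
    using that unfolding u_def W_def by (auto simp: inv_into_into f_inv_into_f)
  have "continuous_map T (subtopology (arr_top G) (rng G ` U)) (rng G)"
  proof (rule continuous_map_into_subtopology)
    show "continuous_map T (arr_top G) (rng G)"
      unfolding T_def by (rule continuous_map_from_subtopology[OF continuous_rng])
    show "rng G \<in> topspace T \<rightarrow> rng G ` U"
      unfolding topT by (rule Pi_I) (simp add: W_def)
  qed
  then have cu: "continuous_map T (arr_top G) u"
    using continuous_map_compose[OF _ continuous_rng_section[OF U]] unfolding u_def comp_def by blast
  have "continuous_map T (composable_space G) (\<lambda>k. (ginv G (u k), k))"
    unfolding composable_space_def
  proof (rule continuous_map_into_subtopology)
    have "continuous_map T (arr_top G) (\<lambda>k. ginv G (u k))"
      using continuous_map_compose[OF cu continuous_inv] by (simp add: comp_def)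
    moreover have "continuous_map T (arr_top G) (\<lambda>k. k)"
      unfolding T_def by (simp add: continuous_map_from_subtopology)
    ultimately show "continuous_map T (prod_topology (arr_top G) (arr_top G)) (\<lambda>k. (ginv G (u k), k))"
      by (rule continuous_map_pairedI)
    show "(\<lambda>k. (ginv G (u k), k)) \<in> topspace T \<rightarrow> composable G"
    proof (rule Pi_I)
      fix k assume "k \<in> topspace T"
      then have k: "k \<in> W" by (simp add: topT)
      then have "k \<in> arrows G" "u k \<in> arrows G" using u UA by (auto simp: W_def)
      then show "(ginv G (u k), k) \<in> composable G"
        using u(2)[OF k] by (simp add: composable_iff inv_closed src_inv)
    qed
  qed
  from continuous_map_compose[OF this continuous_mult]
  have "continuous_map T (arr_top G) (\<lambda>k. gmult G (ginv G (u k)) k)"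
    by (simp add: comp_def)
  then have "openin T {k \<in> topspace T. gmult G (ginv G (u k)) k \<in> V}"
    using V openin_continuous_map_preimage by blast
  then have "openin (arr_top G) {k \<in> W. gmult G (ginv G (u k)) k \<in> V}"
    using W openin_open_subtopology unfolding topT unfolding T_def by blast
  moreover have "bis_mult G U V = {k \<in> W. gmult G (ginv G (u k)) k \<in> V}"
  proof (intro equalityI subsetI)
    fix k assume "k \<in> bis_mult G U V"
    then obtain g h where gh: "g \<in> U" "h \<in> V" "src G g = rng G h" "k = gmult G g h"
      unfolding bis_mult_def by blast
    then have A: "g \<in> arrows G" "h \<in> arrows G" using UA VA by auto
    then have "k \<in> W" "u k = g" using gh U(2) by (auto simp: W_def u_def inv_into_f_f)
    then show "k \<in> {k \<in> W. gmult G (ginv G (u k)) k \<in> V}" using gh A by simp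
  next
    fix k assume k: "k \<in> {k \<in> W. gmult G (ginv G (u k)) k \<in> V}"
    then have "u k \<in> U" "u k \<in> arrows G" "rng G (u k) = rng G k" "k \<in> arrows G"
      using u UA by (auto simp: W_def)
    moreover from this have "k = gmult G (u k) (gmult G (ginv G (u k)) k)" by simp
    ultimately show "k \<in> bis_mult G U V"
      unfolding bis_mult_def mem_Collect_eq using k
      by (intro exI[of _ "u k"] exI[of _ "gmult G (ginv G (u k)) k"]) (simp add: inv_closed src_inv rng_inv)
  qed
  ultimately show ?thesis by simp
qed

section \<open>The group of full bisections and its action on units\<close>

lemma bis_groupD:
  assumes "U \<in> carrier (bis_group G)"
  shows "openin (arr_top G) U" "U \<subseteq> arrows G" "inj_on (rng G) U" "inj_on (src G) U"
    "src G ` U = units G" "rng G ` U = units G" "G_set G U"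
  using assms by (auto simp: bis_group_def G_set_def)

lemma bis_groupI:
  assumes "openin (arr_top G) U" "inj_on (rng G) U" "inj_on (src G) U"
    "src G ` U = units G" "rng G ` U = units G"
  shows "U \<in> carrier (bis_group G)"
  using assms openin_subset[OF assms(1)] by (auto simp: bis_group_def G_set_def)

lemma bis_mult_eq [simp]: "U \<otimes>\<^bsub>bis_group G\<^esub> V = bis_mult G U V"
  by (simp add: bis_group_def)

lemma bis_one_eq [simp]: "\<one>\<^bsub>bis_group G\<^esub> = units G"
  by (simp add: bis_group_def)

lemma arrow_at:
  assumes "U \<in> carrier (bis_group G)" "x \<in> units G"
  shows "arrow_at G U x \<in> U" "src G (arrow_at G U x) = x"
  using bis_groupD(5)[OF assms(1)] assms(2) unfolding arrow_at_def
  by (auto simp: inv_into_into f_inv_into_f)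

lemma arrow_at_arrows:
  assumes "U \<in> carrier (bis_group G)" "x \<in> units G"
  shows "arrow_at G U x \<in> arrows G"
  using arrow_at(1)[OF assms] bis_groupD(2)[OF assms(1)] by blast

lemma arrow_at_eq:
  assumes "U \<in> carrier (bis_group G)" "g \<in> U" "src G g = x"
  shows "arrow_at G U x = g"
  using bis_groupD(4)[OF assms(1)] assms unfolding arrow_at_def by (auto simp: inv_into_f_f)

lemma bis_act_eq:
  "\<lbrakk>U \<in> carrier (bis_group G); g \<in> U; src G g = x\<rbrakk> \<Longrightarrow> bis_act G U x = rng G g"
  by (simp add: bis_act_def arrow_at_eq)

lemma bis_act_closed:
  "\<lbrakk>U \<in> carrier (bis_group G); x \<in> units G\<rbrakk> \<Longrightarrow> bis_act G U x \<in> units G"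
  using arrow_at_arrows by (simp add: bis_act_def)

lemma bis_mult_closed:
  assumes U: "U \<in> carrier (bis_group G)" and V: "V \<in> carrier (bis_group G)"
  shows "bis_mult G U V \<in> carrier (bis_group G)"
proof (rule bis_groupI)
  note UD = bis_groupD[OF U] and VD = bis_groupD[OF V]
  show "openin (arr_top G) (bis_mult G U V)"
    using openin_bis_mult UD VD by blast
  show "inj_on (rng G) (bis_mult G U V)"
  proof (rule inj_onI)
    fix k k' assume k: "k \<in> bis_mult G U V" "k' \<in> bis_mult G U V" and e: "rng G k = rng G k'"
    obtain g h g' h' where gh: "g \<in> U" "h \<in> V" "src G g = rng G h" "k = gmult G g h"
       "g' \<in> U" "h' \<in> V" "src G g' = rng G h'" "k' = gmult G g' h'"
      using k unfolding bis_mult_def by blast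
    then have A: "g \<in> arrows G" "h \<in> arrows G" "g' \<in> arrows G" "h' \<in> arrows G"
      using UD VD by auto
    then have "g = g'" using gh e inj_onD[OF UD(3), of g g'] by simp
    moreover from this have "h = h'" using gh inj_onD[OF VD(3), of h h'] by simp
    ultimately show "k = k'" using gh by simp
  qed
  show "inj_on (src G) (bis_mult G U V)"
  proof (rule inj_onI)
    fix k k' assume k: "k \<in> bis_mult G U V" "k' \<in> bis_mult G U V" and e: "src G k = src G k'"
    obtain g h g' h' where gh: "g \<in> U" "h \<in> V" "src G g = rng G h" "k = gmult G g h"
       "g' \<in> U" "h' \<in> V" "src G g' = rng G h'" "k' = gmult G g' h'"
      using k unfolding bis_mult_def by blast
    then have A: "g \<in> arrows G" "h \<in> arrows G" "g' \<in> arrows G" "h' \<in> arrows G"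
      using UD VD by auto
    then have "h = h'" using gh e inj_onD[OF VD(4), of h h'] by simp
    moreover from this have "g = g'" using gh inj_onD[OF UD(4), of g g'] by simp
    ultimately show "k = k'" using gh by simp
  qed
  show "src G ` bis_mult G U V = units G"
  proof (intro equalityI subsetI)
    fix x assume x: "x \<in> units G"
    let ?h = "arrow_at G V x" let ?g = "arrow_at G U (rng G ?h)"
    have h: "?h \<in> V" "?h \<in> arrows G" "src G ?h = x" using arrow_at arrow_at_arrows V x by auto
    then have g: "?g \<in> U" "?g \<in> arrows G" "src G ?g = rng G ?h" using arrow_at arrow_at_arrows U by auto
    then have "gmult G ?g ?h \<in> bis_mult G U V" "src G (gmult G ?g ?h) = x"
      using h g by (auto simp: bis_mult_def)
    then show "x \<in> src G ` bis_mult G U V" by (metis imageI)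
  qed (use UD VD in \<open>auto simp: bis_mult_def subset_iff\<close>)
  show "rng G ` bis_mult G U V = units G"
  proof (intro equalityI subsetI)
    fix x assume "x \<in> units G"
    then obtain g where g: "g \<in> U" "rng G g = x" using UD by (metis imageE)
    moreover have "src G g \<in> units G" using g UD by auto
    then obtain h where h: "h \<in> V" "rng G h = src G g" using VD by (metis imageE)
    ultimately have "gmult G g h \<in> bis_mult G U V" "rng G (gmult G g h) = x"
      using UD(2) VD(2) by (auto intro!: bis_multI simp: subset_iff)
    then show "x \<in> rng G ` bis_mult G U V" by (metis imageI)
  qed (use UD VD in \<open>auto simp: bis_mult_def subset_iff\<close>)
qed

lemma units_bis: "units G \<in> carrier (bis_group G)"
  by (rule bis_groupI) (auto simp: openin_units inj_on_def image_iff)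

lemma ginv_bis:
  assumes U: "U \<in> carrier (bis_group G)"
  shows "ginv G ` U \<in> carrier (bis_group G)"
proof (rule bis_groupI)
  note UD = bis_groupD[OF U]
  show "openin (arr_top G) (ginv G ` U)" using openin_ginv_image UD by blast
  have r: "rng G (ginv G g) = src G g" and s: "src G (ginv G g) = rng G g" if "g \<in> U" for g
    using that UD by (auto simp: rng_inv src_inv)
  show "inj_on (rng G) (ginv G ` U)" "inj_on (src G) (ginv G ` U)"
    using UD(3,4) r s by (auto simp: inj_on_def)
  show "src G ` ginv G ` U = units G" "rng G ` ginv G ` U = units G"
    using UD(5,6) r s by (auto simp: image_image)
qed

lemma ginv_bis_mult:
  assumes U: "U \<in> carrier (bis_group G)"
  shows "bis_mult G (ginv G ` U) U = units G"
proof -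
  note UD = bis_groupD[OF U]
  have *: "gmult G (ginv G g) h = src G g" "g \<in> arrows G"
    if "g \<in> U" "h \<in> U" "src G (ginv G g) = rng G h" for g h
  proof -
    show g: "g \<in> arrows G" using that UD by blast
    have "rng G g = rng G h" using that g by (simp add: src_inv)
    then have "g = h" using inj_onD[OF UD(3)] that by blast
    then show "gmult G (ginv G g) h = src G g" using inv_mult g by simp
  qed
  show ?thesis
  proof (intro equalityI subsetI)
    fix x assume x: "x \<in> units G"
    let ?g = "arrow_at G U x"
    have "?g \<in> U" "?g \<in> arrows G" "src G ?g = x" using arrow_at arrow_at_arrows U x by auto
    then show "x \<in> bis_mult G (ginv G ` U) U"
      unfolding bis_mult_def mem_Collect_eq
      by (intro exI[of _ "ginv G ?g"] exI[of _ ?g]) (simp add: inv_mult src_inv)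
  qed (use * in \<open>auto simp: bis_mult_def\<close>)
qed

lemma bis_mult_assoc:
  assumes "U \<subseteq> arrows G" "V \<subseteq> arrows G" "W \<subseteq> arrows G"
  shows "bis_mult G (bis_mult G U V) W = bis_mult G U (bis_mult G V W)"
proof (intro equalityI subsetI)
  fix k assume "k \<in> bis_mult G (bis_mult G U V) W"
  then obtain g h w where gh: "g \<in> U" "h \<in> V" "w \<in> W" "src G g = rng G h"
    "src G (gmult G g h) = rng G w" "k = gmult G (gmult G g h) w"
    unfolding bis_mult_def by blast
  then have "g \<in> arrows G" "h \<in> arrows G" "w \<in> arrows G" using assms by auto
  then have "src G h = rng G w" "k = gmult G g (gmult G h w)" "src G g = rng G (gmult G h w)"
    using gh by (auto simp: gmult_assoc)
  then show "k \<in> bis_mult G U (bis_mult G V W)" using gh unfolding bis_mult_def by blast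
next
  fix k assume "k \<in> bis_mult G U (bis_mult G V W)"
  then obtain g h w where gh: "g \<in> U" "h \<in> V" "w \<in> W" "src G h = rng G w"
    "src G g = rng G (gmult G h w)" "k = gmult G g (gmult G h w)"
    unfolding bis_mult_def by blast
  then have "g \<in> arrows G" "h \<in> arrows G" "w \<in> arrows G" using assms by auto
  then have "src G g = rng G h" "k = gmult G (gmult G g h) w" "src G (gmult G g h) = rng G w"
    using gh by (auto simp: gmult_assoc)
  then show "k \<in> bis_mult G (bis_mult G U V) W" using gh unfolding bis_mult_def by blast
qed

lemma units_bis_mult:
  assumes "U \<subseteq> arrows G" shows "bis_mult G (units G) U = U"
proof (intro equalityI subsetI)
  fix g assume "g \<in> U"
  then have "g = gmult G (rng G g) g" "rng G g \<in> units G" "src G (rng G g) = rng G g"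
    using assms by auto
  then show "g \<in> bis_mult G (units G) U" unfolding bis_mult_def using \<open>g \<in> U\<close> by blast
qed (use assms in \<open>auto simp: bis_mult_def subset_iff\<close>)

lemma group_bis: "group (bis_group G)"
proof (rule groupI)
  show "\<exists>y\<in>carrier (bis_group G). y \<otimes>\<^bsub>bis_group G\<^esub> x = \<one>\<^bsub>bis_group G\<^esub>"
    if "x \<in> carrier (bis_group G)" for x
    using ginv_bis[OF that] ginv_bis_mult[OF that] by auto
qed (auto simp: bis_mult_closed units_bis bis_mult_assoc units_bis_mult bis_groupD(2))

sublocale bis: group "bis_group G"
  by (rule group_bis)

lemma bis_inv_eq: "U \<in> carrier (bis_group G) \<Longrightarrow> inv\<^bsub>bis_group G\<^esub> U = ginv G ` U"
  by (rule bis.inv_equality) (auto simp: ginv_bis_mult ginv_bis)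

lemma arrow_at_mult:
  assumes "U \<in> carrier (bis_group G)" "V \<in> carrier (bis_group G)" "x \<in> units G"
  shows "arrow_at G (bis_mult G U V) x = gmult G (arrow_at G U (bis_act G V x)) (arrow_at G V x)"
proof (rule arrow_at_eq)
  let ?h = "arrow_at G V x" let ?g = "arrow_at G U (rng G ?h)"
  have h: "?h \<in> V" "?h \<in> arrows G" "src G ?h = x" using arrow_at arrow_at_arrows assms by auto
  then have g: "?g \<in> U" "?g \<in> arrows G" "src G ?g = rng G ?h" using arrow_at arrow_at_arrows assms by auto
  show "gmult G (arrow_at G U (bis_act G V x)) ?h \<in> bis_mult G U V"
    unfolding bis_mult_def bis_act_def using g h by blast
  show "src G (gmult G (arrow_at G U (bis_act G V x)) ?h) = x"
    using g h by (simp add: bis_act_def)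
qed (use assms bis_mult_closed in auto)

lemma bis_act_mult:
  assumes "U \<in> carrier (bis_group G)" "V \<in> carrier (bis_group G)" "x \<in> units G"
  shows "bis_act G (bis_mult G U V) x = bis_act G U (bis_act G V x)"
proof -
  let ?h = "arrow_at G V x" let ?g = "arrow_at G U (rng G ?h)"
  have h: "?h \<in> V" "?h \<in> arrows G" "src G ?h = x" using arrow_at arrow_at_arrows assms by auto
  then have g: "?g \<in> U" "?g \<in> arrows G" "src G ?g = rng G ?h" using arrow_at arrow_at_arrows assms by auto
  have "bis_act G (bis_mult G U V) x = rng G (gmult G ?g ?h)"
    using arrow_at_mult[OF assms] by (simp add: bis_act_def)
  then show ?thesis using g h by (simp add: bis_act_def)
qed

lemma arrow_at_units: "x \<in> units G \<Longrightarrow> arrow_at G (units G) x = x"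
  by (rule arrow_at_eq) (auto simp: units_bis)

lemma bis_act_units: "x \<in> units G \<Longrightarrow> bis_act G (units G) x = x"
  by (simp add: bis_act_def arrow_at_units)

text \<open>The arrows of \<open>U\<close> over \<open>N\<close> form an open set of isotropy
  arrows, hence lie in the interior that essential principality identifies with the units. In terms
  of germs: a trivial germ comes only from a unit.\<close>

lemma arrow_at_fixed_near:
  assumes U: "U \<in> carrier (bis_group G)" and N: "openin (unit_space G) N" "x \<in> N"
    and fixes_N: "\<And>y. y \<in> N \<Longrightarrow> bis_act G U y = y"
  shows "arrow_at G U x = x"
proof -
  have NU: "openin (arr_top G) N" "N \<subseteq> units G" using N by (auto simp: openin_unit_space_iff)
  let ?V = "U \<inter> {g \<in> arrows G. src G g \<in> N}"
  have "openin (arr_top G) ?V" using bis_groupD(1)[OF U] openin_src_preimage[OF NU(1)] by blast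
  moreover have "?V \<subseteq> {g \<in> arrows G. rng G g = src G g}"
  proof (intro subsetI CollectI conjI)
    fix g assume "g \<in> ?V"
    then show "g \<in> arrows G" "rng G g = src G g"
      using fixes_N[of "src G g"] bis_act_eq[OF U _ refl, of g] by auto
  qed
  ultimately have "?V \<subseteq> arr_top G interior_of {g \<in> arrows G. rng G g = src G g}"
    by (rule interior_of_maximal[rotated])
  then have V: "?V \<subseteq> units G" using ep unfolding essentially_principal_def by simp
  have "arrow_at G U x \<in> ?V"
    using arrow_at[OF U] arrow_at_arrows[OF U] N NU by auto
  then have "arrow_at G U x \<in> units G" using V by blast
  then show ?thesis using arrow_at(2)[OF U] N NU by fastforce
qed

lemma bis_act_faithful:
  assumes U: "U \<in> carrier (bis_group G)" and "\<And>x. x \<in> units G \<Longrightarrow> bis_act G U x = x"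
  shows "U = units G"
proof -
  have "openin (unit_space G) (units G)" by (simp add: openin_unit_space_iff openin_units)
  then have at: "arrow_at G U x = x" if "x \<in> units G" for x
    using arrow_at_fixed_near[OF U] that assms by blast
  show ?thesis
  proof (intro equalityI subsetI)
    fix x assume "x \<in> units G" then show "x \<in> U" using at arrow_at(1)[OF U] by metis
  next
    fix g assume g: "g \<in> U"
    then have "arrow_at G U (src G g) = g" "src G g \<in> units G"
      using arrow_at_eq[OF U] bis_groupD(2)[OF U] by auto
    then show "g \<in> units G" using at by metis
  qed
qed

lemma bis_act_continuous:
  assumes U: "U \<in> carrier (bis_group G)"
  shows "continuous_map (unit_space G) (unit_space G) (bis_act G U)"
proof -
  have "continuous_map (unit_space G) (arr_top G) (arrow_at G U)"
    using continuous_src_section[OF bis_groupD(1,4)[OF U]] bis_groupD(5)[OF U]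
    by (simp add: arrow_at_def[abs_def] unit_space_def)
  then have "continuous_map (unit_space G) (arr_top G) (bis_act G U)"
    using continuous_map_compose[OF _ continuous_rng] unfolding bis_act_def[abs_def] comp_def by blast
  moreover have "bis_act G U \<in> topspace (unit_space G) \<rightarrow> units G"
    using bis_act_closed[OF U] by auto
  ultimately show ?thesis
    by (simp add: unit_space_def continuous_map_in_subtopology)
qed

section \<open>Minimality, local bisections and three-cycles\<close>

lemma orbit_meets:
  assumes "x \<in> units G" "openin (unit_space G) W" "W \<noteq> {}"
  obtains g where "g \<in> arrows G" "src G g = x" "rng G g \<in> W"
proof -
  obtain y where y: "y \<in> W" using assms by blast
  then have "y \<in> unit_space G closure_of orbit G x"
    using min assms openin_subset[OF assms(2)] unfolding minimal_groupoid_def by auto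
  then obtain z where "z \<in> orbit G x" "z \<in> W"
    using y assms(2) unfolding in_closure_of by blast
  then show thesis using that by (auto simp: orbit_def)
qed

lemma open_units_Diff_finite:
  assumes "openin (unit_space G) U" "U \<noteq> {}" "finite F"
  shows "openin (unit_space G) (U - F)" "U - F \<noteq> {}"
  using openin_Diff_finite[OF Hausdorff_unit_space assms(1,3)]
    open_Diff_finite_nonempty[OF Hausdorff_unit_space _ assms] no_isolated_unit by auto

lemma compactin_closedin_units:
  assumes "compactin (arr_top G) S" "S \<subseteq> units G" shows "closedin (unit_space G) S"
  using assms compactin_imp_closedin[OF Hausdorff_unit_space]
  by (simp add: unit_space_def compactin_subtopology)

lemma closedin_units_compactin:
  assumes "closedin (unit_space G) S" shows "compactin (arr_top G) S"
  using closedin_compact_space[OF compact_unit_space assms]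
  by (simp add: unit_space_def compactin_subtopology)

text \<open>Closedness of both ends is what makes the unit part of \<open>swap\<close> open. Cutting
  down to a clopen source makes the bisection compact, and then its range is closed too. Injectivity
  of the source near \<open>g\<close> is injectivity of the range near the inverse of
  \<open>g\<close>.\<close>

lemma local_bisection:
  assumes g: "g \<in> arrows G" and P: "openin (unit_space G) P" "src G g \<in> P"
    and Q: "openin (unit_space G) Q" "rng G g \<in> Q"
  obtains A where "openin (arr_top G) A" "g \<in> A" "inj_on (src G) A" "inj_on (rng G) A"
    "src G ` A \<subseteq> P" "rng G ` A \<subseteq> Q"
    "closedin (unit_space G) (src G ` A)" "closedin (unit_space G) (rng G ` A)"
proof -
  have loc: "\<exists>U. openin (arr_top G) U \<and> h \<in> U \<and> inj_on (rng G) U" if "h \<in> arrows G" for h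
  proof -
    obtain U where U: "openin (arr_top G) U" "h \<in> U"
      "homeomorphic_map (subtopology (arr_top G) U) (subtopology (unit_space G) (rng G ` U)) (rng G)"
      using etale \<open>h \<in> arrows G\<close> unfolding local_homeomorphism_def by auto
    have "topspace (subtopology (arr_top G) U) = U"
      using openin_subset[OF U(1)] by auto
    then have "inj_on (rng G) U" using homeomorphic_imp_injective_map[OF U(3)] by simp
    then show ?thesis using U by blast
  qed
  obtain U where U: "openin (arr_top G) U" "g \<in> U" "inj_on (rng G) U" using loc g by blast
  obtain V where V: "openin (arr_top G) V" "ginv G g \<in> V" "inj_on (rng G) V"
    using loc[of "ginv G g"] g inv_closed by blast
  define N where "N = U \<inter> ginv G ` V \<inter> {a \<in> arrows G. src G a \<in> P} \<inter> {a \<in> arrows G. rng G a \<in> Q}"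
  have PQ: "openin (arr_top G) P" "openin (arr_top G) Q"
    using P Q by (auto simp: openin_unit_space_iff)
  have "g = ginv G (ginv G g)" using g by simp
  then have "g \<in> ginv G ` V" using V(2) by (metis imageI)
  then have gN: "g \<in> N" using U g P Q by (auto simp: N_def)
  have N: "openin (arr_top G) N"
    unfolding N_def by (intro openin_Int U(1) openin_ginv_image V(1) openin_src_preimage openin_rng_preimage PQ)
  have VA: "V \<subseteq> arrows G" using openin_subset[OF V(1)] by simp
  have "inj_on (src G) (ginv G ` V)"
  proof (rule inj_onI)
    fix a b assume "a \<in> ginv G ` V" "b \<in> ginv G ` V" and e: "src G a = src G b"
    then obtain v w where "v \<in> V" "w \<in> V" "a = ginv G v" "b = ginv G w" by blast
    then show "a = b" using e inj_onD[OF V(3), of v w] VA by (auto simp: src_inv subset_iff)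
  qed
  then have injN: "inj_on (src G) N" "inj_on (rng G) N"
    using U(3) by (auto simp: N_def intro: inj_on_subset)
  have "openin (unit_space G) (src G ` N)"
    using openin_src_image[OF N] openin_subset[OF N] by (auto simp: openin_unit_space_iff)
  then obtain K where K: "openin (unit_space G) K" "closedin (unit_space G) K" "src G g \<in> K" "K \<subseteq> src G ` N"
    using clopen_units gN by blast
  define A where "A = {a \<in> N. src G a \<in> K}"
  have A_N: "A = N \<inter> {a \<in> arrows G. src G a \<in> K}"
    using openin_subset[OF N] by (auto simp: A_def)
  have A: "openin (arr_top G) A"
    unfolding A_N using N K(1) openin_src_preimage by (auto simp: openin_unit_space_iff)
  have cA: "compactin (arr_top G) A"
    unfolding A_def using N injN(1) closedin_units_compactin[OF K(2)] K(4) by (rule compactin_bisection)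
  have srcA: "src G ` A = K" using K(4) by (auto simp: A_def)
  have "compactin (arr_top G) (rng G ` A)" using image_compactin[OF cA continuous_rng] .
  moreover have "rng G ` A \<subseteq> units G" using openin_subset[OF A] by auto
  ultimately have "closedin (unit_space G) (rng G ` A)" by (rule compactin_closedin_units)
  then show thesis
    using that[of A] A gN K injN srcA by (auto simp: A_def N_def intro: inj_on_subset)
qed

text \<open>For an open bisection with disjoint clopen ends, the involution that exchanges the ends
  along \<open>A\<close> and is the identity elsewhere.\<close>

definition swap :: "'a set \<Rightarrow> 'a set" where
  "swap A = A \<union> ginv G ` A \<union> (units G - (src G ` A \<union> rng G ` A))"

lemma swap_bis:
  assumes A: "openin (arr_top G) A" "inj_on (src G) A" "inj_on (rng G) A"
    and cl: "closedin (unit_space G) (src G ` A)" "closedin (unit_space G) (rng G ` A)"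
    and disj: "src G ` A \<inter> rng G ` A = {}"
  shows "swap A \<in> carrier (bis_group G)" "ginv G ` swap A = swap A"
proof -
  let ?E = "units G - (src G ` A \<union> rng G ` A)"
  have AA: "A \<subseteq> arrows G" using openin_subset[OF A(1)] by simp
  have sr: "src G (ginv G a) = rng G a" "rng G (ginv G a) = src G a" if "a \<in> A" for a
    using that AA by (auto simp: src_inv rng_inv)
  have img: "src G ` ginv G ` A = rng G ` A" "rng G ` ginv G ` A = src G ` A"
    using sr by (auto simp: image_image)
  have imE: "src G ` ?E = ?E" "rng G ` ?E = ?E" by (auto simp: image_iff)
  have subs: "src G ` A \<subseteq> units G" "rng G ` A \<subseteq> units G" using AA by auto
  have op: "openin (arr_top G) (swap A)"
  proof -
    have "openin (unit_space G) (topspace (unit_space G) - (src G ` A \<union> rng G ` A))"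
      using cl by blast
    then have "openin (arr_top G) ?E" by (simp add: openin_unit_space_iff)
    then show ?thesis unfolding swap_def using A(1) openin_ginv_image by blast
  qed
  have injI: "inj_on (src G) (ginv G ` A)" "inj_on (rng G) (ginv G ` A)"
    using A(2,3) sr by (auto simp: inj_on_def)
  have injE: "inj_on (src G) ?E" "inj_on (rng G) ?E" by (auto simp: inj_on_def)
  have Un: "inj_on f (B \<union> C)" if "inj_on f B" "inj_on f C" "f ` B \<inter> f ` C = {}" for f :: "'a \<Rightarrow> 'a" and B C
    using that by (auto simp: inj_on_Un)
  have inj: "inj_on (src G) (swap A)" "inj_on (rng G) (swap A)"
    unfolding swap_def
    by (intro Un A injI injE; use disj in \<open>auto simp only: image_Un img imE\<close>)+
  have onto: "src G ` swap A = units G" "rng G ` swap A = units G"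
    unfolding swap_def image_Un img imE using subs by auto
  show "swap A \<in> carrier (bis_group G)" using op inj(2,1) onto by (rule bis_groupI)
  have "ginv G ` ginv G ` A = A" using AA by (force simp: image_image)
  moreover have "ginv G ` ?E = ?E" by (auto simp: image_iff)
  ultimately show "ginv G ` swap A = swap A" unfolding swap_def image_Un by auto
qed

text \<open>Reading the word from right to left at \<open>x\<close>: \<open>swap B\<close> fixes
  \<open>x\<close>, \<open>swap A\<close> moves it along \<open>a\<close> to the third point
  \<open>y\<close>, \<open>swap B\<close> moves that along \<open>b\<close> to \<open>z\<close>, and
  \<open>swap A\<close> fixes \<open>z\<close>. The arrow collected is \<open>gmult G b a\<close>,
  that is \<open>g\<close>. Both factors are involutions, so the word is a commutator.\<close>

lemma three_cycle:
  assumes g: "g \<in> arrows G" "src G g \<noteq> rng G g"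
    and U: "openin (unit_space G) U" "src G g \<in> U" "rng G g \<in> U"
  obtains T where "T \<in> derived (bis_group G) (carrier (bis_group G))" "g \<in> T" "units G - U \<subseteq> T"
proof -
  define x z where "x = src G g" and "z = rng G g"
  have xz: "x \<in> units G" "z \<in> units G" "x \<noteq> z" using g by (auto simp: x_def z_def)
  obtain a where a: "a \<in> arrows G" "src G a = x" "rng G a \<in> U - {x, z}"
    using orbit_meets[OF xz(1) open_units_Diff_finite[OF U(1), of "{x, z}"]] U by auto
  define y where "y = rng G a"
  have y: "y \<in> U" "y \<noteq> x" "y \<noteq> z" "y \<in> units G" using a by (auto simp: y_def)
  define b where "b = gmult G g (ginv G a)"
  have b: "b \<in> arrows G" "src G b = y" "rng G b = z"
    using g a by (auto simp: b_def y_def x_def z_def inv_closed src_inv rng_inv)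
  have ba: "gmult G b a = g"
    using g a unfolding b_def
    by (subst gmult_assoc) (auto simp: x_def inv_closed src_inv rng_inv inv_mult)
  have sep: "\<exists>P Q. openin (unit_space G) P \<and> openin (unit_space G) Q \<and> p \<in> P \<and> q \<in> Q \<and> P \<inter> Q = {}"
    if "p \<in> units G" "q \<in> units G" "p \<noteq> q" for p q
    using Hausdorff_unit_space that unfolding Hausdorff_space_def disjnt_def by auto
  obtain P1 P2 where P: "openin (unit_space G) P1" "openin (unit_space G) P2" "x \<in> P1" "y \<in> P2" "P1 \<inter> P2 = {}"
    using sep[of x y] xz y by blast
  obtain Q1 Q2 where Q: "openin (unit_space G) Q1" "openin (unit_space G) Q2" "x \<in> Q1" "z \<in> Q2" "Q1 \<inter> Q2 = {}"
    using sep[of x z] xz y by blast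
  obtain R1 R2 where R: "openin (unit_space G) R1" "openin (unit_space G) R2" "y \<in> R1" "z \<in> R2" "R1 \<inter> R2 = {}"
    using sep[of y z] xz y by blast
  \<comment> \<open>With these pairwise disjoint neighbourhoods \<open>swap A\<close> acts only on
    \<open>Nx\<close> and \<open>Ny\<close>, and \<open>swap B\<close> only on \<open>Ny\<close> and
    \<open>Nz\<close>. So \<open>x\<close> is fixed by \<open>swap B\<close>, \<open>z\<close> by
    \<open>swap A\<close>, and every unit off \<open>U\<close> by both.\<close>
  define Nx Ny Nz where "Nx = U \<inter> P1 \<inter> Q1" and "Ny = U \<inter> P2 \<inter> R1" and "Nz = U \<inter> Q2 \<inter> R2"
  have N: "openin (unit_space G) Nx" "openin (unit_space G) Ny" "openin (unit_space G) Nz"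
    unfolding Nx_def Ny_def Nz_def by (intro openin_Int U(1) P(1,2) Q(1,2) R(1,2))+
  have mem: "x \<in> Nx" "y \<in> Ny" "z \<in> Nz"
    using U P Q R y by (auto simp: Nx_def Ny_def Nz_def x_def z_def)
  have dis: "Nx \<inter> Ny = {}" "Nx \<inter> Nz = {}" "Ny \<inter> Nz = {}"
    using P(5) Q(5) R(5) unfolding Nx_def Ny_def Nz_def by blast+
  have NU: "Nx \<subseteq> U" "Ny \<subseteq> U" "Nz \<subseteq> U" unfolding Nx_def Ny_def Nz_def by blast+
  obtain A where A: "openin (arr_top G) A" "a \<in> A" "inj_on (src G) A" "inj_on (rng G) A"
    "src G ` A \<subseteq> Nx" "rng G ` A \<subseteq> Ny"
    "closedin (unit_space G) (src G ` A)" "closedin (unit_space G) (rng G ` A)"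
    using local_bisection[OF a(1) N(1) _ N(2)] a mem by (auto simp: y_def)
  obtain B where B: "openin (arr_top G) B" "b \<in> B" "inj_on (src G) B" "inj_on (rng G) B"
    "src G ` B \<subseteq> Ny" "rng G ` B \<subseteq> Nz"
    "closedin (unit_space G) (src G ` B)" "closedin (unit_space G) (rng G ` B)"
    using local_bisection[OF b(1) N(2) _ N(3)] b mem by auto
  have disA: "src G ` A \<inter> rng G ` A = {}" and disB: "src G ` B \<inter> rng G ` B = {}"
    using A(5,6) B(5,6) dis by blast+
  note SA = swap_bis[OF A(1,3,4,7,8) disA] and SB = swap_bis[OF B(1,3,4,7,8) disB]
  define T where "T = bis_mult G (bis_mult G (bis_mult G (swap A) (swap B)) (swap A)) (swap B)"
  have "T = swap A \<otimes>\<^bsub>bis_group G\<^esub> swap B \<otimes>\<^bsub>bis_group G\<^esub> inv\<^bsub>bis_group G\<^esub> swap A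
      \<otimes>\<^bsub>bis_group G\<^esub> inv\<^bsub>bis_group G\<^esub> swap B"
    using SA SB by (simp add: T_def bis_inv_eq)
  then have TD: "T \<in> derived (bis_group G) (carrier (bis_group G))"
    unfolding derived_def using SA(1) SB(1) by (intro generate.incl) blast
  have zA: "z \<in> swap A" and xB: "x \<in> swap B"
    using xz A(5,6) B(5,6) mem dis by (auto simp: swap_def)
  have aA: "a \<in> swap A" and bB: "b \<in> swap B" using A(2) B(2) by (auto simp: swap_def)
  have "gmult G z b \<in> bis_mult G (swap A) (swap B)"
    by (rule bis_multI[OF zA bB]) (use b xz in simp)
  then have "b \<in> bis_mult G (swap A) (swap B)" using b xz by simp
  then have "gmult G b a \<in> bis_mult G (bis_mult G (swap A) (swap B)) (swap A)"
    by (rule bis_multI[OF _ aA]) (simp add: b y_def)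
  then have "g \<in> bis_mult G (bis_mult G (swap A) (swap B)) (swap A)" by (simp only: ba)
  then have "gmult G g x \<in> T"
    unfolding T_def by (rule bis_multI[OF _ xB]) (use xz in \<open>simp add: x_def\<close>)
  then have gT: "g \<in> T" using g by (simp add: x_def)
  have "w \<in> T" if w: "w \<in> units G - U" for w
  proof -
    have sw: "w \<in> swap A" "w \<in> swap B"
      using w A(5,6) B(5,6) NU by (auto simp: swap_def)
    have ww: "gmult G w w = w" "src G w = rng G w" using w units_arrows by auto
    have step: "w \<in> bis_mult G S S'" if "w \<in> S" "w \<in> S'" for S S'
      using bis_multI[of w S w S' G] that ww by simp
    show ?thesis unfolding T_def by (intro step sw)
  qed
  then show thesis using that TD gT by blast
qed

section \<open>Subgroups containing all commutators\<close>

lemma locally_dense_bis_subgroup: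
  assumes H: "subgroup H (bis_group G)" and D: "derived (bis_group G) (carrier (bis_group G)) \<subseteq> H"
  shows "locally_dense_action ((bis_group G)\<lparr>carrier := H\<rparr>) (unit_space G) (bis_act G)"
proof -
  have HB: "U \<in> carrier (bis_group G)" if "U \<in> H" for U using that subgroup.subset[OF H] by blast
  interpret H: group "(bis_group G)\<lparr>carrier := H\<rparr>" using bis.subgroup_imp_group[OF H] .
  show ?thesis
  proof
    fix U x W assume U: "openin (unit_space G) U" "x \<in> U" and W: "openin (unit_space G) W" "W \<subseteq> U" "W \<noteq> {}"
    have xU: "x \<in> units G" using U openin_subset by fastforce
    \<comment> \<open>Aiming at \<open>W - {x}\<close> instead of \<open>W\<close> makes the ends of
      \<open>g\<close> distinct, as \<open>three_cycle\<close> requires.\<close>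
    obtain g where g: "g \<in> arrows G" "src G g = x" "rng G g \<in> W - {x}"
      using orbit_meets[OF xU open_units_Diff_finite[OF W(1,3), of "{x}"]] by auto
    have ne: "src G g \<noteq> rng G g" and gU: "src G g \<in> U" "rng G g \<in> U" using g U W by auto
    obtain T where T: "T \<in> derived (bis_group G) (carrier (bis_group G))" "g \<in> T" "units G - U \<subseteq> T"
      using three_cycle[OF g(1) ne U(1) gU] by blast
    have TH: "T \<in> H" using T D by blast
    have "bis_act G T w = w" if "w \<in> units G - U" for w
      using bis_act_eq[OF HB[OF TH], of w w] that T by auto
    moreover have "bis_act G T x \<in> W"
      using bis_act_eq[OF HB[OF TH] T(2) g(2)] g by auto
    ultimately show "\<exists>k\<in>carrier ((bis_group G)\<lparr>carrier := H\<rparr>).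
        (\<forall>y\<in>topspace (unit_space G) - U. bis_act G k y = y) \<and> bis_act G k x \<in> W"
      using TH by auto
  qed (use HB in \<open>auto simp: bis_act_closed bis_act_units bis_act_mult bis_act_continuous
      bis_act_faithful Hausdorff_unit_space compact_unit_space no_isolated_unit\<close>)
qed

text \<open>An isotropy arrow \<open>g\<close> is the inverse of \<open>h\<close> times
  \<open>gmult G h g\<close>, where \<open>h\<close> leaves the common end point of
  \<open>g\<close>; both \<open>h\<close> and this product have distinct ends.\<close>

lemma arrow_in_bis_subgroup:
  assumes H: "subgroup H (bis_group G)" and D: "derived (bis_group G) (carrier (bis_group G)) \<subseteq> H"
    and g: "g \<in> arrows G"
  obtains T where "T \<in> H" "g \<in> T"
proof -
  have un: "openin (unit_space G) (units G)" by (simp add: openin_unit_space_iff openin_units)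
  have *: "\<exists>T\<in>H. k \<in> T" if "k \<in> arrows G" "src G k \<noteq> rng G k" for k
    using three_cycle[OF that un] that D by (metis rng_units src_units subsetD)
  show thesis
  proof (cases "src G g = rng G g")
    case False
    then show thesis using * g that by blast
  next
    case True
    obtain h where h: "h \<in> arrows G" "src G h = src G g" "rng G h \<in> units G - {src G g}"
      using orbit_meets[OF src_units[OF g] open_units_Diff_finite[OF un, of "{src G g}"]] src_units[OF g]
      by auto
    let ?k = "gmult G h g"
    have k: "?k \<in> arrows G" "src G ?k \<noteq> rng G ?k" using g h True by auto
    obtain S where S: "S \<in> H" "h \<in> S" using * h by force
    obtain T where T: "T \<in> H" "?k \<in> T" using * k by blast
    have SB: "S \<in> carrier (bis_group G)" using S subgroup.subset[OF H] by blast
    have "bis_mult G (ginv G ` S) T \<in> H"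
      using S T subgroup.m_closed[OF H] subgroup.m_inv_closed[OF H] bis_inv_eq[OF SB] by fastforce
    moreover have "gmult G (ginv G h) ?k \<in> bis_mult G (ginv G ` S) T"
      using S T g h True by (intro bis_multI) (auto simp: src_inv)
    then have "g \<in> bis_mult G (ginv G ` S) T" using g h True by simp
    ultimately show thesis by (rule that)
  qed
qed

end

section \<open>Lifting an equivariant homeomorphism to arrows\<close>

text \<open>Both inverses belong to the data, which makes the situation symmetric: the inverse of
  the lift is the lift for the swapped instance.\<close>

locale spatial_iso = G: cantor_groupoid G + K: cantor_groupoid K
  for G :: "'a top_groupoid" and K :: "'b top_groupoid" +
  fixes H :: "'a set set" and L :: "'b set set" and \<Phi> :: "'a set \<Rightarrow> 'b set" and \<Psi> :: "'b set \<Rightarrow> 'a set"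
    and \<phi> :: "'a \<Rightarrow> 'b" and \<psi> :: "'b \<Rightarrow> 'a"
  assumes H: "subgroup H (bis_group G)" "derived (bis_group G) (carrier (bis_group G)) \<subseteq> H"
    and L: "subgroup L (bis_group K)" "derived (bis_group K) (carrier (bis_group K)) \<subseteq> L"
    and \<Phi>_closed: "U \<in> H \<Longrightarrow> \<Phi> U \<in> L"
    and \<Psi>_closed: "W \<in> L \<Longrightarrow> \<Psi> W \<in> H"
    and \<Psi>_\<Phi>: "U \<in> H \<Longrightarrow> \<Psi> (\<Phi> U) = U"
    and \<Phi>_\<Psi>: "W \<in> L \<Longrightarrow> \<Phi> (\<Psi> W) = W"
    and \<Phi>_mult: "\<lbrakk>U \<in> H; V \<in> H\<rbrakk> \<Longrightarrow> \<Phi> (bis_mult G U V) = bis_mult K (\<Phi> U) (\<Phi> V)"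
    and homeo: "homeomorphic_maps (unit_space G) (unit_space K) \<phi> \<psi>"
    and equivariant: "\<lbrakk>U \<in> H; x \<in> units G\<rbrakk> \<Longrightarrow> \<phi> (bis_act G U x) = bis_act K (\<Phi> U) (\<phi> x)"
begin

lemma H_bis: "U \<in> H \<Longrightarrow> U \<in> carrier (bis_group G)"
  using subgroup.subset[OF H(1)] by blast

lemma L_bis: "U \<in> L \<Longrightarrow> U \<in> carrier (bis_group K)"
  using subgroup.subset[OF L(1)] by blast

lemma H_mult: "\<lbrakk>U \<in> H; V \<in> H\<rbrakk> \<Longrightarrow> bis_mult G U V \<in> H"
  using subgroup.m_closed[OF H(1)] by fastforce

lemma L_mult: "\<lbrakk>U \<in> L; V \<in> L\<rbrakk> \<Longrightarrow> bis_mult K U V \<in> L"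
  using subgroup.m_closed[OF L(1)] by fastforce

lemma \<phi>_units: "x \<in> units G \<Longrightarrow> \<phi> x \<in> units K"
  using homeo by (auto simp: homeomorphic_maps_def continuous_map_def)

lemma \<psi>_units: "y \<in> units K \<Longrightarrow> \<psi> y \<in> units G"
  using homeo by (auto simp: homeomorphic_maps_def continuous_map_def)

lemma \<psi>_\<phi>: "x \<in> units G \<Longrightarrow> \<psi> (\<phi> x) = x"
  using homeo by (simp add: homeomorphic_maps_def)

lemma \<phi>_\<psi>: "y \<in> units K \<Longrightarrow> \<phi> (\<psi> y) = y"
  using homeo by (simp add: homeomorphic_maps_def)

lemma swap_iso: "spatial_iso K G L H \<Psi> \<Phi> \<psi> \<phi>"
proof (intro spatial_iso.intro spatial_iso_axioms.intro)
  show "\<Psi> (bis_mult K U V) = bis_mult G (\<Psi> U) (\<Psi> V)" if "U \<in> L" "V \<in> L" for U V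
    using \<Phi>_mult[of "\<Psi> U" "\<Psi> V"] that \<Psi>_closed \<Phi>_\<Psi> \<Psi>_\<Phi> H_mult by metis
  show "\<psi> (bis_act K V y) = bis_act G (\<Psi> V) (\<psi> y)" if "V \<in> L" "y \<in> units K" for V y
  proof -
    have "\<phi> (bis_act G (\<Psi> V) (\<psi> y)) = bis_act K V y"
      using equivariant[of "\<Psi> V" "\<psi> y"] that \<Psi>_closed \<Phi>_\<Psi> \<phi>_\<psi> \<psi>_units by simp
    then show ?thesis
      using that \<psi>_\<phi>[of "bis_act G (\<Psi> V) (\<psi> y)"] G.bis_act_closed H_bis \<Psi>_closed \<psi>_units by metis
  qed
  show "homeomorphic_maps (unit_space K) (unit_space G) \<psi> \<phi>"
    using homeo homeomorphic_maps_sym by blast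
qed (fact G.cantor_groupoid_axioms K.cantor_groupoid_axioms H L
    | simp add: \<Psi>_closed \<Phi>_closed \<Psi>_\<Phi> \<Phi>_\<Psi>)+

definition lift :: "'a \<Rightarrow> 'b" where
  "lift g = arrow_at K (\<Phi> (SOME U. U \<in> H \<and> g \<in> U)) (\<phi> (src G g))"

text \<open>Two elements of \<open>H\<close> through \<open>g\<close> agree near \<open>src G g\<close>, hence so do their images near
  \<open>\<phi> (src G g)\<close>, and essential principality of \<open>K\<close> makes the arrows above that point equal.\<close>

lemma lift_eq:
  assumes U: "U \<in> H" "g \<in> U"
  shows "lift g = arrow_at K (\<Phi> U) (\<phi> (src G g))"
proof -
  define V where "V = (SOME V. V \<in> H \<and> g \<in> V)"
  have V: "V \<in> H" "g \<in> V" using someI[of "\<lambda>V. V \<in> H \<and> g \<in> V" U] U by (auto simp: V_def)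
  note UB = H_bis[OF U(1)] and VB = H_bis[OF V(1)]
  define x where "x = src G g"
  have g: "g \<in> arrows G" using G.bis_groupD(2)[OF UB] U by blast
  have x: "x \<in> units G" using g by (simp add: x_def)
  \<comment> \<open>Comparing \<open>U\<close> and \<open>V\<close> through their quotient turns
    agreement near a point into triviality of one germ, a condition that \<phi> carries over to
    \<open>K\<close>.\<close>
  define W where "W = inv\<^bsub>bis_group G\<^esub> V \<otimes>\<^bsub>bis_group G\<^esub> U"
  have WH: "W \<in> H" unfolding W_def
    by (intro subgroup.m_closed[OF H(1)] subgroup.m_inv_closed[OF H(1)] U V)
  have iV: "inv\<^bsub>bis_group G\<^esub> V \<in> carrier (bis_group G)" using VB by simp
  have VW: "bis_mult G V W = U"
    using G.bis.inv_solve_left[of W V U] UB VB H_bis[OF WH] by (simp add: W_def)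
  define N where "N = src G ` (U \<inter> V)"
  have "openin (arr_top G) (U \<inter> V)" using G.bis_groupD(1) UB VB by blast
  then have N: "openin (unit_space G) N" "x \<in> N"
    using G.openin_src_image[of "U \<inter> V"] U V G.bis_groupD(2)[OF UB]
    unfolding N_def x_def by (auto simp: G.openin_unit_space_iff)
  have actW: "bis_act G W y = y" if "y \<in> N" for y
  proof -
    obtain k where k: "k \<in> U" "k \<in> V" "y = src G k" using \<open>y \<in> N\<close> by (auto simp: N_def)
    have yU: "y \<in> units G" using N(1) \<open>y \<in> N\<close> by (auto simp: G.openin_unit_space_iff)
    have "bis_act G U y = bis_act G V y"
      using G.bis_act_eq[OF UB k(1)] G.bis_act_eq[OF VB k(2)] k(3) by simp
    then have "bis_act G W y = bis_act G (inv\<^bsub>bis_group G\<^esub> V) (bis_act G V y)"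
      unfolding W_def using G.bis_act_mult[OF iV UB yU] by simp
    also have "\<dots> = bis_act G (bis_mult G (inv\<^bsub>bis_group G\<^esub> V) V) y"
      using G.bis_act_mult[OF iV VB yU] by simp
    also have "\<dots> = y" using G.bis.l_inv[OF VB] G.bis_act_units[OF yU] by simp
    finally show ?thesis .
  qed
  note \<Phi>WB = L_bis[OF \<Phi>_closed[OF WH]]
  have "homeomorphic_map (unit_space G) (unit_space K) \<phi>"
    using homeo homeomorphic_map_maps by blast
  then have N': "openin (unit_space K) (\<phi> ` N)"
    using N(1) homeomorphic_imp_open_map open_map_def by blast
  have "bis_act K (\<Phi> W) y = y" if "y \<in> \<phi> ` N" for y
  proof -
    obtain u where u: "u \<in> N" "y = \<phi> u" using \<open>y \<in> \<phi> ` N\<close> by blast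
    then have "u \<in> units G" using N(1) by (auto simp: G.openin_unit_space_iff)
    then show ?thesis using equivariant[OF WH] actW[OF u(1)] u(2) by metis
  qed
  then have at: "arrow_at K (\<Phi> W) (\<phi> x) = \<phi> x"
    using K.arrow_at_fixed_near[OF \<Phi>WB N'] N(2) by blast
  have \<phi>x: "\<phi> x \<in> units K" using \<phi>_units x by blast
  have "bis_act K (\<Phi> W) (\<phi> x) = \<phi> x" using at \<phi>x by (simp add: bis_act_def)
  moreover note K.arrow_at_mult[OF L_bis[OF \<Phi>_closed[OF V(1)]] \<Phi>WB \<phi>x]
  ultimately have "arrow_at K (bis_mult K (\<Phi> V) (\<Phi> W)) (\<phi> x) = gmult K (arrow_at K (\<Phi> V) (\<phi> x)) (\<phi> x)"
    using at by simp
  also have "\<dots> = arrow_at K (\<Phi> V) (\<phi> x)"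
    using \<phi>x K.arrow_at(2) K.arrow_at_arrows L_bis[OF \<Phi>_closed[OF V(1)]] by simp
  also have "bis_mult K (\<Phi> V) (\<Phi> W) = \<Phi> U"
    using \<Phi>_mult[OF V(1) WH] VW by simp
  finally show ?thesis by (simp add: lift_def V_def x_def)
qed

lemma arrow_cover:
  assumes "g \<in> arrows G" obtains U where "U \<in> H" "g \<in> U" "U \<in> carrier (bis_group G)"
  using G.arrow_in_bis_subgroup[OF H assms, of thesis] H_bis by simp

lemma lift:
  assumes U: "U \<in> H" "g \<in> U"
  shows "lift g \<in> \<Phi> U" "lift g \<in> arrows K" "src K (lift g) = \<phi> (src G g)" "rng K (lift g) = \<phi> (rng G g)"
proof -
  note UB = H_bis[OF U(1)]
  have x: "src G g \<in> units G" using G.bis_groupD(2)[OF UB] U by auto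
  note \<Phi>U = L_bis[OF \<Phi>_closed[OF U(1)]]
  show "lift g \<in> \<Phi> U" "lift g \<in> arrows K" "src K (lift g) = \<phi> (src G g)"
    unfolding lift_eq[OF U] using K.arrow_at[OF \<Phi>U \<phi>_units[OF x]] K.arrow_at_arrows[OF \<Phi>U \<phi>_units[OF x]] by auto
  show "rng K (lift g) = \<phi> (rng G g)"
    using equivariant[OF U(1) x] G.bis_act_eq[OF UB U(2)] unfolding lift_eq[OF U] bis_act_def[of K] by simp
qed

text \<open>The product of two bisections consists of the products of their arrows, so
  \<open>gmult K (lift g) (lift h)\<close> is the arrow over \<phi> \<open>(src G h)\<close> in the
  image of \<open>bis_mult G U V\<close>.\<close>

lemma lift_mult:
  assumes "(g, h) \<in> composable G"
  shows "(lift g, lift h) \<in> composable K" "lift (gmult G g h) = gmult K (lift g) (lift h)"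
proof -
  have gh: "g \<in> arrows G" "h \<in> arrows G" "src G g = rng G h" using assms by (auto simp: G.composable_iff)
  obtain U where U: "U \<in> H" "g \<in> U" using arrow_cover gh by blast
  obtain V where V: "V \<in> H" "h \<in> V" using arrow_cover gh by blast
  note lg = lift[OF U] and lh = lift[OF V]
  show "(lift g, lift h) \<in> composable K" using lg lh gh by (simp add: K.composable_iff)
  have UV: "bis_mult G U V \<in> H" "gmult G g h \<in> bis_mult G U V"
    using H_mult U V gh by (auto intro: bis_multI)
  have "lift (gmult G g h) = arrow_at K (bis_mult K (\<Phi> U) (\<Phi> V)) (\<phi> (src G h))"
    using lift_eq[OF UV] \<Phi>_mult[OF U(1) V(1)] gh by simp
  also have "\<dots> = gmult K (lift g) (lift h)"
  proof (rule K.arrow_at_eq)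
    show "bis_mult K (\<Phi> U) (\<Phi> V) \<in> carrier (bis_group K)"
      using L_bis L_mult \<Phi>_closed U V by blast
    show "gmult K (lift g) (lift h) \<in> bis_mult K (\<Phi> U) (\<Phi> V)"
      by (rule bis_multI) (use lg lh gh in auto)
    show "src K (gmult K (lift g) (lift h)) = \<phi> (src G h)" using lg lh gh by simp
  qed
  finally show "lift (gmult G g h) = gmult K (lift g) (lift h)" .
qed

text \<open>On a bisection \<open>U\<close> the lift is the source map, followed by \<phi> and by
  the section of the source map over \<Phi> \<open>U\<close>; arrows are covered by such
  bisections.\<close>

lemma lift_continuous: "continuous_map (arr_top G) (arr_top K) lift"
  unfolding continuous_map_def
proof (intro conjI allI impI)
  show "lift \<in> topspace (arr_top G) \<rightarrow> topspace (arr_top K)"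
    using lift(2) arrow_cover by (metis G.topspace_arr K.topspace_arr Pi_I)
  fix N assume N: "openin (arr_top K) N"
  show "openin (arr_top G) {g \<in> topspace (arr_top G). lift g \<in> N}"
  proof (subst openin_subopen, intro ballI)
    fix g assume "g \<in> {g \<in> topspace (arr_top G). lift g \<in> N}"
    then have g: "g \<in> arrows G" "lift g \<in> N" by auto
    obtain U where U: "U \<in> H" "g \<in> U" "U \<in> carrier (bis_group G)" using arrow_cover g by blast
    note \<Phi>U = L_bis[OF \<Phi>_closed[OF U(1)]]
    let ?M = "src K ` (\<Phi> U \<inter> N)"
    have "openin (arr_top K) (\<Phi> U \<inter> N)" using K.bis_groupD(1)[OF \<Phi>U] N by blast
    then have M: "openin (unit_space K) ?M"
      using K.openin_src_image K.bis_groupD(2)[OF \<Phi>U] by (auto simp: K.openin_unit_space_iff)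
    have "continuous_map (unit_space G) (unit_space K) \<phi>" using homeo by (simp add: homeomorphic_maps_def)
    then have "openin (unit_space G) {x \<in> units G. \<phi> x \<in> ?M}"
      using M openin_continuous_map_preimage by fastforce
    then have "openin (arr_top G) {x \<in> units G. \<phi> x \<in> ?M}" by (simp add: G.openin_unit_space_iff)
    then have op: "openin (arr_top G) (U \<inter> {k \<in> arrows G. src G k \<in> {x \<in> units G. \<phi> x \<in> ?M}})"
      using G.openin_src_preimage G.bis_groupD(1)[OF U(3)] by blast
    have "lift k \<in> N" if k: "k \<in> U" "\<phi> (src G k) \<in> ?M" for k
    proof -
      obtain m where m: "m \<in> \<Phi> U" "m \<in> N" "src K m = \<phi> (src G k)" using k(2) by auto
      have "lift k = m" using lift_eq[OF U(1) k(1)] K.arrow_at_eq[OF \<Phi>U m(1,3)] by simp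
      then show ?thesis using m by simp
    qed
    moreover have "\<phi> (src G g) \<in> ?M" using lift[OF U(1,2)] g by (metis IntI imageI)
    ultimately show "\<exists>T. openin (arr_top G) T \<and> g \<in> T \<and> T \<subseteq> {g \<in> topspace (arr_top G). lift g \<in> N}"
      using op g U(2) by (intro exI[of _ "U \<inter> {k \<in> arrows G. src G k \<in> {x \<in> units G. \<phi> x \<in> ?M}}"]) auto
  qed
qed

end

lemma (in spatial_iso) lift_lift:
  assumes g: "g \<in> arrows G"
  shows "spatial_iso.lift K G L \<Psi> \<psi> (lift g) = g"
proof -
  interpret S: spatial_iso K G L H \<Psi> \<Phi> \<psi> \<phi> by (rule swap_iso)
  obtain U where U: "U \<in> H" "g \<in> U" "U \<in> carrier (bis_group G)" using arrow_cover g by blast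
  note l = lift[OF U(1,2)]
  have "S.lift (lift g) = arrow_at G (\<Psi> (\<Phi> U)) (\<psi> (src K (lift g)))"
    using S.lift_eq[OF \<Phi>_closed[OF U(1)] l(1)] .
  also have "\<dots> = arrow_at G U (src G g)"
    using U l g \<psi>_\<phi> \<Psi>_\<Phi> by simp
  also have "\<dots> = g" using G.arrow_at_eq[OF U(3,2)] by simp
  finally show ?thesis .
qed

lemma (in spatial_iso) etale_isomorphic: "etale_isomorphic G K"
proof -
  interpret S: spatial_iso K G L H \<Psi> \<Phi> \<psi> \<phi> by (rule swap_iso)
  have "homeomorphic_maps (arr_top G) (arr_top K) lift S.lift"
    unfolding homeomorphic_maps_def using lift_continuous S.lift_continuous lift_lift S.lift_lift by simp
  moreover have "groupoid_hom G K lift"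
    unfolding groupoid_hom_def using lift_mult lift_continuous
    by (auto simp: continuous_map_def)
  moreover have "groupoid_hom K G S.lift"
    unfolding groupoid_hom_def using S.lift_mult S.lift_continuous
    by (auto simp: continuous_map_def)
  ultimately show ?thesis unfolding etale_isomorphic_def by blast
qed

lemma etale_isomorphic_if_bis_subgroups_iso:
  assumes "cantor_groupoid G" "cantor_groupoid K"
    and H: "subgroup H (bis_group G)" "derived (bis_group G) (carrier (bis_group G)) \<subseteq> H"
    and L: "subgroup L (bis_group K)" "derived (bis_group K) (carrier (bis_group K)) \<subseteq> L"
    and iso: "(bis_group G)\<lparr>carrier := H\<rparr> \<cong> (bis_group K)\<lparr>carrier := L\<rparr>"
  shows "etale_isomorphic G K"
proof -
  interpret G: cantor_groupoid G by fact
  interpret K: cantor_groupoid K by fact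
  let ?\<Gamma> = "(bis_group G)\<lparr>carrier := H\<rparr>" and ?\<Lambda> = "(bis_group K)\<lparr>carrier := L\<rparr>"
  interpret A: locally_dense_action ?\<Gamma> "unit_space G" "bis_act G"
    using G.locally_dense_bis_subgroup[OF H] .
  interpret B0: locally_dense_action ?\<Lambda> "unit_space K" "bis_act K"
    using K.locally_dense_bis_subgroup[OF L] .
  obtain \<Phi> where \<Phi>: "\<Phi> \<in> iso ?\<Gamma> ?\<Lambda>" using iso unfolding is_iso_def by blast
  have closed: "\<Phi> U \<in> L" if "U \<in> H" for U using \<Phi> that by (auto simp: iso_def hom_def)
  have mult: "\<Phi> (bis_mult G U V) = bis_mult K (\<Phi> U) (\<Phi> V)" if "U \<in> H" "V \<in> H" for U V
    using \<Phi> that by (auto simp: iso_def hom_def)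
  have bij: "bij_betw \<Phi> H L" using \<Phi> by (auto simp: iso_def)
  have one: "\<Phi> (units G) = units K"
    using hom_one[OF _ A.is_group B0.is_group, of \<Phi>] \<Phi> by (auto simp: iso_def)
  have LB: "V \<in> carrier (bis_group K)" if "V \<in> L" for V using that subgroup.subset[OF L(1)] by blast
  \<comment> \<open>The action on the units of \<open>K\<close>, pulled back along \<Phi>.
    Faithfulness uses that \<Phi> is injective, local density that it is surjective onto
    \<open>L\<close>.\<close>
  interpret B: locally_dense_action ?\<Gamma> "unit_space K" "\<lambda>U. bis_act K (\<Phi> U)"
  proof
    fix U assume U: "U \<in> carrier ?\<Gamma>" and triv: "\<And>x. x \<in> topspace (unit_space K) \<Longrightarrow> bis_act K (\<Phi> U) x = x"
    have "\<Phi> U = units K" using B0.faithful[of "\<Phi> U"] U closed triv by auto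
    moreover have "units G \<in> H" using subgroup.one_closed[OF H(1)] by simp
    ultimately show "U = \<one>\<^bsub>?\<Gamma>\<^esub>" using one inj_onD[OF bij_betw_imp_inj_on[OF bij]] U by auto
  next
    fix U x W assume U: "openin (unit_space K) U" "x \<in> U" and W: "openin (unit_space K) W" "W \<subseteq> U" "W \<noteq> {}"
    obtain V where V: "V \<in> L" "\<forall>y\<in>topspace (unit_space K) - U. bis_act K V y = y" "bis_act K V x \<in> W"
      using B0.locally_dense[OF U W] by auto
    obtain T where "T \<in> H" "\<Phi> T = V" using V bij by (metis bij_betw_imp_surj_on imageE)
    then show "\<exists>k\<in>carrier ?\<Gamma>. (\<forall>y\<in>topspace (unit_space K) - U. bis_act K (\<Phi> k) y = y) \<and> bis_act K (\<Phi> k) x \<in> W"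
      using V by auto
  qed (use closed LB in \<open>auto simp: one mult K.bis_act_closed K.bis_act_units K.bis_act_mult
      K.bis_act_continuous K.Hausdorff_unit_space K.compact_unit_space K.no_isolated_unit\<close>)
  interpret AB: two_locally_dense_actions ?\<Gamma> "unit_space G" "bis_act G" "unit_space K" "\<lambda>U. bis_act K (\<Phi> U)"
    by unfold_locales
  obtain \<phi> \<psi> where homeo: "homeomorphic_maps (unit_space G) (unit_space K) \<phi> \<psi>"
    and eq: "\<And>g x. \<lbrakk>g \<in> carrier ?\<Gamma>; x \<in> topspace (unit_space G)\<rbrakk> \<Longrightarrow> \<phi> (bis_act G g x) = bis_act K (\<Phi> g) (\<phi> x)"
    using AB.equivariant_homeomorphism by blast
  interpret spatial_iso G K H L \<Phi> "inv_into H \<Phi>" \<phi> \<psi>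
  proof (intro spatial_iso.intro spatial_iso_axioms.intro)
    show "inv_into H \<Phi> V \<in> H" if "V \<in> L" for V
      using that bij by (metis bij_betw_imp_surj_on inv_into_into)
    show "inv_into H \<Phi> (\<Phi> U) = U" if "U \<in> H" for U
      using that bij by (metis bij_betw_imp_inj_on inv_into_f_f)
    show "\<Phi> (inv_into H \<Phi> V) = V" if "V \<in> L" for V
      using that bij by (metis bij_betw_imp_surj_on f_inv_into_f)
  qed (fact assms homeo | simp add: closed mult eq)+
  show ?thesis by (rule etale_isomorphic)
qed

section \<open>The topological full group as a group of bisections\<close>

context cantor_groupoid
begin

lemma pi_map_eq: "U \<in> carrier (bis_group G) \<Longrightarrow> pi_map G U = restrict (bis_act G U) (units G)"
  using bis_groupD(5) by (simp add: pi_map_def bis_act_def[abs_def] arrow_at_def[abs_def] comp_def)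

lemma homeomorphic_bis_act:
  assumes U: "U \<in> carrier (bis_group G)"
  shows "homeomorphic_map (unit_space G) (unit_space G) (bis_act G U)"
proof -
  note V = bis.inv_closed[OF U]
  have "bis_act G (inv\<^bsub>bis_group G\<^esub> U) (bis_act G U x) = x"
    "bis_act G U (bis_act G (inv\<^bsub>bis_group G\<^esub> U) x) = x" if "x \<in> units G" for x
    using bis_act_mult[OF V U that] bis_act_mult[OF U V that] bis.l_inv[OF U] bis.r_inv[OF U]
      bis_act_units[OF that] by simp_all
  then show ?thesis
    unfolding homeomorphic_map_maps homeomorphic_maps_def
    using bis_act_continuous[OF U] bis_act_continuous[OF V] by auto
qed

lemma induces_pi_map:
  assumes U: "U \<in> carrier (bis_group G)" shows "induces G U (pi_map G U)"
proof -
  note UD = bis_groupD[OF U]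
  have "compactin (arr_top G) {g \<in> U. src G g \<in> units G}"
    using compactin_bisection[OF UD(1,4) compactin_units] UD(5) by simp
  moreover have "{g \<in> U. src G g \<in> units G} = U" using UD(2) by auto
  ultimately show ?thesis using UD by (simp add: induces_def)
qed

lemma pi_map_full_group:
  assumes U: "U \<in> carrier (bis_group G)" shows "pi_map G U \<in> carrier (full_group G)"
proof -
  have h: "homeomorphic_map (unit_space G) (unit_space G) (pi_map G U)"
    using homeomorphic_bis_act[OF U] by (rule homeomorphic_map_eq) (simp add: pi_map_eq[OF U])
  then have "bij_betw (pi_map G U) (units G) (units G)"
    using homeomorphic_imp_surjective_map homeomorphic_imp_injective_map
    by (fastforce simp: bij_betw_def)
  moreover have "pi_map G U \<in> extensional (units G)" by (simp add: pi_map_eq[OF U])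
  ultimately show ?thesis
    using h induces_pi_map[OF U] by (auto simp: full_group_def Bij_def)
qed

text \<open>\<open>induces\<close> prescribes only the source of \<open>U\<close>; the range is full
  because \<alpha> maps onto the units.\<close>

lemma bis_groupI_induces:
  assumes \<alpha>: "\<alpha> \<in> carrier (full_group G)" and U: "induces G U \<alpha>"
  shows "U \<in> carrier (bis_group G)"
proof (rule bis_groupI)
  show op: "openin (arr_top G) U" and inj: "inj_on (rng G) U" "inj_on (src G) U"
    and src: "src G ` U = units G"
    using U by (auto simp: induces_def G_set_def)
  have "\<alpha> ` units G = units G" using \<alpha> by (auto simp: full_group_def Bij_def bij_betw_def)
  moreover have "\<alpha> ` units G = rng G ` U"
  proof -
    have "\<alpha> ` units G = \<alpha> ` src G ` U" using src by simp
    also have "\<dots> = rng G ` U"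
      unfolding image_image using U inj(2) src
      by (intro image_cong) (auto simp: induces_def pi_map_def inv_into_f_f)
    finally show ?thesis .
  qed
  ultimately show "rng G ` U = units G" by simp
qed

text \<open>Uniqueness of the inducing bisection is faithfulness of the action of the whole
  bisection group, a consequence of essential principality.\<close>

lemma pi_map_inject:
  assumes U: "U \<in> carrier (bis_group G)" and V: "V \<in> carrier (bis_group G)" and e: "pi_map G U = pi_map G V"
  shows "U = V"
proof -
  interpret A: locally_dense_action "(bis_group G)\<lparr>carrier := carrier (bis_group G)\<rparr>" "unit_space G" "bis_act G"
    using locally_dense_bis_subgroup[OF bis.subgroup_self bis.derived_in_carrier] by blast
  show ?thesis
  proof (rule A.act_ext)
    fix x assume "x \<in> topspace (unit_space G)"
    then show "bis_act G U x = bis_act G V x"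
      using fun_cong[OF e, of x] U V by (simp add: pi_map_eq)
  qed (use U V in auto)
qed

lemma pi_map_iso: "pi_map G \<in> iso (bis_group G) (full_group G)"
proof (rule isoI)
  show "pi_map G \<in> hom (bis_group G) (full_group G)"
  proof (rule homI)
    fix U V assume U: "U \<in> carrier (bis_group G)" and V: "V \<in> carrier (bis_group G)"
    have B: "pi_map G U \<in> Bij (units G)" "pi_map G V \<in> Bij (units G)"
      using pi_map_full_group U V by (auto simp: full_group_def)
    have "pi_map G (bis_mult G U V) = compose (units G) (pi_map G U) (pi_map G V)"
      using U V bis_mult_closed[OF U V]
      by (auto simp: fun_eq_iff pi_map_eq compose_def restrict_def bis_act_mult bis_act_closed)
    then show "pi_map G (U \<otimes>\<^bsub>bis_group G\<^esub> V) = pi_map G U \<otimes>\<^bsub>full_group G\<^esub> pi_map G V"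
      using B by (simp add: full_group_def BijGroup_def)
  qed (rule pi_map_full_group)
  show "bij_betw (pi_map G) (carrier (bis_group G)) (carrier (full_group G))"
    unfolding bij_betw_def
  proof (intro conjI equalityI subsetI)
    show "inj_on (pi_map G) (carrier (bis_group G))" using pi_map_inject by (auto simp: inj_on_def)
    fix \<alpha> assume \<alpha>: "\<alpha> \<in> carrier (full_group G)"
    then obtain U where U: "induces G U \<alpha>" by (auto simp: full_group_def)
    then have "\<alpha> = pi_map G U" by (simp add: induces_def)
    then show "\<alpha> \<in> pi_map G ` carrier (bis_group G)" using bis_groupI_induces[OF \<alpha> U] by blast
  qed (use pi_map_full_group in auto)
qed

lemma group_full_group: "group (full_group G)"
proof -
  have "pi_map G \<one>\<^bsub>bis_group G\<^esub> = \<one>\<^bsub>full_group G\<^esub>"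
    using bis_act_units by (auto simp: pi_map_eq[OF units_bis] full_group_def BijGroup_def restrict_def fun_eq_iff)
  then show ?thesis using bis.iso_imp_img_group[OF pi_map_iso] by simp
qed

lemma subgroup_iso_pi_map:
  assumes "subgroup H (bis_group G)"
  shows "(bis_group G)\<lparr>carrier := H\<rparr> \<cong> (full_group G)\<lparr>carrier := pi_map G ` H\<rparr>"
  using iso_restrict[OF pi_map_iso group_bis group_full_group assms] by (rule is_isoI)

lemma commutator_full_group:
  "(bis_group G)\<lparr>carrier := derived (bis_group G) (carrier (bis_group G))\<rparr>
    \<cong> commutator_subgroup (full_group G)"
proof -
  interpret h: group_hom "bis_group G" "full_group G" "pi_map G"
    using group_bis group_full_group pi_map_iso by (simp add: group_hom_def group_hom_axioms_def iso_def)
  have "derived (full_group G) (carrier (full_group G))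
      = pi_map G ` derived (bis_group G) (carrier (bis_group G))"
    using h.derived_img[OF subset_refl] pi_map_iso by (simp add: iso_def bij_betw_def)
  then show ?thesis
    using subgroup_iso_pi_map[OF bis.derived_is_subgroup[OF subset_refl]]
    by (simp add: commutator_subgroup_def)
qed

text \<open>Uniqueness of the inducing bisection resolves the definite description.\<close>

lemma index_map_pi_map:
  assumes U: "U \<in> carrier (bis_group G)"
  shows "index_map G (pi_map G U) = boundaries1 G #>\<^bsub>cycles1 G\<^esub> indicator U"
proof -
  have "(THE V. induces G V (pi_map G U)) = U"
  proof (rule the_equality)
    show "induces G U (pi_map G U)" by (rule induces_pi_map[OF U])
    fix V assume V: "induces G V (pi_map G U)"
    have "V \<in> carrier (bis_group G)" using bis_groupI_induces[OF pi_map_full_group[OF U] V] .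
    then show "V = U" using V U by (intro pi_map_inject) (auto simp: induces_def)
  qed
  then show ?thesis by (simp add: index_map_def)
qed

text \<open>The subgroup corresponding to \<open>[[G]]\<^sub>0\<close>: the class of \<open>1\<^sub>U\<close> is trivial iff translation by \<open>1\<^sub>U\<close>
  preserves the set of boundaries.\<close>

definition bis_kernel :: "'a set set" where
  "bis_kernel = {U \<in> carrier (bis_group G). (\<lambda>f y. f y + indicator U y) ` boundaries1 G = boundaries1 G}"

text \<open>The neutral element of \<open>H1 G\<close> is \<open>boundaries1 G\<close> itself, so
  lying in the kernel means that a coset equals this set.\<close>

lemma carrier_full_group0: "carrier (full_group0 G) = pi_map G ` bis_kernel"
proof -
  have co: "boundaries1 G #>\<^bsub>cycles1 G\<^esub> a = (\<lambda>f y. f y + a y) ` boundaries1 G" for a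
    by (auto simp: r_coset_def cycles1_def Cc_group_def)
  have "carrier (full_group G) = pi_map G ` carrier (bis_group G)"
    using pi_map_iso by (simp add: iso_def bij_betw_def)
  then show ?thesis
    using index_map_pi_map
    by (auto simp: full_group0_def kernel_def H1_def FactGroup_def bis_kernel_def co)
qed

end

section \<open>The index map\<close>

lemma pushforward_indicator:
  assumes "S \<subseteq> topspace Y" "inj_on p S"
  shows "pushforward Y p (indicator S) = indicator (p ` S)"
proof
  fix z
  have eq: "{y \<in> topspace Y. p y = z \<and> indicator S y \<noteq> (0::int)} = {y \<in> S. p y = z}"
    using assms(1) by (auto simp: indicator_def)
  show "pushforward Y p (indicator S) z = indicator (p ` S) z"
  proof (cases "z \<in> p ` S")
    case True
    then obtain s where s: "s \<in> S" "z = p s" by blast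
    then have "{y \<in> S. p y = z} = {s}" using inj_onD[OF assms(2)] by auto
    then show ?thesis using s True unfolding pushforward_def eq by simp
  next
    case False
    then have empty: "{y \<in> S. p y = z} = {}" by blast
    show ?thesis using False unfolding pushforward_def eq empty by simp
  qed
qed

text \<open>The part of being a local homeomorphism that makes fibres discrete.\<close>

definition locally_injective :: "'a topology \<Rightarrow> ('a \<Rightarrow> 'b) \<Rightarrow> bool" where
  "locally_injective Y p \<longleftrightarrow> (\<forall>y\<in>topspace Y. \<exists>N. openin Y N \<and> y \<in> N \<and> inj_on p N)"

text \<open>Each member of a finite subcover by sets of injectivity meets the fibre at most
  once.\<close>

lemma finite_fibre:
  assumes p: "locally_injective Y p" and K: "compactin Y K"
  shows "finite {y \<in> K. p y = z}"
proof -
  obtain N where N: "\<And>y. y \<in> topspace Y \<Longrightarrow> openin Y (N y) \<and> y \<in> N y \<and> inj_on p (N y)"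
    using p unfolding locally_injective_def by metis
  have KY: "K \<subseteq> topspace Y" using K compactin_subset_topspace by blast
  have "(\<forall>U\<in>N ` K. openin Y U) \<and> K \<subseteq> \<Union>(N ` K)" using N KY by blast
  then obtain F where F: "finite F" "F \<subseteq> N ` K" "K \<subseteq> \<Union>F"
    using K unfolding compactin_def by meson
  have "{y \<in> K. p y = z} \<subseteq> (\<Union>U\<in>F. {y \<in> U. p y = z})" using F by blast
  moreover have "finite {y \<in> U. p y = z}" if "U \<in> F" for U
  proof -
    have "inj_on p U" using that F N KY by blast
    then have "inj_on p {y \<in> U. p y = z}" by (rule inj_on_subset) blast
    moreover have "p ` {y \<in> U. p y = z} \<subseteq> {z}" by blast
    ultimately show ?thesis by (meson finite.emptyI finite_insert finite_subset inj_on_finite)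
  qed
  ultimately show ?thesis using F(1) by (meson finite_UN_I finite_subset)
qed

lemma Cc_finite_fibre:
  assumes p: "locally_injective Y p" and f: "f \<in> carrier (Cc_group Y)"
  shows "finite {y \<in> topspace Y. p y = z \<and> f y \<noteq> 0}"
proof -
  let ?K = "Y closure_of {y \<in> topspace Y. f y \<noteq> 0}"
  have "compactin Y ?K" using f by (simp add: Cc_group_def)
  then have "finite {y \<in> ?K. p y = z}" by (rule finite_fibre[OF p])
  moreover have "{y \<in> topspace Y. f y \<noteq> 0} \<subseteq> ?K" by (simp add: closure_of_subset)
  then have "{y \<in> topspace Y. p y = z \<and> f y \<noteq> 0} \<subseteq> {y \<in> ?K. p y = z}" by blast
  ultimately show ?thesis by (rule rev_finite_subset)
qed

text \<open>The three sums run over different supports, so each is extended by zeros to the union of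
  the supports of \<open>f\<close> and \<open>g\<close>. The coefficient \<open>c\<close> serves for
  sums and differences alike.\<close>

lemma pushforward_lincomb:
  assumes p: "locally_injective Y p" and f: "f \<in> carrier (Cc_group Y)" and g: "g \<in> carrier (Cc_group Y)"
  shows "pushforward Y p (\<lambda>y. f y + c * g y) z = pushforward Y p f z + c * pushforward Y p g z"
proof -
  let ?S = "\<lambda>h. {y \<in> topspace Y. p y = z \<and> h y \<noteq> (0::int)}"
  let ?T = "?S f \<union> ?S g"
  have fin: "finite ?T" using Cc_finite_fibre[OF p] f g by auto
  have eq: "pushforward Y p h z = sum h ?T" if "?S h \<subseteq> ?T" for h
    unfolding pushforward_def
    by (rule sum.mono_neutral_left[OF fin that]) (use that in auto)
  have "pushforward Y p (\<lambda>y. f y + c * g y) z = (\<Sum>y\<in>?T. f y + c * g y)" by (rule eq) auto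
  also have "\<dots> = pushforward Y p f z + c * pushforward Y p g z"
    by (simp add: eq[of f] eq[of g] sum.distrib sum_distrib_left)
  finally show ?thesis .
qed

lemma Cc_lincomb:
  assumes f: "f \<in> carrier (Cc_group Y)" and g: "g \<in> carrier (Cc_group Y)"
  shows "(\<lambda>y. f y + c * g y) \<in> carrier (Cc_group Y)"
proof -
  let ?h = "\<lambda>y. f y + c * g y" and ?s = "\<lambda>h. {y \<in> topspace Y. h y \<noteq> (0::int)}"
  \<comment> \<open>A product of two discrete spaces is discrete, so continuity of the pair
    suffices: any map out of a discrete space may follow.\<close>
  have "continuous_map Y (prod_topology (discrete_topology UNIV) (discrete_topology UNIV)) (\<lambda>y. (f y, g y))"
    using f g by (intro continuous_map_pairedI) (auto simp: Cc_group_def)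
  then have pair: "continuous_map Y (discrete_topology UNIV) (\<lambda>y. (f y, g y))"
    by (simp add: prod_topology_discrete_topology[symmetric])
  have "continuous_map (discrete_topology (UNIV :: (int \<times> int) set)) (discrete_topology UNIV)
      (\<lambda>(a, b). a + c * b)" by simp
  from continuous_map_compose[OF pair this]
  have cont: "continuous_map Y (discrete_topology UNIV) ?h" by (simp add: comp_def)
  have "Y closure_of ?s ?h \<subseteq> Y closure_of (?s f \<union> ?s g)" by (rule closure_of_mono) auto
  then have "Y closure_of ?s ?h \<subseteq> Y closure_of ?s f \<union> Y closure_of ?s g"
    by (simp only: closure_of_Un)
  moreover have "compactin Y (Y closure_of ?s f)" "compactin Y (Y closure_of ?s g)"
    using f g by (simp_all add: Cc_group_def)
  ultimately have "compactin Y (Y closure_of ?s ?h)"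
    by (meson closed_compactin closedin_closure_of compactin_Un)
  moreover have "?h y = 0" if "y \<notin> topspace Y" for y
    using f g that by (simp add: Cc_group_def)
  ultimately show ?thesis using cont unfolding Cc_group_def by simp
qed

lemma indicator_Cc:
  assumes "Hausdorff_space Y" "openin Y S" "compactin Y S"
  shows "indicator S \<in> carrier (Cc_group Y)"
proof -
  have cl: "closedin Y S" using assms compactin_imp_closedin by blast
  have SY: "S \<subseteq> topspace Y" using assms openin_subset by blast
  have "continuous_map Y (discrete_topology UNIV) (indicator S :: _ \<Rightarrow> int)"
    unfolding continuous_map_def
  proof (intro conjI allI impI)
    fix V :: "int set"
    have "{y \<in> topspace Y. indicator S y \<in> V} =
       (if 1 \<in> V then S else {}) \<union> (if 0 \<in> V then topspace Y - S else {})"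
      using SY by (auto simp: indicator_def split: if_splits)
    then show "openin Y {y \<in> topspace Y. indicator S y \<in> V}" using assms cl by auto
  qed auto
  moreover have "{y \<in> topspace Y. indicator S y \<noteq> (0::int)} = S" using SY by (auto simp: indicator_def)
  moreover have "Y closure_of S = S" using cl by (simp add: closure_of_eq)
  ultimately show ?thesis using assms SY by (auto simp: Cc_group_def indicator_def)
qed

section \<open>Additivity of the index on full bisections\<close>

context cantor_groupoid
begin

text \<open>In a small neighbourhood of a composable pair, \<open>fst\<close> loses nothing because
  it fixes the range of the second arrow, and \<open>snd\<close> because it fixes the source of the
  first. A product determines its first factor by its range, and then the second by
  cancellation.\<close>

lemma locally_injective_faces:
  "locally_injective (composable_space G) fst"
  "locally_injective (composable_space G) snd"
  "locally_injective (composable_space G) (\<lambda>(g, h). gmult G g h)"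
proof -
  have op: "openin (composable_space G) (composable G \<inter> U \<times> V)"
    if "openin (arr_top G) U" "openin (arr_top G) V" for U V
    using that unfolding composable_space_def
    by (intro openin_subtopology_Int2) (simp add: openin_prod_Times_iff)
  have A: "openin (arr_top G) (arrows G)" using openin_topspace[of "arr_top G"] by simp
  have bis: "\<exists>U. openin (arr_top G) U \<and> g \<in> U \<and> inj_on (src G) U \<and> inj_on (rng G) U" if "g \<in> arrows G" for g
  proof -
    have un: "openin (unit_space G) (units G)" by (simp add: openin_unit_space_iff openin_units)
    show ?thesis using local_bisection[OF that un _ un] that by (metis rng_units src_units)
  qed
  show "locally_injective (composable_space G) fst"
    unfolding locally_injective_def
  proof
    fix y assume "y \<in> topspace (composable_space G)"
    then obtain g h where y: "y = (g, h)" "g \<in> arrows G" "h \<in> arrows G" "src G g = rng G h"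
      by (cases y) (auto simp: composable_iff)
    obtain V where V: "openin (arr_top G) V" "h \<in> V" "inj_on (rng G) V" using bis y by blast
    have "inj_on fst (composable G \<inter> arrows G \<times> V)"
      by (rule inj_onI) (auto simp: composable_iff intro: inj_onD[OF V(3)])
    then show "\<exists>N. openin (composable_space G) N \<and> y \<in> N \<and> inj_on fst N"
      using op[OF A V(1)] y V(2) by (intro exI[of _ "composable G \<inter> arrows G \<times> V"]) (auto simp: composable_iff)
  qed
  show "locally_injective (composable_space G) snd"
    unfolding locally_injective_def
  proof
    fix y assume "y \<in> topspace (composable_space G)"
    then obtain g h where y: "y = (g, h)" "g \<in> arrows G" "h \<in> arrows G" "src G g = rng G h"
      by (cases y) (auto simp: composable_iff)
    obtain U where U: "openin (arr_top G) U" "g \<in> U" "inj_on (src G) U" using bis y by blast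
    have "inj_on snd (composable G \<inter> U \<times> arrows G)"
      by (rule inj_onI) (auto simp: composable_iff intro: inj_onD[OF U(3)])
    then show "\<exists>N. openin (composable_space G) N \<and> y \<in> N \<and> inj_on snd N"
      using op[OF U(1) A] y U(2) by (intro exI[of _ "composable G \<inter> U \<times> arrows G"]) (auto simp: composable_iff)
  qed
  show "locally_injective (composable_space G) (\<lambda>(g, h). gmult G g h)"
    unfolding locally_injective_def
  proof
    fix y assume "y \<in> topspace (composable_space G)"
    then obtain g h where y: "y = (g, h)" "g \<in> arrows G" "h \<in> arrows G" "src G g = rng G h"
      by (cases y) (auto simp: composable_iff)
    obtain U where U: "openin (arr_top G) U" "g \<in> U" "inj_on (rng G) U" using bis y by blast
    have "inj_on (\<lambda>(g, h). gmult G g h) (composable G \<inter> U \<times> arrows G)"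
    proof (rule inj_onI)
      fix s t assume st: "s \<in> composable G \<inter> U \<times> arrows G" "t \<in> composable G \<inter> U \<times> arrows G"
        "(\<lambda>(g, h). gmult G g h) s = (\<lambda>(g, h). gmult G g h) t"
      obtain a b c d where s: "s = (a, b)" and t: "t = (c, d)" by (cases s, cases t)
      have ab: "a \<in> arrows G" "b \<in> arrows G" "src G a = rng G b" "a \<in> U"
        "c \<in> arrows G" "d \<in> arrows G" "src G c = rng G d" "c \<in> U"
        and e: "gmult G a b = gmult G c d" using st by (auto simp: s t composable_iff)
      have "rng G a = rng G c" using rng_gmult[OF ab(1,2,3)] rng_gmult[OF ab(5,6,7)] e by simp
      then have ac: "a = c" using inj_onD[OF U(3)] ab by blast
      have "b = gmult G (ginv G a) (gmult G a b)" using ab by simp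
      also have "\<dots> = gmult G (ginv G c) (gmult G c d)" by (simp only: e[unfolded ac] ac)
      also have "\<dots> = d" using ab by simp
      finally show "s = t" by (simp add: s t ac)
    qed
    then show "\<exists>N. openin (composable_space G) N \<and> y \<in> N \<and> inj_on (\<lambda>(g, h). gmult G g h) N"
      using op[OF U(1) A] y U(2) by (intro exI[of _ "composable G \<inter> U \<times> arrows G"]) (auto simp: composable_iff)
  qed
qed

lemma delta2_lincomb:
  assumes "f \<in> carrier (Cc_group (composable_space G))" "g \<in> carrier (Cc_group (composable_space G))"
  shows "delta2 G (\<lambda>y. f y + c * g y) = (\<lambda>x. delta2 G f x + c * delta2 G g x)"
  unfolding delta2_def pushforward_lincomb[OF locally_injective_faces(1) assms]
    pushforward_lincomb[OF locally_injective_faces(2) assms]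
    pushforward_lincomb[OF locally_injective_faces(3) assms]
  by (simp add: fun_eq_iff algebra_simps)

definition stabilizes_boundaries :: "('a \<Rightarrow> int) \<Rightarrow> bool" where
  "stabilizes_boundaries a \<longleftrightarrow> (\<lambda>f y. f y + a y) ` boundaries1 G = boundaries1 G"

text \<open>Translation is a bijection of functions, so invariance of the set is a two-sided
  membership condition; in this form it visibly passes to sums and negatives.\<close>

lemma stabilizes_boundaries_iff:
  "stabilizes_boundaries a \<longleftrightarrow> (\<forall>f. (\<lambda>y. f y + a y) \<in> boundaries1 G \<longleftrightarrow> f \<in> boundaries1 G)"
proof
  assume e: "stabilizes_boundaries a"
  show "\<forall>f. (\<lambda>y. f y + a y) \<in> boundaries1 G \<longleftrightarrow> f \<in> boundaries1 G"
  proof (intro allI iffI)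
    fix f assume "(\<lambda>y. f y + a y) \<in> boundaries1 G"
    then obtain f' where f': "f' \<in> boundaries1 G" "(\<lambda>y. f y + a y) = (\<lambda>y. f' y + a y)"
      using e unfolding stabilizes_boundaries_def by blast
    then have "f = f'" by (simp add: fun_eq_iff)
    then show "f \<in> boundaries1 G" using f' by simp
  qed (use e in \<open>auto simp: stabilizes_boundaries_def\<close>)
next
  assume e: "\<forall>f. (\<lambda>y. f y + a y) \<in> boundaries1 G \<longleftrightarrow> f \<in> boundaries1 G"
  show "stabilizes_boundaries a"
    unfolding stabilizes_boundaries_def
  proof (intro equalityI subsetI)
    fix f assume f: "f \<in> boundaries1 G"
    have "(\<lambda>y. f y - a y) \<in> boundaries1 G" using e[rule_format, of "\<lambda>y. f y - a y"] f by simp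
    then show "f \<in> (\<lambda>f y. f y + a y) ` boundaries1 G"
      by (intro image_eqI[of _ _ "\<lambda>y. f y - a y"]) simp_all
  qed (use e in auto)
qed

lemma stabilizes_boundaries_add:
  assumes "stabilizes_boundaries a" "stabilizes_boundaries b" shows "stabilizes_boundaries (\<lambda>y. a y + b y)"
  unfolding stabilizes_boundaries_iff
proof
  fix f
  show "(\<lambda>y. f y + (a y + b y)) \<in> boundaries1 G \<longleftrightarrow> f \<in> boundaries1 G"
    using assms(2)[unfolded stabilizes_boundaries_iff, rule_format, of "\<lambda>y. f y + a y"]
      assms(1)[unfolded stabilizes_boundaries_iff, rule_format, of f] by (simp add: add.assoc)
qed

lemma stabilizes_boundaries_minus:
  assumes "stabilizes_boundaries a" shows "stabilizes_boundaries (\<lambda>y. - a y)"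
  unfolding stabilizes_boundaries_iff
proof
  fix f
  show "(\<lambda>y. f y + - a y) \<in> boundaries1 G \<longleftrightarrow> f \<in> boundaries1 G"
    using assms[unfolded stabilizes_boundaries_iff, rule_format, of "\<lambda>y. f y + - a y"] by simp
qed

text \<open>Linearity of \<open>delta2\<close>; the coefficients \<open>1\<close> and
  \<open>-1\<close> give the two directions.\<close>

lemma stabilizes_boundaries_delta2:
  assumes g: "g \<in> carrier (Cc_group (composable_space G))"
  shows "stabilizes_boundaries (delta2 G g)"
  unfolding stabilizes_boundaries_iff
proof (intro allI iffI)
  have *: "(\<lambda>y. f y + c * delta2 G g y) \<in> boundaries1 G" if f: "f \<in> boundaries1 G" for f c
  proof -
    obtain k where k: "k \<in> carrier (Cc_group (composable_space G))" "f = delta2 G k"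
      using f unfolding boundaries1_def by blast
    have "(\<lambda>y. f y + c * delta2 G g y) = delta2 G (\<lambda>y. k y + c * g y)"
      unfolding k(2) by (rule delta2_lincomb[OF k(1) g, symmetric])
    then show ?thesis
      unfolding boundaries1_def using imageI[OF Cc_lincomb[OF k(1) g]] by (simp only:)
  qed
  fix f
  show "(\<lambda>y. f y + delta2 G g y) \<in> boundaries1 G" if "f \<in> boundaries1 G" using *[OF that, of 1] by simp
  show "f \<in> boundaries1 G" if "(\<lambda>y. f y + delta2 G g y) \<in> boundaries1 G" using *[OF that, of "-1"] by simp
qed

text \<open>The function is the boundary of the indicator of the composable pairs in
  \<open>U \<times> V\<close>. Each face is injective on these pairs, and since the bisections are
  full the images are exactly \<open>V\<close>, \<open>bis_mult G U V\<close> and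
  \<open>U\<close>.\<close>

lemma delta2_bis:
  assumes U: "U \<in> carrier (bis_group G)" and V: "V \<in> carrier (bis_group G)"
  shows "stabilizes_boundaries (\<lambda>y. indicator V y - indicator (bis_mult G U V) y + indicator U y)"
proof -
  note UD = bis_groupD[OF U] and VD = bis_groupD[OF V]
  define S where "S = composable G \<inter> U \<times> V"
  have Hp: "Hausdorff_space (prod_topology (arr_top G) (arr_top G))"
    using Hausdorff by (simp add: Hausdorff_space_prod_topology)
  have cU: "compactin (arr_top G) U" "compactin (arr_top G) V"
    using induces_pi_map U V by (auto simp: induces_def)
  \<comment> \<open>Composability is the equaliser of two continuous maps into a Hausdorff space, so
    the composable pairs in the compact set \<open>U \<times> V\<close> form a compact set.\<close>
  have "closedin (prod_topology (arr_top G) (arr_top G)) (composable G)"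
  proof -
    have "closedin (prod_topology (arr_top G) (arr_top G))
        {p \<in> topspace (prod_topology (arr_top G) (arr_top G)). (src G \<circ> fst) p = (rng G \<circ> snd) p}"
      using Hausdorff continuous_src continuous_rng
      by (intro closedin_continuous_maps_eq[of "arr_top G"] continuous_map_compose[OF continuous_map_fst]
          continuous_map_compose[OF continuous_map_snd])
    moreover have "{p \<in> topspace (prod_topology (arr_top G) (arr_top G)). (src G \<circ> fst) p = (rng G \<circ> snd) p}
        = composable G" by (auto simp: composable_def)
    ultimately show ?thesis by simp
  qed
  then have "compactin (prod_topology (arr_top G) (arr_top G)) S"
    unfolding S_def using cU by (intro closed_Int_compactin) (auto simp: compactin_Times)
  then have "compactin (composable_space G) S"
    unfolding composable_space_def by (simp add: compactin_subtopology S_def)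
  moreover have "openin (composable_space G) S"
    unfolding composable_space_def S_def using UD(1) VD(1)
    by (intro openin_subtopology_Int2) (simp add: openin_prod_Times_iff)
  moreover have "Hausdorff_space (composable_space G)"
    unfolding composable_space_def using Hp by (rule Hausdorff_space_subtopology)
  ultimately have Cc: "indicator S \<in> carrier (Cc_group (composable_space G))" by (intro indicator_Cc)
  have Ssub: "S \<subseteq> topspace (composable_space G)" by (auto simp: S_def)
  have inj: "inj_on fst S" "inj_on snd S" "inj_on (\<lambda>(g, h). gmult G g h) S"
  proof -
    show "inj_on fst S" by (rule inj_onI) (auto simp: S_def composable_iff intro: inj_onD[OF VD(3)])
    show "inj_on snd S" by (rule inj_onI) (auto simp: S_def composable_iff intro: inj_onD[OF UD(4)])
    show "inj_on (\<lambda>(g, h). gmult G g h) S"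
    proof (rule inj_onI, clarify)
      fix a b c d assume s: "(a, b) \<in> S" "(c, d) \<in> S" and e: "gmult G a b = gmult G c d"
      have ab: "a \<in> arrows G" "b \<in> arrows G" "src G a = rng G b" "a \<in> U" "b \<in> V"
        "c \<in> arrows G" "d \<in> arrows G" "src G c = rng G d" "c \<in> U" "d \<in> V"
        using s by (auto simp: S_def composable_iff)
      have "rng G a = rng G c" "src G b = src G d"
        using rng_gmult[OF ab(1,2,3)] rng_gmult[OF ab(6,7,8)] src_gmult[OF ab(1,2,3)] src_gmult[OF ab(6,7,8)] e
        by simp_all
      then show "a = c \<and> b = d" using inj_onD[OF UD(3)] inj_onD[OF VD(4)] ab by blast
    qed
  qed
  have img: "fst ` S = U" "snd ` S = V" "(\<lambda>(g, h). gmult G g h) ` S = bis_mult G U V"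
  proof -
    show "fst ` S = U"
    proof (intro equalityI subsetI)
      fix g assume g: "g \<in> U"
      then have "src G g \<in> rng G ` V" using UD VD by auto
      then obtain h where "h \<in> V" "src G g = rng G h" by blast
      then have "(g, h) \<in> S" using g UD VD by (auto simp: S_def composable_iff)
      then show "g \<in> fst ` S" by force
    qed (auto simp: S_def)
    show "snd ` S = V"
    proof (intro equalityI subsetI)
      fix h assume h: "h \<in> V"
      then have "rng G h \<in> src G ` U" using UD VD by auto
      then obtain g where "g \<in> U" "rng G h = src G g" by blast
      then have "(g, h) \<in> S" using h UD VD by (auto simp: S_def composable_iff)
      then show "h \<in> snd ` S" by force
    qed (auto simp: S_def)
    show "(\<lambda>(g, h). gmult G g h) ` S = bis_mult G U V"
      using UD(2) VD(2) by (force simp: S_def bis_mult_def composable_iff)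
  qed
  have "delta2 G (indicator S) = (\<lambda>y. indicator V y - indicator (bis_mult G U V) y + indicator U y)"
    unfolding delta2_def pushforward_indicator[OF Ssub inj(1)] pushforward_indicator[OF Ssub inj(2)]
      pushforward_indicator[OF Ssub inj(3)] img by (rule refl)
  then show ?thesis using stabilizes_boundaries_delta2[OF Cc] by simp
qed

lemma stabilizes_boundaries_cong:
  assumes "stabilizes_boundaries a" "stabilizes_boundaries (\<lambda>y. b y - a y)" shows "stabilizes_boundaries b"
  using stabilizes_boundaries_add[OF assms] by simp

text \<open>With both factors equal to the unit space the three faces have the same image, and the
  alternating sum leaves one copy.\<close>

lemma stabilizes_boundaries_units: "stabilizes_boundaries (indicator (units G))"
  using delta2_bis[OF units_bis units_bis] units_bis_mult[OF units_subset] by simp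

lemma stabilizes_boundaries_mult:
  assumes U: "U \<in> carrier (bis_group G)" and V: "V \<in> carrier (bis_group G)"
  shows "stabilizes_boundaries (\<lambda>y. indicator (bis_mult G U V) y - (indicator U y + indicator V y))"
  using stabilizes_boundaries_minus[OF delta2_bis[OF U V]] by (simp add: algebra_simps)

lemma stabilizes_boundaries_inv:
  assumes U: "U \<in> carrier (bis_group G)"
  shows "stabilizes_boundaries (\<lambda>y. indicator (inv\<^bsub>bis_group G\<^esub> U) y + indicator U y)"
  using stabilizes_boundaries_add[OF delta2_bis[OF bis.inv_closed[OF U] U] stabilizes_boundaries_units] bis.l_inv[OF U]
  by (simp add: algebra_simps)

lemma bis_kernel_iff: "U \<in> bis_kernel \<longleftrightarrow> U \<in> carrier (bis_group G) \<and> stabilizes_boundaries (indicator U)"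
  by (simp add: bis_kernel_def stabilizes_boundaries_def)

lemma subgroup_bis_kernel: "subgroup bis_kernel (bis_group G)"
proof
  show "bis_kernel \<subseteq> carrier (bis_group G)" by (auto simp: bis_kernel_def)
  show "\<one>\<^bsub>bis_group G\<^esub> \<in> bis_kernel" by (simp add: bis_kernel_iff units_bis stabilizes_boundaries_units)
  fix U assume U: "U \<in> bis_kernel"
  show "inv\<^bsub>bis_group G\<^esub> U \<in> bis_kernel"
    using U stabilizes_boundaries_add[OF stabilizes_boundaries_inv[of U] stabilizes_boundaries_minus[of "indicator U"]]
    by (simp add: bis_kernel_iff)
  fix V assume V: "V \<in> bis_kernel"
  show "U \<otimes>\<^bsub>bis_group G\<^esub> V \<in> bis_kernel"
    using U V stabilizes_boundaries_cong[OF stabilizes_boundaries_add stabilizes_boundaries_mult]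
    by (simp add: bis_kernel_iff bis_mult_closed)
qed

text \<open>Telescoping: three product relations build up the commutator word, two inverse relations
  cancel its letters, and their sum is the indicator of the commutator.\<close>

lemma derived_subset_bis_kernel: "derived (bis_group G) (carrier (bis_group G)) \<subseteq> bis_kernel"
  unfolding derived_def
proof (rule bis.generate_subgroup_incl[OF _ subgroup_bis_kernel], clarify)
  fix U V assume U: "U \<in> carrier (bis_group G)" and V: "V \<in> carrier (bis_group G)"
  let ?U = "inv\<^bsub>bis_group G\<^esub> U" and ?V = "inv\<^bsub>bis_group G\<^esub> V"
  let ?W = "bis_mult G (bis_mult G U V) ?U"
  note U' = bis.inv_closed[OF U] and V' = bis.inv_closed[OF V]
  note UV = bis_mult_closed[OF U V] and W = bis_mult_closed[OF bis_mult_closed[OF U V] U']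
  have "stabilizes_boundaries (\<lambda>y. (indicator (bis_mult G U V) y - (indicator U y + indicator V y))
      + (indicator ?W y - (indicator (bis_mult G U V) y + indicator ?U y))
      + (indicator (bis_mult G ?W ?V) y - (indicator ?W y + indicator ?V y))
      + (indicator ?U y + indicator U y) + (indicator ?V y + indicator V y))"
    by (intro stabilizes_boundaries_add[OF stabilizes_boundaries_add[OF stabilizes_boundaries_add[OF stabilizes_boundaries_add]]]
        stabilizes_boundaries_mult stabilizes_boundaries_inv U V U' V' UV W)
  then have "stabilizes_boundaries (indicator (bis_mult G ?W ?V))" by (simp add: algebra_simps)
  then show "U \<otimes>\<^bsub>bis_group G\<^esub> V \<otimes>\<^bsub>bis_group G\<^esub> ?U \<otimes>\<^bsub>bis_group G\<^esub> ?V \<in> bis_kernel"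
    using bis_mult_closed[OF W V'] by (simp add: bis_kernel_iff)
qed

lemma full_group0_iso: "(bis_group G)\<lparr>carrier := bis_kernel\<rparr> \<cong> full_group0 G"
proof -
  have "full_group0 G = (full_group G)\<lparr>carrier := pi_map G ` bis_kernel\<rparr>"
    using carrier_full_group0 by (simp add: full_group0_def)
  then show ?thesis using subgroup_iso_pi_map[OF subgroup_bis_kernel] by simp
qed

end

section \<open>Isomorphic groupoids\<close>

text \<open>\<open>F\<close> matches the fibres. The base maps are asked to be mutually inverse only
  at values of \<open>p\<close> and at \<open>z\<close>, because as total functions they are
  arbitrary off the spaces.\<close>

lemma pushforward_transport:
  assumes F: "homeomorphic_maps Y Y' F F'"
    and \<phi>: "\<And>y. y \<in> topspace Y \<Longrightarrow> p' (F y) = \<phi> (p y)"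
    and \<psi>: "\<And>y. y \<in> topspace Y \<Longrightarrow> \<psi> (\<phi> (p y)) = p y" "\<phi> (\<psi> z) = z"
  shows "pushforward Y' p' (\<lambda>y. if y \<in> topspace Y' then f (F' y) else 0) z = pushforward Y p f (\<psi> z)"
proof -
  let ?f' = "\<lambda>y. if y \<in> topspace Y' then f (F' y) else 0"
  have F1: "F y \<in> topspace Y'" "F' (F y) = y" if "y \<in> topspace Y" for y
    using F that by (auto simp: homeomorphic_maps_def continuous_map_def)
  have F2: "F' y \<in> topspace Y" "F (F' y) = y" if "y \<in> topspace Y'" for y
    using F that by (auto simp: homeomorphic_maps_def continuous_map_def)
  have fib: "p' (F y) = z \<longleftrightarrow> p y = \<psi> z" if "y \<in> topspace Y" for y
    using \<phi>[OF that] \<psi>(1)[OF that] \<psi>(2) by metis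
  show ?thesis
    unfolding pushforward_def
  proof (rule sum.reindex_bij_witness[where i = F and j = F'])
    fix y assume "y \<in> {y \<in> topspace Y'. p' y = z \<and> ?f' y \<noteq> 0}"
    then have y: "y \<in> topspace Y'" "p' y = z" "f (F' y) \<noteq> 0" by auto
    then show "F (F' y) = y" "F' y \<in> {y \<in> topspace Y. p y = \<psi> z \<and> f y \<noteq> 0}" "f (F' y) = ?f' y"
      using F2[OF y(1)] fib[of "F' y"] by auto
  next
    fix y assume "y \<in> {y \<in> topspace Y. p y = \<psi> z \<and> f y \<noteq> 0}"
    then have y: "y \<in> topspace Y" "p y = \<psi> z" "f y \<noteq> 0" by auto
    then show "F' (F y) = y" "F y \<in> {y \<in> topspace Y'. p' y = z \<and> ?f' y \<noteq> 0}"
      using F1[OF y(1)] fib[OF y(1)] by auto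
  qed
qed

lemma Cc_transport:
  assumes F: "homeomorphic_maps Y Y' F F'" and f: "f \<in> carrier (Cc_group Y)"
  shows "(\<lambda>y. if y \<in> topspace Y' then f (F' y) else 0) \<in> carrier (Cc_group Y')"
proof -
  let ?f' = "\<lambda>y. if y \<in> topspace Y' then f (F' y) else 0"
  have F': "continuous_map Y' Y F'" and hF: "homeomorphic_map Y Y' F"
    using F homeomorphic_map_maps by (auto simp: homeomorphic_maps_def)
  have "continuous_map Y' (discrete_topology UNIV) (f \<circ> F')"
    using f by (intro continuous_map_compose[OF F']) (simp add: Cc_group_def)
  then have "continuous_map Y' (discrete_topology UNIV) ?f'"
    by (rule continuous_map_eq) simp
  moreover have "{y \<in> topspace Y'. ?f' y \<noteq> 0} = F ` {y \<in> topspace Y. f y \<noteq> 0}"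
  proof (intro equalityI subsetI)
    fix y assume "y \<in> {y \<in> topspace Y'. ?f' y \<noteq> 0}"
    then have y: "y \<in> topspace Y'" "f (F' y) \<noteq> 0" by auto
    then have "F' y \<in> {y \<in> topspace Y. f y \<noteq> 0}" "y = F (F' y)"
      using F by (auto simp: homeomorphic_maps_def continuous_map_def)
    then show "y \<in> F ` {y \<in> topspace Y. f y \<noteq> 0}" by blast
  qed (use F in \<open>auto simp: homeomorphic_maps_def continuous_map_def\<close>)
  moreover have "compactin Y' (F ` (Y closure_of {y \<in> topspace Y. f y \<noteq> 0}))"
    using f by (intro image_compactin[OF _ homeomorphic_imp_continuous_map[OF hF]]) (simp add: Cc_group_def)
  moreover have "Y' closure_of (F ` {y \<in> topspace Y. f y \<noteq> 0}) = F ` (Y closure_of {y \<in> topspace Y. f y \<noteq> 0})"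
    using homeomorphic_map_closure_of[OF hF] by simp
  ultimately show ?thesis by (simp add: Cc_group_def)
qed

section \<open>Bisections under a groupoid isomorphism\<close>

locale cantor_groupoid_iso = G: cantor_groupoid G + K: cantor_groupoid K
  for G :: "'a top_groupoid" and K :: "'b top_groupoid" +
  fixes \<phi> :: "'a \<Rightarrow> 'b" and \<psi> :: "'b \<Rightarrow> 'a"
  assumes homeo: "homeomorphic_maps (arr_top G) (arr_top K) \<phi> \<psi>"
    and hom: "groupoid_hom G K \<phi>" and hom': "groupoid_hom K G \<psi>"
begin

lemma swap_iso: "cantor_groupoid_iso K G \<psi> \<phi>"
  using hom hom' homeo homeomorphic_maps_sym
  by (intro cantor_groupoid_iso.intro cantor_groupoid_iso_axioms.intro
      G.cantor_groupoid_axioms K.cantor_groupoid_axioms) auto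

lemma \<phi>_arrows: "g \<in> arrows G \<Longrightarrow> \<phi> g \<in> arrows K"
  using hom by (auto simp: groupoid_hom_def)

lemma \<psi>_\<phi>: "g \<in> arrows G \<Longrightarrow> \<psi> (\<phi> g) = g"
  using homeo by (simp add: homeomorphic_maps_def)

lemma \<phi>_mult:
  assumes "g \<in> arrows G" "h \<in> arrows G" "src G g = rng G h"
  shows "src K (\<phi> g) = rng K (\<phi> h)" "\<phi> (gmult G g h) = gmult K (\<phi> g) (\<phi> h)"
proof -
  have "(g, h) \<in> composable G" using assms by (simp add: G.composable_iff)
  then show "src K (\<phi> g) = rng K (\<phi> h)" "\<phi> (gmult G g h) = gmult K (\<phi> g) (\<phi> h)"
    using hom by (auto simp: groupoid_hom_def K.composable_iff)
qed

text \<open>\<open>groupoid_hom\<close> speaks of products only. Applying \<phi> to \<open>g\<close>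
  times its source unit and cancelling \<phi> \<open>g\<close> identifies the image of that
  unit.\<close>

lemma \<phi>_src: assumes "g \<in> arrows G" shows "\<phi> (src G g) = src K (\<phi> g)"
proof -
  have x: "src G g \<in> arrows G" "src G g = rng G (src G g)"
    using assms G.units_arrows[OF G.src_units[OF assms]] by auto
  note m = \<phi>_mult[OF assms x]
  have "gmult K (\<phi> g) (\<phi> (src G g)) = \<phi> g" using m(2) G.mult_src[OF assms] by simp
  then have "gmult K (ginv K (\<phi> g)) (\<phi> g) = \<phi> (src G g)"
    using K.inv_gmult_cancel[OF \<phi>_arrows[OF assms] \<phi>_arrows[OF x(1)] m(1)] by simp
  then show ?thesis using K.inv_mult[OF \<phi>_arrows[OF assms]] by simp
qed

lemma \<phi>_units: "x \<in> units G \<Longrightarrow> \<phi> x \<in> units K"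
  using \<phi>_src[of x] K.src_units[OF \<phi>_arrows] G.units_arrows by fastforce

text \<open>Composability of \<open>rng G g\<close> with \<open>g\<close> is preserved, and a unit
  is its own source.\<close>

lemma \<phi>_rng: assumes "g \<in> arrows G" shows "\<phi> (rng G g) = rng K (\<phi> g)"
proof -
  have x: "rng G g \<in> units G" "rng G g \<in> arrows G" "src G (rng G g) = rng G g"
    using assms G.units_arrows[OF G.rng_units[OF assms]] by auto
  have "src K (\<phi> (rng G g)) = rng K (\<phi> g)" by (rule \<phi>_mult(1)[OF x(2) assms x(3)])
  then show ?thesis using K.src_unit[OF \<phi>_units[OF x(1)]] by simp
qed

lemma \<phi>_inject: "\<lbrakk>g \<in> arrows G; h \<in> arrows G\<rbrakk> \<Longrightarrow> \<phi> g = \<phi> h \<longleftrightarrow> g = h"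
  using \<psi>_\<phi> by metis

lemma \<phi>_image_units: "\<phi> ` units G = units K"
proof
  interpret S: cantor_groupoid_iso K G \<psi> \<phi> by (rule swap_iso)
  show "units K \<subseteq> \<phi> ` units G"
    using S.\<phi>_units S.\<psi>_\<phi> K.units_arrows by (metis image_eqI subsetI)
qed (use \<phi>_units in auto)

lemma \<phi>_image_bis:
  assumes U: "U \<in> carrier (bis_group G)" shows "\<phi> ` U \<in> carrier (bis_group K)"
proof (rule K.bis_groupI)
  note UD = G.bis_groupD[OF U]
  have "homeomorphic_map (arr_top G) (arr_top K) \<phi>" using homeo homeomorphic_map_maps by blast
  then show "openin (arr_top K) (\<phi> ` U)"
    using UD(1) homeomorphic_imp_open_map open_map_def by blast
  have r: "rng K (\<phi> g) = \<phi> (rng G g)" and s: "src K (\<phi> g) = \<phi> (src G g)" if "g \<in> U" for g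
    using that UD(2) \<phi>_rng \<phi>_src by auto
  show "inj_on (rng K) (\<phi> ` U)"
  proof (rule inj_onI)
    fix y z assume "y \<in> \<phi> ` U" "z \<in> \<phi> ` U" and e: "rng K y = rng K z"
    then obtain g h where gh: "g \<in> U" "y = \<phi> g" "h \<in> U" "z = \<phi> h" by blast
    then have "\<phi> (rng G g) = \<phi> (rng G h)" using e r by simp
    then have "rng G g = rng G h"
      using \<phi>_inject[OF G.rng_closed G.rng_closed] gh UD(2) by blast
    then show "y = z" using inj_onD[OF UD(3)] gh by blast
  qed
  show "inj_on (src K) (\<phi> ` U)"
  proof (rule inj_onI)
    fix y z assume "y \<in> \<phi> ` U" "z \<in> \<phi> ` U" and e: "src K y = src K z"
    then obtain g h where gh: "g \<in> U" "y = \<phi> g" "h \<in> U" "z = \<phi> h" by blast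
    then have "\<phi> (src G g) = \<phi> (src G h)" using e s by simp
    then have "src G g = src G h"
      using \<phi>_inject[OF G.src_closed G.src_closed] gh UD(2) by blast
    then show "y = z" using inj_onD[OF UD(4)] gh by blast
  qed
  have "src K ` \<phi> ` U = \<phi> ` src G ` U" "rng K ` \<phi> ` U = \<phi> ` rng G ` U"
    unfolding image_image using r s by (auto intro: image_cong)
  then show "src K ` \<phi> ` U = units K" "rng K ` \<phi> ` U = units K"
    using UD(5,6) \<phi>_image_units by simp_all
qed

lemma \<phi>_image_mult:
  assumes "U \<subseteq> arrows G" "V \<subseteq> arrows G"
  shows "\<phi> ` bis_mult G U V = bis_mult K (\<phi> ` U) (\<phi> ` V)"
proof (intro equalityI subsetI)
  fix k assume "k \<in> \<phi> ` bis_mult G U V"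
  then obtain g h where gh: "g \<in> U" "h \<in> V" "src G g = rng G h" "k = \<phi> (gmult G g h)"
    unfolding bis_mult_def by blast
  then have A: "g \<in> arrows G" "h \<in> arrows G" using assms by auto
  then show "k \<in> bis_mult K (\<phi> ` U) (\<phi> ` V)"
    using gh \<phi>_mult[OF A gh(3)] by (auto intro!: bis_multI)
next
  fix k assume "k \<in> bis_mult K (\<phi> ` U) (\<phi> ` V)"
  then obtain g h where gh: "g \<in> U" "h \<in> V" "src K (\<phi> g) = rng K (\<phi> h)" "k = gmult K (\<phi> g) (\<phi> h)"
    unfolding bis_mult_def by blast
  then have A: "g \<in> arrows G" "h \<in> arrows G" using assms by auto
  then have "\<phi> (src G g) = \<phi> (rng G h)" using gh \<phi>_src \<phi>_rng by simp
  then have e: "src G g = rng G h" using \<phi>_inject A G.src_closed G.rng_closed by blast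
  then have "k = \<phi> (gmult G g h)" using \<phi>_mult[OF A e] gh by simp
  then show "k \<in> \<phi> ` bis_mult G U V" using bis_multI[of g U h V G] gh e by simp
qed

lemma \<psi>_image_\<phi>_image: "U \<subseteq> arrows G \<Longrightarrow> \<psi> ` \<phi> ` U = U"
  using \<psi>_\<phi> by (force simp: image_image)

lemma image_iso: "image \<phi> \<in> iso (bis_group G) (bis_group K)"
proof (rule isoI)
  interpret S: cantor_groupoid_iso K G \<psi> \<phi> by (rule swap_iso)
  show "image \<phi> \<in> hom (bis_group G) (bis_group K)"
    by (rule homI) (simp_all add: \<phi>_image_bis \<phi>_image_mult G.bis_groupD(2))
  show "bij_betw (image \<phi>) (carrier (bis_group G)) (carrier (bis_group K))"
    by (rule bij_betw_byWitness[where f' = "image \<psi>"])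
      (use \<psi>_image_\<phi>_image S.\<psi>_image_\<phi>_image \<phi>_image_bis S.\<phi>_image_bis G.bis_groupD(2) K.bis_groupD(2) in auto)
qed

lemma homeomorphic_composable:
  "homeomorphic_maps (composable_space G) (composable_space K) (\<lambda>(g, h). (\<phi> g, \<phi> h)) (\<lambda>(g, h). (\<psi> g, \<psi> h))"
  unfolding composable_space_def
proof (rule homeomorphic_maps_subtopologies_alt)
  show "homeomorphic_maps (prod_topology (arr_top G) (arr_top G)) (prod_topology (arr_top K) (arr_top K))
      (\<lambda>(g, h). (\<phi> g, \<phi> h)) (\<lambda>(g, h). (\<psi> g, \<psi> h))"
    using homeo by (simp add: homeomorphic_maps_prod)
  show "(\<lambda>(g, h). (\<phi> g, \<phi> h)) ` (topspace (prod_topology (arr_top G) (arr_top G)) \<inter> composable G) \<subseteq> composable K"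
    using hom by (auto simp: groupoid_hom_def)
  show "(\<lambda>(g, h). (\<psi> g, \<psi> h)) ` (topspace (prod_topology (arr_top K) (arr_top K)) \<inter> composable K) \<subseteq> composable G"
    using hom' by (auto simp: groupoid_hom_def)
qed

section \<open>Boundaries under a groupoid isomorphism\<close>

text \<open>The value \<open>0\<close> off the arrows restores the convention by which functions on
  a space are coded.\<close>

definition transport :: "('a \<Rightarrow> int) \<Rightarrow> 'b \<Rightarrow> int" where
  "transport f y = (if y \<in> arrows K then f (\<psi> y) else 0)"

end

text \<open>The faces take values in the arrows, so all other fibres are empty. Boundaries therefore
  survive the cut-off in \<open>transport\<close>, which becomes invertible on them.\<close>

lemma (in cantor_groupoid) boundary_outside:
  assumes "f \<in> boundaries1 G" "x \<notin> arrows G" shows "f x = 0"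
proof -
  obtain k where k: "f = delta2 G k" using assms by (auto simp: boundaries1_def)
  have z: "pushforward (composable_space G) p k x = 0" if "p ` composable G \<subseteq> arrows G" for p
  proof -
    have "{y \<in> topspace (composable_space G). p y = x \<and> k y \<noteq> 0} = {}" using that assms(2) by auto
    then show ?thesis unfolding pushforward_def by (simp only: sum.empty)
  qed
  have "snd ` composable G \<subseteq> arrows G" "fst ` composable G \<subseteq> arrows G"
    "(\<lambda>(g, h). gmult G g h) ` composable G \<subseteq> arrows G"
    by (auto simp: composable_iff)
  then show ?thesis unfolding k delta2_def by (simp add: z)
qed

context cantor_groupoid_iso
begin

text \<open>The coordinatewise map on composable pairs intertwines each face with \<phi>, so
  \<open>transport\<close> commutes with \<open>delta2\<close> at arrows; elsewhere both sides
  vanish.\<close>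

lemma transport_boundary:
  assumes f: "f \<in> boundaries1 G" shows "transport f \<in> boundaries1 K"
proof -
  interpret S: cantor_groupoid_iso K G \<psi> \<phi> by (rule swap_iso)
  obtain k where k: "k \<in> carrier (Cc_group (composable_space G))" "f = delta2 G k"
    using f by (auto simp: boundaries1_def)
  define k' where "k' = (\<lambda>y. if y \<in> topspace (composable_space K) then k ((\<lambda>(g, h). (\<psi> g, \<psi> h)) y) else 0)"
  have k': "k' \<in> carrier (Cc_group (composable_space K))"
    unfolding k'_def by (rule Cc_transport[OF homeomorphic_composable k(1)])
  then have b: "delta2 K k' \<in> boundaries1 K" by (auto simp: boundaries1_def)
  have "delta2 K k' z = transport f z" for z
  proof (cases "z \<in> arrows K")
    case True
    then have z: "\<phi> (\<psi> z) = z" using S.\<psi>_\<phi> by simp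
    have push: "pushforward (composable_space K) p' k' z = pushforward (composable_space G) p k (\<psi> z)"
      if "\<And>y. y \<in> topspace (composable_space G) \<Longrightarrow> p' ((\<lambda>(g, h). (\<phi> g, \<phi> h)) y) = \<phi> (p y)"
        "\<And>y. y \<in> topspace (composable_space G) \<Longrightarrow> p y \<in> arrows G" for p p'
      unfolding k'_def
      by (rule pushforward_transport[OF homeomorphic_composable, where \<phi> = \<phi>]) (use that \<psi>_\<phi> z in auto)
    have "delta2 K k' z = delta2 G k (\<psi> z)"
      unfolding delta2_def
      by (intro arg_cong2[where f = "(+)"] arg_cong2[where f = "(-)"] push)
        (auto simp: G.composable_iff \<phi>_mult)
    then show ?thesis using True k by (simp add: transport_def)
  next
    case False
    then show ?thesis using K.boundary_outside[OF b] by (simp add: transport_def)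
  qed
  then have "delta2 K k' = transport f" by (simp add: fun_eq_iff)
  then show ?thesis using b by simp
qed

lemma transport_boundaries: "transport ` boundaries1 G = boundaries1 K"
proof (intro equalityI subsetI)
  interpret S: cantor_groupoid_iso K G \<psi> \<phi> by (rule swap_iso)
  fix f assume f: "f \<in> boundaries1 K"
  have "transport (S.transport f) = f"
    using K.boundary_outside[OF f] S.\<psi>_\<phi> S.\<phi>_arrows by (auto simp: fun_eq_iff transport_def S.transport_def)
  then show "f \<in> transport ` boundaries1 G" using S.transport_boundary[OF f] by (metis imageI)
qed (use transport_boundary in auto)

lemma transport_indicator:
  assumes "U \<subseteq> arrows G" shows "transport (indicator U) = indicator (\<phi> ` U)"
proof
  interpret S: cantor_groupoid_iso K G \<psi> \<phi> by (rule swap_iso)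
  fix y
  have "y \<in> \<phi> ` U \<longleftrightarrow> y \<in> arrows K \<and> \<psi> y \<in> U"
    using assms \<phi>_arrows \<psi>_\<phi> S.\<psi>_\<phi> by (metis image_iff subsetD)
  then show "transport (indicator U) y = indicator (\<phi> ` U) y"
    by (auto simp: transport_def indicator_def)
qed

lemma \<phi>_image_kernel:
  assumes U: "U \<in> G.bis_kernel" shows "\<phi> ` U \<in> K.bis_kernel"
proof -
  have UB: "U \<in> carrier (bis_group G)"
    and e: "(\<lambda>f y. f y + indicator U y) ` boundaries1 G = boundaries1 G"
    using U by (auto simp: G.bis_kernel_def)
  have UA: "U \<subseteq> arrows G" using G.bis_groupD(2)[OF UB] .
  \<comment> \<open>\<open>transport\<close> carries translation by the indicator of
    \<open>U\<close> to translation by the indicator of its image, so invariance of the boundaries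
    carries over.\<close>
  have t: "(\<lambda>y. transport f y + indicator (\<phi> ` U) y) = transport (\<lambda>y. f y + indicator U y)" for f
    unfolding transport_indicator[OF UA, symmetric] by (auto simp: fun_eq_iff transport_def)
  have "(\<lambda>f y. f y + indicator (\<phi> ` U) y) ` boundaries1 K
      = (\<lambda>f. transport (\<lambda>y. f y + indicator U y)) ` boundaries1 G"
    unfolding transport_boundaries[symmetric] image_image t by (rule refl)
  also have "\<dots> = transport ` (\<lambda>f y. f y + indicator U y) ` boundaries1 G"
    by (simp only: image_image)
  also have "\<dots> = boundaries1 K" unfolding e transport_boundaries by (rule refl)
  finally show ?thesis using \<phi>_image_bis[OF UB] by (simp add: K.bis_kernel_def)
qed

lemma image_kernel: "image \<phi> ` G.bis_kernel = K.bis_kernel"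
proof (intro equalityI subsetI)
  interpret S: cantor_groupoid_iso K G \<psi> \<phi> by (rule swap_iso)
  fix V assume V: "V \<in> K.bis_kernel"
  then have "V \<subseteq> arrows K" using K.bis_groupD(2) by (auto simp: K.bis_kernel_def)
  then show "V \<in> image \<phi> ` G.bis_kernel"
    using S.\<phi>_image_kernel[OF V] S.\<psi>_image_\<phi>_image by (metis imageI)
qed (use \<phi>_image_kernel in auto)

end

section \<open>Passing to the three groups of homeomorphisms\<close>

lemma iso_groups_iff:
  assumes A: "group A" "A \<cong> A'" and B: "group B" "B \<cong> B'"
  shows "A' \<cong> B' \<longleftrightarrow> A \<cong> B"
proof
  assume "A' \<cong> B'"
  with A(2) have "A \<cong> B'" by (rule iso_trans)
  then show "A \<cong> B" using group.iso_sym[OF B] by (rule iso_trans)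
next
  assume "A \<cong> B"
  with group.iso_sym[OF A] have "A' \<cong> B" by (rule iso_trans)
  then show "A' \<cong> B'" using B(2) by (rule iso_trans)
qed

theorem theorem3p10:
  fixes G1 :: "'a top_groupoid" and G2 :: "'b top_groupoid"
  assumes "etale_groupoid G1" and "essentially_principal G1"
    and "cantor_set (unit_space G1)" and "minimal_groupoid G1"
    and "etale_groupoid G2" and "essentially_principal G2"
    and "cantor_set (unit_space G2)" and "minimal_groupoid G2"
  shows "(etale_isomorphic G1 G2 \<longleftrightarrow> full_group G1 \<cong> full_group G2) \<and>
         (etale_isomorphic G1 G2 \<longleftrightarrow> full_group0 G1 \<cong> full_group0 G2) \<and>
         (etale_isomorphic G1 G2 \<longleftrightarrow>
            commutator_subgroup (full_group G1) \<cong> commutator_subgroup (full_group G2))"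
proof -
  interpret G: cantor_groupoid G1
    using assms by (simp add: cantor_groupoid_def cantor_groupoid_axioms_def)
  interpret K: cantor_groupoid G2
    using assms by (simp add: cantor_groupoid_def cantor_groupoid_axioms_def)
  let ?B1 = "bis_group G1" and ?B2 = "bis_group G2"
  \<comment> \<open>One argument serves all three groups, each being a copy of a bisection subgroup
    that contains the commutators. For the step from groupoids to groups, \<open>img\<close> records
    that the subgroup is carried to its counterpart by every groupoid isomorphism.\<close>
  have main: "etale_isomorphic G1 G2 \<longleftrightarrow> A \<cong> B"
    if iso: "?B1\<lparr>carrier := H\<rparr> \<cong> A" "?B2\<lparr>carrier := L\<rparr> \<cong> B"
      and H: "subgroup H ?B1" "derived ?B1 (carrier ?B1) \<subseteq> H"
      and L: "subgroup L ?B2" "derived ?B2 (carrier ?B2) \<subseteq> L"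
      and img: "\<And>\<phi> \<psi>. cantor_groupoid_iso G1 G2 \<phi> \<psi> \<Longrightarrow> image \<phi> ` H = L"
    for H L and A :: "('a \<Rightarrow> 'a) monoid" and B :: "('b \<Rightarrow> 'b) monoid"
  proof -
    have "A \<cong> B \<longleftrightarrow> ?B1\<lparr>carrier := H\<rparr> \<cong> ?B2\<lparr>carrier := L\<rparr>"
      by (rule iso_groups_iff[OF G.bis.subgroup_imp_group[OF H(1)] iso(1)
            K.bis.subgroup_imp_group[OF L(1)] iso(2)])
    also have "\<dots> \<longleftrightarrow> etale_isomorphic G1 G2"
    proof
      assume "?B1\<lparr>carrier := H\<rparr> \<cong> ?B2\<lparr>carrier := L\<rparr>"
      then show "etale_isomorphic G1 G2"
        by (rule etale_isomorphic_if_bis_subgroups_iso[OF G.cantor_groupoid_axioms K.cantor_groupoid_axioms H L])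
    next
      assume "etale_isomorphic G1 G2"
      then obtain \<phi> \<psi> where *: "cantor_groupoid_iso G1 G2 \<phi> \<psi>"
        unfolding etale_isomorphic_def cantor_groupoid_iso_def cantor_groupoid_iso_axioms_def
        using G.cantor_groupoid_axioms K.cantor_groupoid_axioms by blast
      show "?B1\<lparr>carrier := H\<rparr> \<cong> ?B2\<lparr>carrier := L\<rparr>"
        using iso_restrict[OF cantor_groupoid_iso.image_iso[OF *] G.group_bis K.group_bis H(1)]
        unfolding img[OF *] by (rule is_isoI)
    qed
    finally show ?thesis by blast
  qed
  have self: "?B1\<lparr>carrier := carrier ?B1\<rparr> \<cong> full_group G1" "?B2\<lparr>carrier := carrier ?B2\<rparr> \<cong> full_group G2"
    using is_isoI[OF G.pi_map_iso] is_isoI[OF K.pi_map_iso] by simp_all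
  have img: "image \<phi> ` carrier ?B1 = carrier ?B2" if "cantor_groupoid_iso G1 G2 \<phi> \<psi>" for \<phi> \<psi>
    using cantor_groupoid_iso.image_iso[OF that] by (simp add: iso_def bij_betw_def)
  have img': "image \<phi> ` derived ?B1 (carrier ?B1) = derived ?B2 (carrier ?B2)"
    if "cantor_groupoid_iso G1 G2 \<phi> \<psi>" for \<phi> \<psi>
  proof -
    interpret h: group_hom ?B1 ?B2 "image \<phi>"
      using cantor_groupoid_iso.image_iso[OF that] G.group_bis K.group_bis
      by (simp add: group_hom_def group_hom_axioms_def iso_def)
    show ?thesis using h.derived_img[OF subset_refl] img[OF that] by simp
  qed
  have "etale_isomorphic G1 G2 \<longleftrightarrow> full_group G1 \<cong> full_group G2"
    by (rule main[OF self G.bis.subgroup_self G.bis.derived_in_carrier[OF subset_refl]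
          K.bis.subgroup_self K.bis.derived_in_carrier[OF subset_refl] img])
  moreover have "etale_isomorphic G1 G2 \<longleftrightarrow> full_group0 G1 \<cong> full_group0 G2"
    by (rule main[OF G.full_group0_iso K.full_group0_iso G.subgroup_bis_kernel
          G.derived_subset_bis_kernel K.subgroup_bis_kernel K.derived_subset_bis_kernel
          cantor_groupoid_iso.image_kernel])
  moreover have "etale_isomorphic G1 G2 \<longleftrightarrow>
      commutator_subgroup (full_group G1) \<cong> commutator_subgroup (full_group G2)"
    by (rule main[OF G.commutator_full_group K.commutator_full_group
          G.bis.derived_is_subgroup[OF subset_refl] subset_refl
          K.bis.derived_is_subgroup[OF subset_refl] subset_refl img'])
  ultimately show ?thesis by blast
qed

end
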